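(* Let $\gamma\subset\mathbb R^2$ be a local $C^\infty$-smooth planar curve (a small representative of a germ of planar curve), and let $\Pi$ be a corresponding domain in the space of oriented lines in $\mathbb R^2$. Then the Lie algebra generated by the vector fields $v_f$, $f\in C^\infty(\gamma)$, is dense in the Lie algebra of symplectic vector fields on $\Pi$ (in the $C^\infty$-topology of uniform convergence with all derivatives on compact subsets).
   Context: Setting. $\gamma$ is an arbitrarily small contractible neighborhood of a point in a $C^\infty$-smooth planar curve, parametrized by an interval. $\Pi$ is a fixed domain in the space of oriented lines in $\mathbb R^2$ such that each $L\in\Pi$ intersects $\gamma$ transversally at one point $x=x(L)$. Let $w=w(L)\in T_x\gamma$ be the orthogonal projection to $T_x\gamma$ of the unit directing vector of $L$ at $x$. The tangent lines $T_x\gamma$ are identified by projecting them orthogonally to an appropriate coordinate axis, and $\Pi$ is chosen so that $L\mapsto(x,w)$ is a diffeomorphism of $\Pi$ onto a contractible domain in $\mathbb R^{2}$. The canonical symplectic form of the space of oriented lines is, on $\Pi$, the pullback under $L\mapsto(x(L),w(L))\in T_{<1}\gamma=\{(x,w)\in T\gamma:\|w\|<1\}$ of $\omega=d\alpha$, where $\alpha(v)=\langle w,\pi_*v\rangle$ for $v\in T_{(x,w)}(T\gamma)$ and $\pi:T\gamma\to\gamma$ is the projection. A vector field $X$ is symplectic if $L_X\omega=0$. Reflection and deformations. Let $\vec N$ be the unit normal field on $\gamma$ with $\langle u,\vec N\rangle>0$ for the directing vectors $u$ of lines of $\Pi$. The reflection $\mathcal T_\gamma$ sends an oriented line crossing $\gamma$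 transversally at $x$ with unit directing vector $u$ to the line through $x$ with directing vector $u-2\langle u,\vec N(x)\rangle\vec N(x)$. For $f\in C^\infty(\gamma)$ set $\gamma_{\varepsilon,f}=\{x+\varepsilon f(x)\vec N(x):x\in\gamma\}$, $\Delta\mathcal T_{\varepsilon,f}=\mathcal T_{\gamma_{\varepsilon,f}}^{-1}\circ\mathcal T_\gamma$ (reflection at intersection points close to $x(L)$, so that $\Delta\mathcal T_{0,f}=\mathrm{Id}$), $v_f=\frac{d}{d\varepsilon}\Delta\mathcal T_{\varepsilon,f}|_{\varepsilon=0}$. On each compact subset of $\Pi$, $\Delta\mathcal T_{\varepsilon,f}$ is well-defined for all small $\varepsilon$, so $v_f$ is a vector field on $\Pi$. *)

theory Defs
  imports "HOL-Analysis.Analysis"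
begin

section \<open>Smooth maps between Euclidean spaces\<close>

text \<open>Iterated partial derivatives; for an open set \<open>S\<close> the values on \<open>S\<close> depend only on the
  values of the function on \<open>S\<close>.\<close>

primrec partials :: "'a::euclidean_space list \<Rightarrow> ('a \<Rightarrow> 'b::real_normed_vector) \<Rightarrow> 'a \<Rightarrow> 'b" where
  "partials [] F = F"
| "partials (i # is) F = (\<lambda>z. frechet_derivative (partials is F) (at z) i)"

definition smooth_on :: "'a::euclidean_space set \<Rightarrow> ('a \<Rightarrow> 'b::real_normed_vector) \<Rightarrow> bool" where
  "smooth_on S F \<longleftrightarrow>
     (\<forall>is. set is \<subseteq> Basis \<longrightarrow> (\<forall>z\<in>S. partials is F differentiable (at z)))"

text \<open>Smoothness on an arbitrary subset of a Euclidean space (used for the cylinder of oriented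
  lines): existence of local smooth extensions.\<close>

definition smooth_map_on :: "'a::euclidean_space set \<Rightarrow> ('a \<Rightarrow> 'b::real_normed_vector) \<Rightarrow> bool" where
  "smooth_map_on S F \<longleftrightarrow>
     (\<forall>z\<in>S. \<exists>U G. open U \<and> z \<in> U \<and> smooth_on U G \<and> (\<forall>y\<in>S \<inter> U. G y = F y))"

definition diffeomorphism ::
  "'a::euclidean_space set \<Rightarrow> 'b::euclidean_space set \<Rightarrow> ('a \<Rightarrow> 'b) \<Rightarrow> bool" where
  "diffeomorphism S T \<phi> \<longleftrightarrow>
     bij_betw \<phi> S T \<and> smooth_map_on S \<phi> \<and> smooth_map_on T (the_inv_into S \<phi>)"


section \<open>Vector fields and forms on open sets\<close>

text \<open>A vector field on an open set \<open>D\<close> is a function on the whole space of which only the values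
  on \<open>D\<close> matter.  Forms are evaluated on constant vectors.\<close>

definition lie_bracket ::
  "('a::euclidean_space \<Rightarrow> 'a) \<Rightarrow> ('a \<Rightarrow> 'a) \<Rightarrow> 'a \<Rightarrow> 'a" where
  "lie_bracket X Y z =
     frechet_derivative Y (at z) (X z) - frechet_derivative X (at z) (Y z)"

inductive_set generated_lie_algebra ::
  "('a::euclidean_space \<Rightarrow> 'a) set \<Rightarrow> ('a \<Rightarrow> 'a) set" for G where
  generator: "X \<in> G \<Longrightarrow> X \<in> generated_lie_algebra G"
| zero: "(\<lambda>z. 0) \<in> generated_lie_algebra G"
| add: "X \<in> generated_lie_algebra G \<Longrightarrow> Y \<in> generated_lie_algebra G \<Longrightarrow>
    (\<lambda>z. X z + Y z) \<in> generated_lie_algebra G"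
| scale: "X \<in> generated_lie_algebra G \<Longrightarrow> (\<lambda>z. r *\<^sub>R X z) \<in> generated_lie_algebra G"
| bracket: "X \<in> generated_lie_algebra G \<Longrightarrow> Y \<in> generated_lie_algebra G \<Longrightarrow>
    lie_bracket X Y \<in> generated_lie_algebra G"

definition exterior_derivative ::
  "('a::euclidean_space \<Rightarrow> 'a \<Rightarrow> real) \<Rightarrow> 'a \<Rightarrow> 'a \<Rightarrow> 'a \<Rightarrow> real" where
  "exterior_derivative \<alpha> z v w =
     frechet_derivative (\<lambda>y. \<alpha> y w) (at z) v - frechet_derivative (\<lambda>y. \<alpha> y v) (at z) w"

text \<open>For constant vector fields \<open>v, w\<close> one has \<open>[X, v] = - DX(v)\<close>, whence the signs in
  \<open>(L\<^sub>X \<omega>)(v, w) = X(\<omega>(v, w)) - \<omega>([X, v], w) - \<omega>(v, [X, w])\<close>.\<close>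

definition lie_derivative_2form ::
  "('a::euclidean_space \<Rightarrow> 'a) \<Rightarrow> ('a \<Rightarrow> 'a \<Rightarrow> 'a \<Rightarrow> real) \<Rightarrow> 'a \<Rightarrow> 'a \<Rightarrow> 'a \<Rightarrow> real" where
  "lie_derivative_2form X \<omega> z v w =
     frechet_derivative (\<lambda>y. \<omega> y v w) (at z) (X z)
     + \<omega> z (frechet_derivative X (at z) v) w
     + \<omega> z v (frechet_derivative X (at z) w)"

definition symplectic_fields ::
  "'a::euclidean_space set \<Rightarrow> ('a \<Rightarrow> 'a \<Rightarrow> 'a \<Rightarrow> real) \<Rightarrow> ('a \<Rightarrow> 'a) set" where
  "symplectic_fields D \<omega> =
     {X. smooth_on D X \<and> (\<forall>z\<in>D. \<forall>v w. lie_derivative_2form X \<omega> z v w = 0)}"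

text \<open>Density in the topology of uniform convergence with all derivatives on compact subsets of
  \<open>D\<close>: \<open>A\<close> is contained in \<open>B\<close> and meets every basic neighbourhood of every element of \<open>B\<close>.\<close>

definition C_infinity_dense ::
  "'a::euclidean_space set \<Rightarrow> ('a \<Rightarrow> 'b::real_normed_vector) set \<Rightarrow> ('a \<Rightarrow> 'b) set \<Rightarrow> bool" where
  "C_infinity_dense D A B \<longleftrightarrow>
     A \<subseteq> B \<and>
     (\<forall>X\<in>B. \<forall>K k. \<forall>\<epsilon>>0. compact K \<longrightarrow> K \<subseteq> D \<longrightarrow>
        (\<exists>Y\<in>A. \<forall>is. set is \<subseteq> Basis \<longrightarrow> length is \<le> k \<longrightarrow>
           (\<forall>z\<in>K. norm (partials is Y z - partials is X z) < \<epsilon>)))"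


section \<open>Oriented lines and reflections\<close>

type_synonym plane = "real \<times> real"

definition rot90 :: "plane \<Rightarrow> plane" where
  "rot90 v = (- snd v, fst v)"

text \<open>The oriented line with unit directing vector \<open>u\<close> and signed distance \<open>p\<close> from the origin is
  the pair \<open>(u, p)\<close>; the space of oriented lines is thus a cylinder in \<open>\<real>\<^sup>2 \<times> \<real>\<close>.\<close>

type_synonym oriented_line = "plane \<times> real"

definition oriented_lines :: "oriented_line set" where
  "oriented_lines = sphere 0 1 \<times> UNIV"

abbreviation direction :: "oriented_line \<Rightarrow> plane" where
  "direction L \<equiv> fst L"

definition points :: "oriented_line \<Rightarrow> plane set" where
  "points L = {y. y \<bullet> rot90 (direction L) = snd L}"

definition line_through :: "plane \<Rightarrow> plane \<Rightarrow> oriented_line" where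
  "line_through y u = (u, y \<bullet> rot90 u)"

text \<open>A planar curve is given by a parametrization.  The orientation of the normal is immaterial
  for the reflection.\<close>

abbreviation velocity :: "(real \<Rightarrow> plane) \<Rightarrow> real \<Rightarrow> plane" where
  "velocity g s \<equiv> vector_derivative g (at s)"

definition normal :: "(real \<Rightarrow> plane) \<Rightarrow> real \<Rightarrow> plane" where
  "normal g s = rot90 (velocity g s) /\<^sub>R norm (velocity g s)"

definition lines_crossing :: "(real \<Rightarrow> plane) \<Rightarrow> real \<Rightarrow> oriented_line set" where
  "lines_crossing g s =
     {L \<in> oriented_lines. g s \<in> points L \<and> direction L \<bullet> normal g s \<noteq> 0}"

definition reflection :: "(real \<Rightarrow> plane) \<Rightarrow> real \<Rightarrow> oriented_line \<Rightarrow> oriented_line" where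
  "reflection g s L =
     line_through (g s)
       (direction L - (2 * (direction L \<bullet> normal g s)) *\<^sub>R normal g s)"


section \<open>Deformations of a curve\<close>

text \<open>Throughout, \<open>c\<close> is a parametrization of the curve by the interval \<open>I\<close>, \<open>N\<close> its unit normal
  field and \<open>f\<close> a function on it; \<open>N\<close> and \<open>f\<close> are functions of the points of the curve.\<close>

definition deformed ::
  "(real \<Rightarrow> plane) \<Rightarrow> (plane \<Rightarrow> plane) \<Rightarrow> (plane \<Rightarrow> real) \<Rightarrow> real \<Rightarrow> real \<Rightarrow> plane" where
  "deformed c N f \<epsilon> s = c s + (\<epsilon> * f (c s)) *\<^sub>R N (c s)"

definition crossing_parameter :: "real set \<Rightarrow> (real \<Rightarrow> plane) \<Rightarrow> oriented_line \<Rightarrow> real" where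
  "crossing_parameter I c L = (THE t. t \<in> I \<and> c t \<in> points L)"

definition closest_crossing :: "real set \<Rightarrow> (real \<Rightarrow> plane) \<Rightarrow> oriented_line \<Rightarrow> real \<Rightarrow> real" where
  "closest_crossing I g L t = (ARG_MIN (\<lambda>s. dist s t) s. s \<in> I \<and> g s \<in> points L)"

text \<open>Reflect in the curve at the crossing point of \<open>L\<close>, then apply the inverse of the reflection
  in the deformed curve, at the intersection point of the reflected line with the deformed curve
  that is close to the crossing point.  Closeness is measured in the parameter: a wild \<open>f\<close> may
  bring remote parts of the deformed curve near the crossing point for all small \<open>\<epsilon>\<close>.\<close>

definition deformation_map ::
  "real set \<Rightarrow> (real \<Rightarrow> plane) \<Rightarrow> (plane \<Rightarrow> plane) \<Rightarrow> (plane \<Rightarrow> real) \<Rightarrow> real \<Rightarrow>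
   oriented_line \<Rightarrow> oriented_line" where
  "deformation_map I c N f \<epsilon> L =
     (let t = crossing_parameter I c L;
          R = reflection c t L;
          g = deformed c N f \<epsilon>;
          s = closest_crossing I g R t
      in inv_into (lines_crossing g s) (reflection g s) R)"


section \<open>The coordinates (x, w)\<close>

text \<open>The point \<open>x\<close> is recorded by its parameter, and the tangent vector \<open>w\<close> by its orthogonal
  projection to the coordinate axis spanned by the basis vector \<open>e\<close>.\<close>

definition tangential_part :: "(real \<Rightarrow> plane) \<Rightarrow> real \<Rightarrow> plane \<Rightarrow> plane" where
  "tangential_part c t u =
     ((u \<bullet> velocity c t) / (velocity c t \<bullet> velocity c t)) *\<^sub>R velocity c t"

definition xw_chart ::
  "real set \<Rightarrow> (real \<Rightarrow> plane) \<Rightarrow> plane \<Rightarrow> oriented_line \<Rightarrow> real \<times> real" where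
  "xw_chart I c e L =
     (let t = crossing_parameter I c L
      in (t, tangential_part c t (direction L) \<bullet> e))"

text \<open>The vector \<open>w\<close> tangent to the curve at \<open>c t\<close> with \<open>w \<bullet> e = q\<close>, where \<open>z = (t, q)\<close>.\<close>

definition tangent_vector :: "(real \<Rightarrow> plane) \<Rightarrow> plane \<Rightarrow> real \<times> real \<Rightarrow> plane" where
  "tangent_vector c e z = (snd z / (velocity c (fst z) \<bullet> e)) *\<^sub>R velocity c (fst z)"

definition liouville_form ::
  "(real \<Rightarrow> plane) \<Rightarrow> plane \<Rightarrow> real \<times> real \<Rightarrow> real \<times> real \<Rightarrow> real" where
  "liouville_form c e z v = tangent_vector c e z \<bullet> (fst v *\<^sub>R velocity c (fst z))"

definition deformation_field ::
  "real set \<Rightarrow> (real \<Rightarrow> plane) \<Rightarrow> (plane \<Rightarrow> plane) \<Rightarrow> plane \<Rightarrow> oriented_line set \<Rightarrow>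
   (plane \<Rightarrow> real) \<Rightarrow> real \<times> real \<Rightarrow> real \<times> real" where
  "deformation_field I c N e P f z =
     vector_derivative
       (\<lambda>\<epsilon>. xw_chart I c e
          (deformation_map I c N f \<epsilon> (the_inv_into P (xw_chart I c e) z))) (at 0)"

end

theory Submission
  imports Defs "HOL-Complex_Analysis.Riemann_Mapping"
begin

text \<open>
  Write \<open>(s, q)\<close> for the coordinates of a line, \<open>s\<close> being the parameter of its crossing point with the
  curve, and \<open>\<theta>\<close> for the angle between the line and the normal.  The signed length of the vector \<open>w\<close> is
  \<open>sin \<theta>\<close>, a function of \<open>s\<close> times \<open>q\<close>, and the symplectic form is a nowhere vanishing multiple of the area
  form in the coordinates \<open>(s, q)\<close>.  A symplectic field is therefore a field whose product with the
  density is divergence free, and since the domain is contractible it has a Hamiltonian.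

  Differentiating the reflection law at \<open>\<epsilon> = 0\<close> shows that the deformation field of \<open>f\<close> has the
  Hamiltonian \<open>-2 f cos \<theta>\<close> (\<open>deformation_field_eq_hamiltonian_field\<close>).  The Lie bracket of Hamiltonian
  fields corresponds to the Poisson bracket (\<open>lie_bracket_hamiltonian_fields\<close>), and the Poisson
  bracket of \<open>F(s) \<phi>(sin \<theta>)\<close> with \<open>cos \<theta>\<close> is \<open>- F'(s) \<phi>(sin \<theta>) tan \<theta>\<close> divided by the speed of the curve
  (\<open>poisson_bracket_with_cosine\<close>).  As every smooth function on an interval is a derivative, one bracket
  with \<open>cos \<theta>\<close> multiplies by \<open>tan \<theta>\<close> with no loss in the coefficient.  Hence the Hamiltonians
  \<open>F(s) cos \<theta> tan\<^sup>k \<theta>\<close> for all \<open>k\<close> and all smooth \<open>F\<close> occur (\<open>cosine_slope_powers_generated\<close>).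

  These suffice.  In the coordinates \<open>(s, tan \<theta>)\<close> the quotient of a Hamiltonian by \<open>cos \<theta>\<close> is an
  arbitrary smooth function, and near a compact set such a function is a limit, with all
  derivatives, of polynomials in the second variable whose coefficients are smooth functions of the
  first (\<open>smooth_approximation_by_fibrewise_polynomials\<close>): cut the function off and convolve it in the
  second variable with polynomial kernels.

  Two analytic facts are established along the way.  The primitive of a closed one-form on a
  contractible planar domain is found on a disc or the plane, to which the domain is carried by a
  Riemann map (\<open>closed_form_has_primitive\<close>).  The crossing with the deformed curve depends differentiably on \<open>\<epsilon>\<close>
  at \<open>0\<close> because near the old crossing it is the only zero of a slightly perturbed monotone function,
  hence also the closest one (\<open>closest_zero_of_perturbation\<close>).
\<close>

section \<open>Calculus of smooth maps\<close>

lemma partials_append: "partials (is @ js) F = partials is (partials js F)"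
  by (induction "is") auto

lemma partials_eq_derivative:
  "(F has_derivative F') (at z) \<Longrightarrow> partials [i] F z = F' i"
  by (simp add: frechet_derivative_at[symmetric])

lemma frechet_derivative_eq_sum_partials:
  fixes F :: "'a::euclidean_space \<Rightarrow> 'b::real_normed_vector"
  assumes "F differentiable (at z)"
  shows "frechet_derivative F (at z) h = (\<Sum>j\<in>Basis. (h \<bullet> j) *\<^sub>R partials [j] F z)"
proof -
  have "linear (frechet_derivative F (at z))"
    using assms frechet_derivative_works has_derivative_linear by blast
  then have "frechet_derivative F (at z) (\<Sum>j\<in>Basis. (h \<bullet> j) *\<^sub>R j) =
      (\<Sum>j\<in>Basis. (h \<bullet> j) *\<^sub>R partials [j] F z)"
    by (simp add: linear_sum linear_cmul)
  then show ?thesis by (simp add: euclidean_representation)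
qed

lemma partials_add:
  assumes "F differentiable (at z)" "G differentiable (at z)"
  shows "partials [i] (\<lambda>z. F z + G z) z = partials [i] F z + partials [i] G z"
  using partials_eq_derivative[OF has_derivative_add[OF assms[unfolded frechet_derivative_works]]]
  by simp

lemma partials_linear:
  assumes "bounded_linear T" "F differentiable (at z)"
  shows "partials [i] (\<lambda>z. T (F z)) z = T (partials [i] F z)"
  using partials_eq_derivative[OF bounded_linear.has_derivative[OF assms(1) assms(2)[unfolded frechet_derivative_works]]]
  by simp

lemma partials_minus:
  assumes "F differentiable (at z)"
  shows "partials [i] (\<lambda>z. - F z) z = - partials [i] F z"
  by (rule partials_linear[OF bounded_linear_minus[OF bounded_linear_ident] assms])

lemma partials_diff:
  assumes "F differentiable (at z)" "G differentiable (at z)"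
  shows "partials [i] (\<lambda>z. F z - G z) z = partials [i] F z - partials [i] G z"
  using partials_eq_derivative[OF has_derivative_diff[OF assms[unfolded frechet_derivative_works]]]
  by simp

lemma partials_scaleR:
  assumes "g differentiable (at z)" "F differentiable (at z)"
  shows "partials [i] (\<lambda>z. g z *\<^sub>R F z) z = g z *\<^sub>R partials [i] F z + partials [i] g z *\<^sub>R F z"
  using partials_eq_derivative[OF has_derivative_scaleR[OF assms[unfolded frechet_derivative_works]]]
  by simp

lemma partials_mult:
  fixes F G :: "'a::euclidean_space \<Rightarrow> real"
  assumes "F differentiable (at z)" "G differentiable (at z)"
  shows "partials [i] (\<lambda>z. F z * G z) z = F z * partials [i] G z + partials [i] F z * G z"
  using partials_scaleR[OF assms] by simp

lemma partials_Pair: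
  assumes "F differentiable (at z)" "G differentiable (at z)"
  shows "partials [i] (\<lambda>z. (F z, G z)) z = (partials [i] F z, partials [i] G z)"
  using partials_eq_derivative[OF has_derivative_Pair[OF assms[unfolded frechet_derivative_works]]]
  by simp

lemma partials_compose:
  fixes F :: "'a::euclidean_space \<Rightarrow> 'b::euclidean_space"
  assumes "F differentiable (at z)" "\<phi> differentiable (at (F z))"
  shows "partials [i] (\<lambda>z. \<phi> (F z)) z = (\<Sum>j\<in>Basis. (partials [i] F z \<bullet> j) *\<^sub>R partials [j] \<phi> (F z))"
proof -
  have d\<phi>: "(\<phi> has_derivative frechet_derivative \<phi> (at (F z))) (at (F z))"
    using assms frechet_derivative_works by blast
  have dF: "(F has_derivative frechet_derivative F (at z)) (at z)"
    using assms frechet_derivative_works by blast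
  have "partials [i] (\<lambda>z. \<phi> (F z)) z = frechet_derivative \<phi> (at (F z)) (partials [i] F z)"
    using partials_eq_derivative[OF diff_chain_at[OF dF d\<phi>], of i] by (simp add: o_def)
  then show ?thesis unfolding frechet_derivative_eq_sum_partials[OF assms(2)] .
qed

lemma Basis_plane: "(Basis :: (real \<times> real) set) = {(1, 0), (0, 1)}"
  by (auto simp: Basis_prod_def)

lemma Basis_plane_mem [simp]: "(1, 0) \<in> (Basis :: (real \<times> real) set)" "(0, 1) \<in> (Basis :: (real \<times> real) set)"
  by (auto simp: Basis_plane)

lemma frechet_derivative_plane:
  fixes F :: "real \<times> real \<Rightarrow> 'b::real_normed_vector"
  assumes "F differentiable (at z)"
  shows "frechet_derivative F (at z) h = fst h *\<^sub>R partials [(1, 0)] F z + snd h *\<^sub>R partials [(0, 1)] F z"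
  unfolding frechet_derivative_eq_sum_partials[OF assms]
  by (cases h) (simp add: Basis_plane inner_prod_def del: partials.simps)

lemma has_derivative_plane:
  fixes F :: "real \<times> real \<Rightarrow> 'b::real_normed_vector"
  assumes "F differentiable (at z)"
  shows "(F has_derivative (\<lambda>h. fst h *\<^sub>R partials [(1, 0)] F z + snd h *\<^sub>R partials [(0, 1)] F z)) (at z)"
  using assms unfolding frechet_derivative_works by (simp only: ext[OF frechet_derivative_plane[OF assms]])

text \<open>Recursion on the order of differentiability makes the closure properties inductions: the first
  derivatives of a product or a composite are built from functions of one order less.\<close>

primrec differentiable_times ::
  "nat \<Rightarrow> 'a::euclidean_space set \<Rightarrow> ('a \<Rightarrow> 'b::real_normed_vector) \<Rightarrow> bool" where
  "differentiable_times 0 S F \<longleftrightarrow> (\<forall>z\<in>S. F differentiable (at z))"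
| "differentiable_times (Suc n) S F \<longleftrightarrow>
     (\<forall>z\<in>S. F differentiable (at z)) \<and> (\<forall>i\<in>Basis. differentiable_times n S (partials [i] F))"

text \<open>The list records the derivative taken first at its end, and this is the one that the recursion on
  the order splits off.\<close>

lemma differentiable_times_iff_partials:
  "differentiable_times n S F \<longleftrightarrow>
     (\<forall>is. set is \<subseteq> Basis \<longrightarrow> length is \<le> n \<longrightarrow> (\<forall>z\<in>S. partials is F differentiable (at z)))"
proof (induction n arbitrary: F)
  case 0
  then show ?case by auto
next
  case (Suc n)
  have "differentiable_times (Suc n) S F \<longleftrightarrow>
    (\<forall>z\<in>S. partials [] F differentiable (at z)) \<and>
    (\<forall>i\<in>Basis. \<forall>is. set is \<subseteq> Basis \<longrightarrow> length is \<le> n \<longrightarrow>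
       (\<forall>z\<in>S. partials (is @ [i]) F differentiable (at z)))"
    by (simp only: differentiable_times.simps Suc.IH partials_append) simp
  also have "\<dots> \<longleftrightarrow> (\<forall>is. set is \<subseteq> Basis \<longrightarrow> length is \<le> Suc n \<longrightarrow>
      (\<forall>z\<in>S. partials is F differentiable (at z)))" (is "?A \<longleftrightarrow> ?B")
  proof
    assume A: ?A
    show ?B
    proof (intro allI impI)
      fix "is" :: "'a list"
      assume "set is \<subseteq> Basis" "length is \<le> Suc n"
      then show "\<forall>z\<in>S. partials is F differentiable (at z)"
        using A by (cases "is" rule: rev_cases) auto
    qed
  next
    assume B: ?B
    have "\<forall>z\<in>S. partials (is @ [i]) F differentiable (at z)"
      if "i \<in> Basis" "set is \<subseteq> Basis" "length is \<le> n" for i "is"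
      using B[rule_format, of "is @ [i]"] that by auto
    moreover have "\<forall>z\<in>S. partials [] F differentiable (at z)"
      using B[rule_format, of "[]"] by auto
    ultimately show ?A by blast
  qed
  finally show ?case .
qed

lemma smooth_on_iff_differentiable_times:
  "smooth_on S F \<longleftrightarrow> (\<forall>n. differentiable_times n S F)"
  unfolding smooth_on_def differentiable_times_iff_partials by auto

lemma differentiable_times_imp_differentiable:
  "differentiable_times n S F \<Longrightarrow> z \<in> S \<Longrightarrow> F differentiable (at z)"
  by (cases n) auto

lemma differentiable_times_derivative:
  "differentiable_times n S F \<Longrightarrow> z \<in> S \<Longrightarrow> (F has_derivative frechet_derivative F (at z)) (at z)"
  using differentiable_times_imp_differentiable frechet_derivative_works by blast

lemma differentiable_times_SucD:
  "differentiable_times (Suc n) S F \<Longrightarrow> differentiable_times n S F"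
  unfolding differentiable_times_iff_partials by simp

lemma partials_cong:
  assumes "open S" "\<And>z. z \<in> S \<Longrightarrow> F z = G z" "z \<in> S"
  shows "partials is F z = partials is G z"
  using assms(3)
proof (induction "is" arbitrary: z)
  case (Cons i "is")
  have "(partials is F has_derivative D) (at z) \<longleftrightarrow> (partials is G has_derivative D) (at z)" for D
    using has_derivative_transform_within_open[OF _ \<open>open S\<close> Cons.prems] Cons.IH by metis
  then show ?case by (simp add: frechet_derivative_def)
qed (use assms in simp)

lemma differentiable_times_cong:
  assumes "open S" "\<And>z. z \<in> S \<Longrightarrow> F z = G z" "differentiable_times n S F"
  shows "differentiable_times n S G"
  unfolding differentiable_times_iff_partials
proof (intro allI impI ballI)
  fix "is" :: "'a list" and z
  assume *: "set is \<subseteq> Basis" "length is \<le> n" "z \<in> S"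
  then have "partials is F differentiable (at z)"
    using assms(3) unfolding differentiable_times_iff_partials by blast
  then obtain D where "(partials is F has_derivative D) (at z)"
    unfolding differentiable_def by blast
  then have "(partials is G has_derivative D) (at z)"
    by (rule has_derivative_transform_within_open[OF _ assms(1) *(3)])
       (use partials_cong[OF assms(1,2)] in auto)
  then show "partials is G differentiable (at z)" unfolding differentiable_def by blast
qed

lemma smooth_on_cong:
  assumes "open S" "\<And>z. z \<in> S \<Longrightarrow> F z = G z" "smooth_on S F"
  shows "smooth_on S G"
  using assms differentiable_times_cong smooth_on_iff_differentiable_times by metis

lemma smooth_on_subset: "smooth_on S F \<Longrightarrow> T \<subseteq> S \<Longrightarrow> smooth_on T F"
  unfolding smooth_on_def by blast

lemma smooth_on_Un: "smooth_on S F \<Longrightarrow> smooth_on T F \<Longrightarrow> smooth_on (S \<union> T) F"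
  unfolding smooth_on_def by blast

lemma differentiable_times_SucI:
  assumes "open S" "\<And>z. z \<in> S \<Longrightarrow> (F has_derivative F' z) (at z)"
    "\<And>i. i \<in> Basis \<Longrightarrow> differentiable_times n S (\<lambda>z. F' z i)"
  shows "differentiable_times (Suc n) S F"
proof -
  have "differentiable_times n S (partials [i] F)" if "i \<in> Basis" for i
    by (rule differentiable_times_cong[OF assms(1) _ assms(3)[OF that]])
       (use partials_eq_derivative[OF assms(2)] in metis)
  moreover have "F differentiable (at z)" if "z \<in> S" for z
    using assms(2)[OF that] differentiable_def by blast
  ultimately show ?thesis by simp
qed

lemma smooth_on_if_derivative:
  assumes "open S" "\<And>z. z \<in> S \<Longrightarrow> (F has_derivative F' z) (at z)"
    "\<And>i. i \<in> Basis \<Longrightarrow> smooth_on S (\<lambda>z. F' z i)"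
  shows "smooth_on S F"
  unfolding smooth_on_iff_differentiable_times
proof
  fix n show "differentiable_times n S F"
    using differentiable_times_SucI[OF assms(1,2), of n] assms(3)
      differentiable_times_SucD smooth_on_iff_differentiable_times by blast
qed

lemma smooth_on_differentiable: "smooth_on S F \<Longrightarrow> z \<in> S \<Longrightarrow> F differentiable (at z)"
  using smooth_on_iff_differentiable_times differentiable_times_imp_differentiable by blast

lemma smooth_on_derivative:
  "smooth_on S F \<Longrightarrow> z \<in> S \<Longrightarrow> (F has_derivative frechet_derivative F (at z)) (at z)"
  using smooth_on_differentiable frechet_derivative_works by blast

lemma smooth_on_partial: "smooth_on S F \<Longrightarrow> i \<in> Basis \<Longrightarrow> smooth_on S (partials [i] F)"
  unfolding smooth_on_iff_differentiable_times by (metis differentiable_times.simps(2))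

lemma smooth_on_real_has_derivative:
  fixes F :: "real \<Rightarrow> 'b::real_normed_vector"
  assumes "smooth_on I F" "s \<in> I"
  shows "(F has_vector_derivative partials [1] F s) (at s)"
proof -
  have D: "(F has_derivative frechet_derivative F (at s)) (at s)"
    by (rule smooth_on_derivative[OF assms])
  have "frechet_derivative F (at s) h = h *\<^sub>R partials [1] F s" for h
    using linear_cmul[OF has_derivative_linear[OF D], of h 1] by simp
  then have "frechet_derivative F (at s) = (\<lambda>h. h *\<^sub>R partials [1] F s)" by (rule ext)
  with D show ?thesis unfolding has_vector_derivative_def by metis
qed

lemma smooth_on_continuous: "smooth_on S F \<Longrightarrow> continuous_on S F"
  by (meson continuous_at_imp_continuous_on differentiable_imp_continuous_within
      smooth_on_differentiable)

lemma differentiable_times_const: "open S \<Longrightarrow> differentiable_times n S (\<lambda>z. k)"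
proof (induction n arbitrary: k)
  case (Suc n)
  show ?case by (rule differentiable_times_SucI[where F'="\<lambda>z h. 0"]) (use Suc in auto)
qed auto

lemma differentiable_times_linear:
  assumes "bounded_linear T" "open S"
  shows "differentiable_times n S F \<Longrightarrow> differentiable_times n S (\<lambda>z. T (F z))"
proof (induction n arbitrary: F)
  case 0
  then show ?case
    using bounded_linear.has_derivative[OF assms(1)]
    by (fastforce simp: differentiable_def)
next
  case (Suc n)
  show ?case
    by (rule differentiable_times_SucI
        [OF assms(2) bounded_linear.has_derivative[OF assms(1) differentiable_times_derivative[OF Suc.prems]]])
       (use Suc in auto)
qed

lemma differentiable_times_add:
  "open S \<Longrightarrow> differentiable_times n S F \<Longrightarrow> differentiable_times n S G \<Longrightarrow>
    differentiable_times n S (\<lambda>z. F z + G z)"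
proof (induction n arbitrary: F G)
  case 0
  then show ?case by auto
next
  case (Suc n)
  show ?case
    by (rule differentiable_times_SucI[OF \<open>open S\<close>
        has_derivative_add[OF differentiable_times_derivative[OF Suc.prems(2)]
          differentiable_times_derivative[OF Suc.prems(3)]]])
       (use Suc in auto)
qed

lemma differentiable_times_sum:
  "open S \<Longrightarrow> (\<And>j. j \<in> J \<Longrightarrow> differentiable_times n S (F j)) \<Longrightarrow>
    differentiable_times n S (\<lambda>z. \<Sum>j\<in>J. F j z)"
  by (induction J rule: infinite_finite_induct)
     (auto intro: differentiable_times_const differentiable_times_add)

lemma differentiable_times_bilinear:
  assumes "bounded_bilinear B" "open S"
  shows "differentiable_times n S F \<Longrightarrow> differentiable_times n S G \<Longrightarrow>
    differentiable_times n S (\<lambda>z. B (F z) (G z))"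
proof (induction n arbitrary: F G)
  case 0
  then show ?case
    using bounded_bilinear.FDERIV[OF assms(1)] by (fastforce simp: differentiable_def)
next
  case (Suc n)
  show ?case
    by (rule differentiable_times_SucI[OF assms(2) bounded_bilinear.FDERIV[OF assms(1)
          differentiable_times_derivative[OF Suc.prems(1)]
          differentiable_times_derivative[OF Suc.prems(2)]]])
       (use Suc.prems assms(2) differentiable_times_SucD[OF Suc.prems(1)]
          differentiable_times_SucD[OF Suc.prems(2)] in
         \<open>auto intro!: differentiable_times_add Suc.IH\<close>)
qed

lemma differentiable_times_compose:
  fixes F :: "'a::euclidean_space \<Rightarrow> 'b::euclidean_space"
    and \<phi> :: "'b \<Rightarrow> 'c::real_normed_vector"
  assumes "open S" "open T" "F ` S \<subseteq> T"
  shows "differentiable_times n S F \<Longrightarrow> differentiable_times n T \<phi> \<Longrightarrow>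
    differentiable_times n S (\<lambda>z. \<phi> (F z))"
proof (induction n arbitrary: \<phi>)
  case 0
  have "(\<lambda>z. \<phi> (F z)) differentiable (at z)" if "z \<in> S" for z
    using differentiable_chain_at[of F z \<phi>] 0 that assms(3) by (auto simp: o_def)
  then show ?case by simp
next
  case (Suc n)
  have D: "((\<lambda>z. \<phi> (F z)) has_derivative
      (\<lambda>h. frechet_derivative \<phi> (at (F z)) (frechet_derivative F (at z) h))) (at z)" if "z \<in> S" for z
    using diff_chain_at[OF differentiable_times_derivative[OF Suc.prems(1) that]
        differentiable_times_derivative[OF Suc.prems(2)]] that assms(3)
    by (auto simp: o_def)
  have eq: "frechet_derivative \<phi> (at (F z)) (frechet_derivative F (at z) h) =
      (\<Sum>j\<in>Basis. (frechet_derivative F (at z) h \<bullet> j) *\<^sub>R partials [j] \<phi> (F z))"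
    if "z \<in> S" for z h
    by (rule frechet_derivative_eq_sum_partials[OF differentiable_times_imp_differentiable[OF Suc.prems(2)]])
       (use that assms(3) in blast)
  show ?case
  proof (rule differentiable_times_SucI[OF assms(1)])
    show "((\<lambda>z. \<phi> (F z)) has_derivative (\<lambda>h. \<Sum>j\<in>Basis.
        (frechet_derivative F (at z) h \<bullet> j) *\<^sub>R partials [j] \<phi> (F z))) (at z)"
      if "z \<in> S" for z
      using D[OF that] unfolding eq[OF that] .
    show "differentiable_times n S (\<lambda>z. \<Sum>j\<in>Basis.
        (frechet_derivative F (at z) i \<bullet> j) *\<^sub>R partials [j] \<phi> (F z))" if "i \<in> Basis" for i
    proof (intro differentiable_times_sum differentiable_times_bilinear[OF bounded_bilinear_scaleR]
        assms(1) differentiable_times_linear[OF bounded_linear_inner_left])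
      show "differentiable_times n S (\<lambda>z. frechet_derivative F (at z) i)"
        using Suc.prems(1) that by auto
      show "differentiable_times n S (\<lambda>z. partials [j] \<phi> (F z))" if "j \<in> Basis" for j
        using Suc.IH[OF differentiable_times_SucD[OF Suc.prems(1)], of "partials [j] \<phi>"]
          Suc.prems(2) that by simp
    qed
  qed
qed

lemma smooth_on_const [intro]: "open S \<Longrightarrow> smooth_on S (\<lambda>z. k)"
  by (simp add: smooth_on_iff_differentiable_times differentiable_times_const)

lemma smooth_on_linear:
  "bounded_linear T \<Longrightarrow> open S \<Longrightarrow> smooth_on S F \<Longrightarrow> smooth_on S (\<lambda>z. T (F z))"
  by (simp add: smooth_on_iff_differentiable_times differentiable_times_linear)

lemma smooth_on_add:
  "open S \<Longrightarrow> smooth_on S F \<Longrightarrow> smooth_on S G \<Longrightarrow> smooth_on S (\<lambda>z. F z + G z)"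
  by (simp add: smooth_on_iff_differentiable_times differentiable_times_add)

lemma smooth_on_sum:
  "open S \<Longrightarrow> (\<And>j. j \<in> J \<Longrightarrow> smooth_on S (F j)) \<Longrightarrow> smooth_on S (\<lambda>z. \<Sum>j\<in>J. F j z)"
  by (simp add: smooth_on_iff_differentiable_times differentiable_times_sum)

lemma smooth_on_bilinear:
  "bounded_bilinear B \<Longrightarrow> open S \<Longrightarrow> smooth_on S F \<Longrightarrow> smooth_on S G \<Longrightarrow>
    smooth_on S (\<lambda>z. B (F z) (G z))"
  by (simp add: smooth_on_iff_differentiable_times differentiable_times_bilinear)

lemma smooth_on_compose:
  fixes F :: "'a::euclidean_space \<Rightarrow> 'b::euclidean_space"
    and \<phi> :: "'b \<Rightarrow> 'c::real_normed_vector"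
  assumes "open S" "open T" "\<And>z. z \<in> S \<Longrightarrow> F z \<in> T" "smooth_on S F" "smooth_on T \<phi>"
  shows "smooth_on S (\<lambda>z. \<phi> (F z))"
  using assms differentiable_times_compose[of S T F _ \<phi>] image_subsetI[of S F T]
  by (auto simp: smooth_on_iff_differentiable_times)

lemmas smooth_on_mult = smooth_on_bilinear[OF bounded_bilinear_mult]
lemmas smooth_on_scaleR = smooth_on_bilinear[OF bounded_bilinear_scaleR]
lemmas smooth_on_inner = smooth_on_bilinear[OF bounded_bilinear_inner]
lemmas smooth_on_minus = smooth_on_linear[OF bounded_linear_minus[OF bounded_linear_ident]]

lemma smooth_on_diff:
  "open S \<Longrightarrow> smooth_on S F \<Longrightarrow> smooth_on S G \<Longrightarrow> smooth_on S (\<lambda>z. F z - G z)"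
  using smooth_on_add[of S F "\<lambda>z. - G z"] smooth_on_minus[of S G] by simp

lemma smooth_on_id: "open S \<Longrightarrow> smooth_on S (\<lambda>z. z)"
  by (rule smooth_on_if_derivative[where F'="\<lambda>z h. h"]) auto

lemma smooth_on_fst: "open S \<Longrightarrow> smooth_on S F \<Longrightarrow> smooth_on S (\<lambda>z. fst (F z))"
  by (rule smooth_on_linear[OF bounded_linear_fst])

lemma smooth_on_snd: "open S \<Longrightarrow> smooth_on S F \<Longrightarrow> smooth_on S (\<lambda>z. snd (F z))"
  by (rule smooth_on_linear[OF bounded_linear_snd])

lemma smooth_on_Pair:
  assumes "open S" "smooth_on S F" "smooth_on S G"
  shows "smooth_on S (\<lambda>z. (F z, G z))"
proof -
  have "smooth_on S (\<lambda>z. (F z, 0) + (0, G z))"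
    by (intro smooth_on_add assms smooth_on_linear[OF bounded_linear_Pair[OF bounded_linear_ident bounded_linear_zero]]
        smooth_on_linear[OF bounded_linear_Pair[OF bounded_linear_zero bounded_linear_ident]])
  then show ?thesis by simp
qed

lemma smooth_on_power:
  fixes F :: "'a::euclidean_space \<Rightarrow> real"
  shows "open S \<Longrightarrow> smooth_on S F \<Longrightarrow> smooth_on S (\<lambda>z. F z ^ n)"
  by (induction n) (auto intro: smooth_on_mult)

lemma smooth_on_inverse:
  fixes F :: "'a::euclidean_space \<Rightarrow> real"
  assumes "open S" "smooth_on S F" "\<And>z. z \<in> S \<Longrightarrow> F z \<noteq> 0"
  shows "smooth_on S (\<lambda>z. inverse (F z))"
proof -
  have op: "open (- {0::real})" by auto
  have "differentiable_times n (- {0}) (inverse :: real \<Rightarrow> real)" for n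
  proof (induction n)
    case 0
    have "(inverse :: real \<Rightarrow> real) differentiable (at z)" if "z \<noteq> 0" for z
      using DERIV_inverse[OF that] real_differentiable_def by blast
    then show ?case by simp
  next
    case (Suc n)
    show ?case
    proof (rule differentiable_times_SucI[OF op])
      fix z :: real assume "z \<in> - {0}"
      then show "(inverse has_derivative (\<lambda>h. - (inverse z * h * inverse z))) (at z)"
        by (auto intro!: derivative_eq_intros)
    next
      fix i :: real
      show "differentiable_times n (- {0}) (\<lambda>z. - (inverse z * i * inverse z))"
        by (intro differentiable_times_linear[OF bounded_linear_minus[OF bounded_linear_ident]]
          differentiable_times_bilinear[OF bounded_bilinear_mult] differentiable_times_const op Suc)
    qed
  qed
  then have "smooth_on (- {0}) (inverse :: real \<Rightarrow> real)"
    by (simp add: smooth_on_iff_differentiable_times)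
  with smooth_on_compose[OF assms(1) op _ assms(2)] assms(3) show ?thesis by auto
qed

lemma smooth_on_divide:
  fixes F G :: "'a::euclidean_space \<Rightarrow> real"
  assumes "open S" "smooth_on S F" "smooth_on S G" "\<And>z. z \<in> S \<Longrightarrow> G z \<noteq> 0"
  shows "smooth_on S (\<lambda>z. F z / G z)"
  using smooth_on_mult[OF assms(1,2) smooth_on_inverse[OF assms(1,3,4)]]
  by (simp add: divide_inverse)

lemma smooth_on_sqrt:
  fixes F :: "'a::euclidean_space \<Rightarrow> real"
  assumes "open S" "smooth_on S F" "\<And>z. z \<in> S \<Longrightarrow> F z > 0"
  shows "smooth_on S (\<lambda>z. sqrt (F z))"
proof -
  have op: "open {0::real<..}" by auto
  have "differentiable_times n {0<..} sqrt" for n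
  proof (induction n)
    case 0
    have "sqrt differentiable (at z)" if "z > 0" for z
      using DERIV_real_sqrt[OF that] real_differentiable_def by blast
    then show ?case by simp
  next
    case (Suc n)
    have "smooth_on {0<..} (\<lambda>x::real. inverse x)"
      by (intro smooth_on_inverse op smooth_on_id) auto
    then have inv: "differentiable_times n {0<..} (\<lambda>x. inverse (x::real))"
      by (simp add: smooth_on_iff_differentiable_times)
    show ?case
    proof (rule differentiable_times_SucI[OF op])
      fix z :: real assume "z \<in> {0<..}"
      then show "(sqrt has_derivative (\<lambda>h. h * (1/2 * (inverse z * sqrt z)))) (at z)"
        by (auto intro!: derivative_eq_intros simp: fun_eq_iff field_simps)
    next
      fix i :: real
      show "differentiable_times n {0<..} (\<lambda>z. i * (1/2 * (inverse z * sqrt z)))"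
        by (intro inv differentiable_times_bilinear[OF bounded_bilinear_mult]
            differentiable_times_const op Suc)
    qed
  qed
  then have "smooth_on {0<..} sqrt" by (simp add: smooth_on_iff_differentiable_times)
  with smooth_on_compose[OF assms(1) op _ assms(2)] assms(3) show ?thesis by auto
qed

lemmas smooth_on_intros = smooth_on_const smooth_on_id smooth_on_add smooth_on_diff smooth_on_minus
  smooth_on_sum smooth_on_mult smooth_on_scaleR smooth_on_inner smooth_on_fst smooth_on_snd
  smooth_on_Pair smooth_on_power smooth_on_inverse smooth_on_divide smooth_on_sqrt

subsection \<open>Symmetry of second derivatives\<close>

text \<open>The second difference is symmetric in \<open>i\<close> and \<open>j\<close>, which is what makes it the tool for exchanging
  derivatives.  The mean value theorem in direction \<open>i\<close> turns it into \<open>t\<close> times an increment of the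
  partial derivative along \<open>i\<close>, and differentiability of that derivative at the single point \<open>z\<close>
  determines the increment up to \<open>o(t)\<close>.\<close>

lemma second_difference_quotient_limit:
  fixes F :: "'a::euclidean_space \<Rightarrow> real"
  assumes "open S" "z \<in> S" "\<And>x. x \<in> S \<Longrightarrow> F differentiable (at x)"
    and L: "(partials [i] F has_derivative L) (at z)"
  shows "((\<lambda>t. (F (z + t *\<^sub>R i + t *\<^sub>R j) - F (z + t *\<^sub>R i) - F (z + t *\<^sub>R j) + F z) / t\<^sup>2)
    \<longlongrightarrow> L j) (at_right 0)"
proof (rule tendstoI)
  fix e :: real assume "e > 0"
  define M where "M = norm i + norm j + 1"
  have M: "M > 0" unfolding M_def by (smt (verit) norm_ge_zero)
  define e' where "e' = e / (4 * M)"
  have "e' > 0" unfolding e'_def using \<open>e > 0\<close> M by simp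
  obtain d0 where d0: "d0 > 0" "ball z d0 \<subseteq> S"
    using assms(1,2) open_contains_ball by blast
  obtain d1 where d1: "d1 > 0" "\<And>x. norm (x - z) < d1 \<Longrightarrow>
      norm (partials [i] F x - partials [i] F z - L (x - z)) \<le> e' * norm (x - z)"
    using L \<open>e' > 0\<close> unfolding has_derivative_at_alt by blast
  have linL: "linear L" using L has_derivative_linear by blast
  define d where "d = min d0 d1 / M"
  have "d > 0" unfolding d_def using d0 d1 M by simp
  have "dist ((F (z + t *\<^sub>R i + t *\<^sub>R j) - F (z + t *\<^sub>R i) - F (z + t *\<^sub>R j) + F z) / t\<^sup>2) (L j) < e"
    if t: "0 < t" "t < d" for t
  proof -
    have small: "norm (u *\<^sub>R i + v *\<^sub>R j) \<le> t * M \<and> norm (u *\<^sub>R i + v *\<^sub>R j) < d0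
        \<and> norm (u *\<^sub>R i + v *\<^sub>R j) < d1"
      if "0 \<le> u" "u \<le> t" "0 \<le> v" "v \<le> t" for u v
    proof -
      have "norm (u *\<^sub>R i + v *\<^sub>R j) \<le> u * norm i + v * norm j"
        using norm_triangle_ineq[of "u *\<^sub>R i" "v *\<^sub>R j"] that by simp
      also have "\<dots> \<le> t * norm i + t * norm j"
        using that by (intro add_mono mult_right_mono) auto
      also have "\<dots> \<le> t * M" unfolding M_def using t by (simp add: algebra_simps)
      finally have "norm (u *\<^sub>R i + v *\<^sub>R j) \<le> t * M" .
      moreover have "t * M < min d0 d1" using t M by (simp add: d_def pos_less_divide_eq)
      ultimately show ?thesis by simp
    qed
    define g where "g = (\<lambda>u. F (z + u *\<^sub>R i + t *\<^sub>R j) - F (z + u *\<^sub>R i))"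
    define g' where "g' = (\<lambda>u. partials [i] F (z + u *\<^sub>R i + t *\<^sub>R j) - partials [i] F (z + u *\<^sub>R i))"
    have line: "((\<lambda>u. F (z + u *\<^sub>R i + v *\<^sub>R j)) has_real_derivative
        partials [i] F (z + u *\<^sub>R i + v *\<^sub>R j)) (at u)"
      if "0 \<le> u" "u \<le> t" "0 \<le> v" "v \<le> t" for u v
    proof -
      let ?x = "z + u *\<^sub>R i + v *\<^sub>R j"
      have "?x \<in> S" using small[OF that] d0(2) by (auto simp: dist_norm subset_iff)
          (metis add.assoc add_diff_cancel_left' norm_minus_commute)
      then have D: "(F has_derivative frechet_derivative F (at ?x)) (at ?x)"
        using assms(3) frechet_derivative_works by blast
      have "((\<lambda>u. z + u *\<^sub>R i + v *\<^sub>R j) has_derivative (\<lambda>h. h *\<^sub>R i)) (at u)"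
        by (auto intro!: derivative_eq_intros)
      from diff_chain_at[OF this D]
      have "((\<lambda>u. F (z + u *\<^sub>R i + v *\<^sub>R j)) has_derivative
          (\<lambda>h. frechet_derivative F (at ?x) (h *\<^sub>R i))) (at u)"
        by (simp add: o_def)
      moreover have "frechet_derivative F (at ?x) (h *\<^sub>R i) = partials [i] F ?x * h" for h
        using linear_cmul[OF has_derivative_linear[OF D]] by simp
      ultimately show ?thesis unfolding has_field_derivative_def by (simp add: mult_commute_abs)
    qed
    have "(g has_real_derivative g' u) (at u)" if "0 \<le> u" "u \<le> t" for u
      unfolding g_def g'_def using DERIV_diff[OF line[of u t] line[of u 0]] that t by simp
    then obtain x where x: "0 < x" "x < t" "g t - g 0 = (t - 0) * g' x"
      using MVT2[of 0 t g g'] t by blast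
    let ?a = "x *\<^sub>R i + t *\<^sub>R j" and ?b = "x *\<^sub>R i"
    have a: "norm (partials [i] F (z + ?a) - partials [i] F z - L ?a) \<le> e' * (t * M)"
      using d1(2)[of "z + ?a"] small[of x t] x \<open>e' > 0\<close>
      by (auto simp del: partials.simps intro: order_trans[OF _ mult_left_mono])
    have b: "norm (partials [i] F (z + ?b) - partials [i] F z - L ?b) \<le> e' * (t * M)"
      using d1(2)[of "z + ?b"] small[of x 0] x \<open>e' > 0\<close>
      by (auto simp del: partials.simps intro: order_trans[OF _ mult_left_mono])
    have "L ?a - L ?b = t * L j" by (simp add: linear_add[OF linL] linear_cmul[OF linL])
    then have "\<bar>g' x - t * L j\<bar> \<le> 2 * (e' * (t * M))"
      using a b unfolding g'_def real_norm_def by (smt (verit, best) add.assoc)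
    also have "\<dots> = t * (e / 2)" unfolding e'_def using M by (simp add: field_simps)
    finally have "\<bar>g' x - t * L j\<bar> / t \<le> e / 2"
      using t by (simp add: pos_divide_le_eq mult.commute)
    moreover have "t * g' x / t\<^sup>2 - L j = (g' x - t * L j) / t"
      using t by (simp add: power2_eq_square field_simps)
    ultimately have "\<bar>t * g' x / t\<^sup>2 - L j\<bar> \<le> e / 2"
      using t by simp
    moreover have "F (z + t *\<^sub>R i + t *\<^sub>R j) - F (z + t *\<^sub>R i) - F (z + t *\<^sub>R j) + F z = t * g' x"
      using x(3) unfolding g_def by simp
    ultimately show ?thesis using \<open>e > 0\<close> by (simp add: dist_real_def)
  qed
  then show "\<forall>\<^sub>F t in at_right 0. dist ((F (z + t *\<^sub>R i + t *\<^sub>R j) - F (z + t *\<^sub>R i)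
      - F (z + t *\<^sub>R j) + F z) / t\<^sup>2) (L j) < e"
    using \<open>d > 0\<close> by (auto simp: eventually_at_right_field)
qed

theorem partials_commute:
  fixes F :: "'a::euclidean_space \<Rightarrow> real"
  assumes "open S" "smooth_on S F" "z \<in> S" "i \<in> Basis" "j \<in> Basis"
  shows "partials [i, j] F z = partials [j, i] F z"
proof -
  let ?D = "\<lambda>i j t. (F (z + t *\<^sub>R i + t *\<^sub>R j) - F (z + t *\<^sub>R i) - F (z + t *\<^sub>R j) + F z) / t\<^sup>2"
  have lim: "(?D i j \<longlongrightarrow> partials [j, i] F z) (at_right 0)" if "i \<in> Basis" for i j
    using second_difference_quotient_limit[OF assms(1,3) smooth_on_differentiable[OF assms(2)]
        smooth_on_derivative[OF smooth_on_partial[OF assms(2) that] assms(3)], of j]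
    by simp
  have "?D i j = ?D j i" by (simp add: fun_eq_iff algebra_simps)
  then have "(?D i j \<longlongrightarrow> partials [i, j] F z) (at_right 0)" using lim[OF assms(5), of i] by metis
  then show ?thesis using lim[OF assms(4), of j] by (intro tendsto_unique[OF _ _ lim[OF assms(4)]]) auto
qed

section \<open>Primitives of closed one-forms\<close>

lemma has_derivative_integral_parameter:
  fixes f :: "'a::euclidean_space \<Rightarrow> real \<Rightarrow> real"
  assumes U: "open U" "convex U" "x \<in> U"
    and f: "\<And>y t. y \<in> U \<Longrightarrow> t \<in> {\<alpha>..\<beta>} \<Longrightarrow> ((\<lambda>y. f y t) has_derivative f' y t) (at y)"
    and cont: "\<And>y. y \<in> U \<Longrightarrow> continuous_on {\<alpha>..\<beta>} (f y)"
    and cont': "\<And>i. i \<in> Basis \<Longrightarrow> continuous_on (U \<times> {\<alpha>..\<beta>}) (\<lambda>z. f' (fst z) (snd z) i)"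
  shows "((\<lambda>y. integral {\<alpha>..\<beta>} (f y)) has_derivative (\<lambda>h. integral {\<alpha>..\<beta>} (\<lambda>t. f' x t h))) (at x)"
proof -
  define fx where "fx = (\<lambda>y t. Blinfun (f' y t))"
  have fx: "blinfun_apply (fx y t) = f' y t" if "y \<in> U" "t \<in> {\<alpha>..\<beta>}" for y t
    unfolding fx_def by (rule bounded_linear_Blinfun_apply[OF has_derivative_bounded_linear[OF f[OF that]]])
  have der: "((\<lambda>y. f y t) has_derivative blinfun_apply (fx y t)) (at y within U)"
    if "y \<in> U" "t \<in> cbox \<alpha> \<beta>" for y t
    using f[of y t] that by (simp add: fx has_derivative_at_withinI)
  have cfx: "continuous_on (U \<times> cbox \<alpha> \<beta>) (\<lambda>(y, t). fx y t)"
  proof (rule continuous_on_blinfun_componentwise)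
    fix i :: 'a assume i: "i \<in> Basis"
    show "continuous_on (U \<times> cbox \<alpha> \<beta>) (\<lambda>z. blinfun_apply (case z of (y, t) \<Rightarrow> fx y t) i)"
      unfolding cbox_interval by (rule continuous_on_eq[OF cont'[OF i]]) (auto simp: fx)
  qed
  have "((\<lambda>y. integral (cbox \<alpha> \<beta>) (f y)) has_derivative integral (cbox \<alpha> \<beta>) (fx x)) (at x within U)"
    by (rule leibniz_rule[OF der _ cfx U(3,2)])
       (use cont in \<open>auto intro!: integrable_continuous_real\<close>)
  moreover have "blinfun_apply (integral (cbox \<alpha> \<beta>) (fx x)) = (\<lambda>h. integral {\<alpha>..\<beta>} (\<lambda>t. f' x t h))"
  proof (rule ext)
    fix h
    have "continuous_on (cbox \<alpha> \<beta>) (\<lambda>t. (x, t))" by (intro continuous_intros)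
    from continuous_on_compose2[OF cfx this]
    have "continuous_on (cbox \<alpha> \<beta>) (fx x)" using U(3) by auto
    then have "fx x integrable_on cbox \<alpha> \<beta>" by (rule integrable_continuous)
    from integral_linear[OF this blinfun.bounded_linear_left]
    have "blinfun_apply (integral (cbox \<alpha> \<beta>) (fx x)) h = integral {\<alpha>..\<beta>} (\<lambda>t. fx x t h)"
      by (simp add: o_def)
    also have "\<dots> = integral {\<alpha>..\<beta>} (\<lambda>t. f' x t h)"
      using U(3) by (intro integral_cong) (simp add: fx)
    finally show "blinfun_apply (integral (cbox \<alpha> \<beta>) (fx x)) h = integral {\<alpha>..\<beta>} (\<lambda>t. f' x t h)" .
  qed
  ultimately show ?thesis
    by (simp only: at_within_open[OF U(3,1)] cbox_interval)
qed

text \<open>The potential is the work of the field along the segment from the origin.  After differentiation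
  under the integral sign the symmetry of \<open>p'\<close> makes the integrand the derivative of
  \<open>t (p (t x) \<bullet> h)\<close> with respect to \<open>t\<close>.\<close>

lemma closed_field_has_potential_on_convex:
  fixes p :: "'a::euclidean_space \<Rightarrow> 'a"
  assumes U: "open U" "convex U" "0 \<in> U"
    and p: "\<And>x. x \<in> U \<Longrightarrow> (p has_derivative p' x) (at x)"
    and cont: "\<And>i. i \<in> Basis \<Longrightarrow> continuous_on U (\<lambda>x. p' x i)"
    and sym: "\<And>x h k. x \<in> U \<Longrightarrow> p' x h \<bullet> k = p' x k \<bullet> h"
    and "x \<in> U"
  shows "((\<lambda>x. integral {0..1} (\<lambda>t. p (t *\<^sub>R x) \<bullet> x)) has_derivative (\<lambda>h. p x \<bullet> h)) (at x)"
proof -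
  have tx: "t *\<^sub>R y \<in> U" if "y \<in> U" "t \<in> {0..1}" for y t
    using convexD[OF U(2) that(1) U(3), of t "1 - t"] that(2) by simp
  have contp: "continuous_on U p"
    using p by (meson continuous_at_imp_continuous_on has_derivative_continuous)
  have der: "((\<lambda>y. p (t *\<^sub>R y) \<bullet> y) has_derivative
      (\<lambda>h. t * (p' (t *\<^sub>R y) h \<bullet> y) + p (t *\<^sub>R y) \<bullet> h)) (at y)"
    if "y \<in> U" and t: "t \<in> {0..1}" for y t
  proof -
    have "((\<lambda>y. t *\<^sub>R y) has_derivative (\<lambda>h. t *\<^sub>R h)) (at y)"
      by (auto intro!: derivative_eq_intros)
    from diff_chain_at[OF this p[OF tx[OF that(1) t]]]
    have "((\<lambda>y. p (t *\<^sub>R y)) has_derivative (\<lambda>h. p' (t *\<^sub>R y) (t *\<^sub>R h))) (at y)"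
      by (simp add: o_def)
    moreover have "p' (t *\<^sub>R y) (t *\<^sub>R h) = t *\<^sub>R p' (t *\<^sub>R y) h" for h
      using has_derivative_linear[OF p[OF tx[OF that(1) t]]] by (simp add: linear_cmul)
    ultimately have "((\<lambda>y. p (t *\<^sub>R y)) has_derivative (\<lambda>h. t *\<^sub>R p' (t *\<^sub>R y) h)) (at y)"
      by simp
    from has_derivative_inner[OF this has_derivative_ident]
    show ?thesis by (simp add: add.commute)
  qed
  have contf: "continuous_on {0..1} (\<lambda>t. p (t *\<^sub>R y) \<bullet> y)" if "y \<in> U" for y
    using tx[OF that] by (auto intro!: continuous_intros continuous_on_compose2[OF contp])
  have "((\<lambda>y. integral {0..1} (\<lambda>t. p (t *\<^sub>R y) \<bullet> y)) has_derivative
      (\<lambda>h. integral {0..1} (\<lambda>t. t * (p' (t *\<^sub>R x) h \<bullet> x) + p (t *\<^sub>R x) \<bullet> h))) (at x)"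
  proof (rule has_derivative_integral_parameter[OF U(1,2) \<open>x \<in> U\<close> der contf])
    fix i :: 'a assume i: "i \<in> Basis"
    show "continuous_on (U \<times> {0..1})
        (\<lambda>z. snd z * (p' (snd z *\<^sub>R fst z) i \<bullet> fst z) + p (snd z *\<^sub>R fst z) \<bullet> i)"
      using tx by (auto intro!: continuous_intros continuous_on_compose2[OF contp]
          continuous_on_compose2[OF cont[OF i]])
  qed
  moreover have "integral {0..1} (\<lambda>t. t * (p' (t *\<^sub>R x) h \<bullet> x) + p (t *\<^sub>R x) \<bullet> h) = p x \<bullet> h" for h
  proof -
    have "integral {0..1} (\<lambda>t. t * (p' (t *\<^sub>R x) h \<bullet> x) + p (t *\<^sub>R x) \<bullet> h)
        = integral {0..1} (\<lambda>t. t * (p' (t *\<^sub>R x) x \<bullet> h) + p (t *\<^sub>R x) \<bullet> h)"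
      using sym[OF tx[OF \<open>x \<in> U\<close>], of _ h x] by (intro integral_cong) simp
    also have "\<dots> = 1 * (p (1 *\<^sub>R x) \<bullet> h) - 0 * (p (0 *\<^sub>R x) \<bullet> h)"
    proof (rule integral_unique, rule fundamental_theorem_of_calculus)
      fix t :: real assume t: "t \<in> {0..1}"
      have "((\<lambda>t. t *\<^sub>R x) has_derivative (\<lambda>h. h *\<^sub>R x)) (at t)"
        by (auto intro!: derivative_eq_intros)
      from diff_chain_at[OF this p[OF tx[OF \<open>x \<in> U\<close> t]]]
      have "((\<lambda>t. p (t *\<^sub>R x)) has_derivative (\<lambda>h. p' (t *\<^sub>R x) (h *\<^sub>R x))) (at t)"
        by (simp add: o_def)
      moreover have "p' (t *\<^sub>R x) (h *\<^sub>R x) = h *\<^sub>R p' (t *\<^sub>R x) x" for h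
        using has_derivative_linear[OF p[OF tx[OF \<open>x \<in> U\<close> t]]] by (simp add: linear_cmul)
      ultimately have "((\<lambda>t. p (t *\<^sub>R x)) has_vector_derivative p' (t *\<^sub>R x) x) (at t)"
        by (simp add: has_vector_derivative_def)
      then have *: "((\<lambda>t. p (t *\<^sub>R x)) has_vector_derivative p' (t *\<^sub>R x) x) (at t within {0..1})"
        by (rule has_vector_derivative_at_within)
      then have "((\<lambda>t. p (t *\<^sub>R x) \<bullet> h) has_real_derivative p' (t *\<^sub>R x) x \<bullet> h) (at t within {0..1})"
        unfolding has_real_derivative_iff_has_vector_derivative
        by (rule bounded_linear.has_vector_derivative[OF bounded_linear_inner_left])
      then show "((\<lambda>t. t * (p (t *\<^sub>R x) \<bullet> h)) has_vector_derivative
          t * (p' (t *\<^sub>R x) x \<bullet> h) + p (t *\<^sub>R x) \<bullet> h) (at t within {0..1})"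
        unfolding has_real_derivative_iff_has_vector_derivative[symmetric]
        by (auto intro!: derivative_eq_intros)
    qed simp
    finally show ?thesis by simp
  qed
  ultimately show ?thesis by simp
qed

text \<open>A Riemann map reduces the claim to a convex domain.  The pullback of \<open>p\<close>, regarded as a one-form, under a
  holomorphic \<open>g\<close> is \<open>cnj g' * (p \<circ> g)\<close>.  Its derivative is again symmetric: one summand is the
  symmetric form \<open>p'\<close> evaluated at \<open>g' h\<close> and \<open>g' k\<close>, the other is the inner product of \<open>p\<close> with the
  symmetric product \<open>g'' h k\<close>.\<close>

lemma closed_field_has_potential_complex:
  fixes p :: "complex \<Rightarrow> complex"
  assumes S: "open S" "simply_connected S"
    and p: "\<And>x. x \<in> S \<Longrightarrow> (p has_derivative p' x) (at x)"
    and cont: "\<And>i. i \<in> Basis \<Longrightarrow> continuous_on S (\<lambda>x. p' x i)"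
    and sym: "\<And>x h k. x \<in> S \<Longrightarrow> p' x h \<bullet> k = p' x k \<bullet> h"
  shows "\<exists>G. \<forall>x\<in>S. (G has_derivative (\<lambda>h. p x \<bullet> h)) (at x)"
proof -
  consider "S = {}" | "S = UNIV"
    | f g where "f holomorphic_on S" "g holomorphic_on ball 0 1"
      "\<forall>z\<in>S. f z \<in> ball 0 1 \<and> g (f z) = z" "\<forall>z\<in>ball 0 1. g z \<in> S \<and> f (g z) = z"
    using Riemann_mapping_theorem[of S] S by blast
  then show ?thesis
  proof cases
    case 2
    then show ?thesis
      using closed_field_has_potential_on_convex[of UNIV p p'] p cont sym by auto
  next
    case fg: 3
    let ?B = "ball 0 1 :: complex set"
    define g1 where "g1 = deriv g"
    define g2 where "g2 = deriv g1"
    define P where "P = (\<lambda>x. cnj (g1 x) * p (g x))"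
    define P' where "P' = (\<lambda>x h. cnj (g1 x) * p' (g x) (g1 x * h) + cnj (g2 x * h) * p (g x))"
    have hol1: "g1 holomorphic_on ?B"
      unfolding g1_def using fg(2) by (simp add: holomorphic_deriv)
    then have hol2: "g2 holomorphic_on ?B" unfolding g2_def by (simp add: holomorphic_deriv)
    have dg: "(g has_derivative (\<lambda>h. g1 x * h)) (at x)" if "x \<in> ?B" for x
      using holomorphic_derivI[OF fg(2) _ that] unfolding g1_def has_field_derivative_def by simp
    have dg1: "(g1 has_derivative (\<lambda>h. g2 x * h)) (at x)" if "x \<in> ?B" for x
      using holomorphic_derivI[OF hol1 _ that] unfolding g2_def has_field_derivative_def by simp
    have adj: "(cnj a * b) \<bullet> c = b \<bullet> (a * c)" for a b c :: complex
      by (simp add: inner_complex_def algebra_simps)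
    have lin: "linear (p' x)" if "x \<in> S" for x using has_derivative_linear[OF p[OF that]] .
    have dP: "(P has_derivative P' x) (at x)" if x: "x \<in> ?B" for x
    proof -
      have gx: "g x \<in> S" using fg(4) x by blast
      have "((\<lambda>x. p (g x)) has_derivative (\<lambda>h. p' (g x) (g1 x * h))) (at x)"
        using diff_chain_at[OF dg[OF x] p[OF gx]] by (simp add: o_def)
      moreover have "((\<lambda>x. cnj (g1 x)) has_derivative (\<lambda>h. cnj (g2 x * h))) (at x)"
        using bounded_linear.has_derivative[OF bounded_linear_cnj dg1[OF x]] .
      ultimately show ?thesis
        unfolding P_def P'_def using has_derivative_mult by blast
    qed
    have contP: "continuous_on ?B (\<lambda>x. P' x i)" for i
    proof -
      have eq: "p' (g x) (g1 x * i) = Re (g1 x * i) *\<^sub>R p' (g x) 1 + Im (g1 x * i) *\<^sub>R p' (g x) \<i>"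
        if "x \<in> ?B" for x
      proof -
        have "g x \<in> S" using fg(4) that by blast
        from lin[OF this] have "p' (g x) (Re w *\<^sub>R 1 + Im w *\<^sub>R \<i>) =
            Re w *\<^sub>R p' (g x) 1 + Im w *\<^sub>R p' (g x) \<i>" for w
          by (simp add: linear_add linear_cmul)
        moreover have "Re w *\<^sub>R 1 + Im w *\<^sub>R \<i> = w" for w by (simp add: complex_eq_iff)
        ultimately show ?thesis by metis
      qed
      have c: "continuous_on S p" using p
        by (meson continuous_at_imp_continuous_on has_derivative_continuous)
      have "continuous_on ?B (\<lambda>x. cnj (g1 x) * (Re (g1 x * i) *\<^sub>R p' (g x) 1
          + Im (g1 x * i) *\<^sub>R p' (g x) \<i>) + cnj (g2 x * i) * p (g x))"
        using holomorphic_on_imp_continuous_on[OF hol1] holomorphic_on_imp_continuous_on[OF hol2]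
          holomorphic_on_imp_continuous_on[OF fg(2)] fg(4)
        by (intro continuous_intros continuous_on_compose2[OF c]
            continuous_on_compose2[OF cont[of 1]] continuous_on_compose2[OF cont[of \<i>]])
           (auto simp: Basis_complex_def)
      then show ?thesis by (rule continuous_on_eq) (simp add: P'_def eq)
    qed
    have symP: "P' x h \<bullet> k = P' x k \<bullet> h" if "x \<in> ?B" for x h k
    proof -
      have "g x \<in> S" using fg(4) that by blast
      have "(cnj (g2 x * h) * p (g x)) \<bullet> k = (cnj (g2 x * k) * p (g x)) \<bullet> h"
        unfolding adj by (simp add: ac_simps)
      then show ?thesis unfolding P'_def inner_add_left
        using sym[OF \<open>g x \<in> S\<close>, of "g1 x * h" "g1 x * k"] by (simp only: adj)
    qed
    define G where "G = (\<lambda>x. integral {0..1} (\<lambda>t. P (t *\<^sub>R x) \<bullet> x))"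
    have dG: "(G has_derivative (\<lambda>h. P x \<bullet> h)) (at x)" if "x \<in> ?B" for x
      unfolding G_def
      by (rule closed_field_has_potential_on_convex[of ?B P P']) (use dP contP symP that in auto)
    have "((\<lambda>x. G (f x)) has_derivative (\<lambda>h. p x \<bullet> h)) (at x)" if x: "x \<in> S" for x
    proof -
      have fx: "f x \<in> ?B" and gf: "g (f x) = x" using fg(3) x by auto
      have df: "(f has_field_derivative deriv f x) (at x)"
        using holomorphic_derivI[OF fg(1) S(1) x] .
      have "(g has_field_derivative g1 (f x)) (at (f x))"
        using dg[OF fx] unfolding has_field_derivative_def .
      from DERIV_chain2[OF this df]
      have "((\<lambda>x. g (f x)) has_field_derivative g1 (f x) * deriv f x) (at x)" .
      then have "((\<lambda>x. x) has_field_derivative g1 (f x) * deriv f x) (at x)"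
        by (rule has_field_derivative_transform_within_open[OF _ S(1) x]) (use fg(3) in auto)
      then have one: "g1 (f x) * deriv f x = 1" using DERIV_unique DERIV_ident by blast
      have "((\<lambda>x. G (f x)) has_derivative (\<lambda>h. P (f x) \<bullet> (deriv f x * h))) (at x)"
        using diff_chain_at[OF df[unfolded has_field_derivative_def] dG[OF fx]] by (simp add: o_def)
      moreover have "P (f x) \<bullet> (deriv f x * h) = p x \<bullet> h" for h
        unfolding P_def adj gf using one by (simp add: mult.assoc[symmetric])
      ultimately show ?thesis by simp
    qed
    then show ?thesis by blast
  qed auto
qed

theorem closed_form_has_primitive:
  fixes A B :: "real \<times> real \<Rightarrow> real"
  assumes D: "open D" "contractible D"
    and sm: "smooth_on D A" "smooth_on D B"
    and closed: "\<And>z. z \<in> D \<Longrightarrow> partials [(0, 1)] A z = partials [(1, 0)] B z"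
  shows "\<exists>H. smooth_on D H \<and>
    (\<forall>z\<in>D. (H has_derivative (\<lambda>h. A z * fst h + B z * snd h)) (at z))"
proof -
  define \<iota> where "\<iota> = (\<lambda>z. Complex (fst z) (snd z))"
  define \<kappa> where "\<kappa> = (\<lambda>\<zeta>. (Re \<zeta>, Im \<zeta>))"
  define S where "S = \<kappa> -` D"
  have \<kappa>\<iota>: "\<kappa> (\<iota> z) = z" "\<iota> (\<kappa> \<zeta>) = \<zeta>" for z \<zeta>
    by (auto simp: \<iota>_def \<kappa>_def complex_eq_iff)
  have bl_\<kappa>: "bounded_linear \<kappa>"
    unfolding \<kappa>_def by (intro bounded_linear_Pair bounded_linear_Re bounded_linear_Im)
  have bl_\<iota>: "bounded_linear \<iota>"
  proof -
    have "bounded_linear (\<lambda>z. of_real (fst z) + of_real (snd z) * \<i>)"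
      by (intro bounded_linear_add bounded_linear_mult_const
          bounded_linear_compose[OF bounded_linear_of_real] bounded_linear_fst bounded_linear_snd)
    then show ?thesis unfolding \<iota>_def by (simp add: Complex_eq mult.commute)
  qed
  have c_\<kappa>: "continuous_on X \<kappa>" for X using bl_\<kappa> linear_continuous_on by blast
  have c_\<iota>: "continuous_on X \<iota>" for X using bl_\<iota> linear_continuous_on by blast
  have "open S" unfolding S_def using D(1) c_\<kappa>[of UNIV] open_vimage by blast
  have "homeomorphism S D \<kappa> \<iota>"
    by (intro homeomorphismI c_\<kappa> c_\<iota>) (auto simp: S_def \<kappa>\<iota>)
  then have "S homeomorphic D" unfolding homeomorphic_def by blast
  then have "simply_connected S"
    using D(2) homeomorphic_contractible_eq contractible_imp_simply_connected by blast
  define p where "p = (\<lambda>\<zeta>. \<iota> (A (\<kappa> \<zeta>), B (\<kappa> \<zeta>)))"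
  define p' where "p' = (\<lambda>\<zeta> h. \<iota> (
    Re h * partials [(1, 0)] A (\<kappa> \<zeta>) + Im h * partials [(0, 1)] A (\<kappa> \<zeta>),
    Re h * partials [(1, 0)] B (\<kappa> \<zeta>) + Im h * partials [(0, 1)] B (\<kappa> \<zeta>)))"
  have "\<exists>G. \<forall>x\<in>S. (G has_derivative (\<lambda>h. p x \<bullet> h)) (at x)"
  proof (rule closed_field_has_potential_complex[OF \<open>open S\<close> \<open>simply_connected S\<close>, of p p'])
    fix x assume "x \<in> S"
    then have x: "\<kappa> x \<in> D" by (simp add: S_def)
    note d\<kappa> = bounded_linear_imp_has_derivative[OF bl_\<kappa>, of "at x"]
    have "((\<lambda>\<zeta>. (A (\<kappa> \<zeta>), B (\<kappa> \<zeta>))) has_derivative (\<lambda>h. (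
      Re h * partials [(1, 0)] A (\<kappa> x) + Im h * partials [(0, 1)] A (\<kappa> x),
      Re h * partials [(1, 0)] B (\<kappa> x) + Im h * partials [(0, 1)] B (\<kappa> x)))) (at x)"
      using diff_chain_at[OF d\<kappa> has_derivative_plane[OF smooth_on_differentiable[OF sm(1) x]]]
        diff_chain_at[OF d\<kappa> has_derivative_plane[OF smooth_on_differentiable[OF sm(2) x]]]
      by (intro has_derivative_Pair) (simp_all add: o_def \<kappa>_def del: partials.simps)
    from bounded_linear.has_derivative[OF bl_\<iota> this]
    show "(p has_derivative p' x) (at x)" unfolding p_def p'_def .
    show "p' x h \<bullet> k = p' x k \<bullet> h" for h k
      using closed[OF x]
      by (simp add: p'_def \<iota>_def inner_complex_def algebra_simps del: partials.simps)
  next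
    fix i :: complex
    have c: "continuous_on D (partials [j] A)" "continuous_on D (partials [j] B)" if "j \<in> Basis" for j
      using that smooth_on_continuous[OF smooth_on_partial] sm by blast+
    show "continuous_on S (\<lambda>x. p' x i)"
      unfolding p'_def
      by (intro continuous_on_compose2[OF c_\<iota>[of UNIV]] continuous_intros
          continuous_on_compose2[OF c(1) c_\<kappa>] continuous_on_compose2[OF c(2) c_\<kappa>])
         (auto simp: S_def Basis_plane)
  qed
  then obtain G where G: "\<And>x. x \<in> S \<Longrightarrow> (G has_derivative (\<lambda>h. p x \<bullet> h)) (at x)" by blast
  have H: "((\<lambda>z. G (\<iota> z)) has_derivative (\<lambda>h. A z * fst h + B z * snd h)) (at z)" if "z \<in> D" for z
  proof -
    have "\<iota> z \<in> S" using that by (simp add: S_def \<kappa>\<iota>)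
    from diff_chain_at[OF bounded_linear_imp_has_derivative[OF bl_\<iota>] G[OF this]]
    show ?thesis by (simp add: o_def p_def \<kappa>\<iota>) (simp add: \<iota>_def inner_complex_def)
  qed
  moreover have "smooth_on D (\<lambda>z. G (\<iota> z))"
    by (rule smooth_on_if_derivative[OF D(1) H])
       (auto intro!: smooth_on_add smooth_on_mult smooth_on_const sm D(1))
  ultimately show ?thesis by blast
qed

section \<open>Cutoff functions\<close>

text \<open>For \<open>p = 1\<close> this is the standard flat function \<open>exp (- 1 / x)\<close>.  The polynomial factors make the family
  closed under differentiation.\<close>

definition flat :: "real poly \<Rightarrow> real \<Rightarrow> real" where
  "flat p x = (if x \<le> 0 then 0 else poly p (1 / x) * exp (- (1 / x)))"

lemma poly_times_exp_minus_tendsto_0: "((\<lambda>x::real. poly p x * exp (- x)) \<longlongrightarrow> 0) at_top"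
proof -
  have "((\<lambda>x. \<Sum>i\<le>degree p. coeff p i * (x ^ i / exp x)) \<longlongrightarrow> (\<Sum>i\<le>degree p. coeff p i * 0)) at_top"
    by (intro tendsto_sum tendsto_mult tendsto_const tendsto_power_div_exp_0)
  then show ?thesis
    by (simp add: poly_altdef sum_divide_distrib exp_minus divide_inverse[symmetric])
qed

lemma flat_has_derivative:
  "(flat p has_real_derivative flat ([:0, 0, 1:] * (p - pderiv p)) x) (at x)"
proof -
  consider "x < 0" | "x > 0" | "x = 0" by linarith
  then show ?thesis
  proof cases
    case 1
    have "((\<lambda>x. 0) has_real_derivative 0) (at x)" by simp
    then have "(flat p has_real_derivative 0) (at x)"
      by (rule has_field_derivative_transform_within_open[of _ _ _ "{..<0}"])
         (use 1 in \<open>auto simp: flat_def\<close>)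
    then show ?thesis using 1 by (simp add: flat_def)
  next
    case 2
    have "((\<lambda>x. poly p (1 / x) * exp (- (1 / x))) has_real_derivative
        flat ([:0, 0, 1:] * (p - pderiv p)) x) (at x)"
      using 2 by (auto intro!: derivative_eq_intros DERIV_chain2[OF poly_DERIV]
          simp: flat_def field_simps power2_eq_square)
    then show ?thesis
      by (rule has_field_derivative_transform_within_open[of _ _ _ "{0<..}"])
         (use 2 in \<open>auto simp: flat_def\<close>)
  next
    case 3
    have "((\<lambda>u. poly ([:0, 1:] * p) u * exp (- u)) \<longlongrightarrow> 0) at_top"
      by (rule poly_times_exp_minus_tendsto_0)
    then have "((\<lambda>h. poly ([:0, 1:] * p) (inverse h) * exp (- inverse h)) \<longlongrightarrow> 0) (at_right 0)"
      using filterlim_compose filterlim_inverse_at_top_right by blast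
    then have r: "((\<lambda>h. (flat p (0 + h) - flat p 0) / h) \<longlongrightarrow> 0) (at_right 0)"
      by (rule Lim_transform_eventually)
         (auto simp: eventually_at_right_field flat_def field_simps intro!: exI[of _ 1])
    have "((\<lambda>h. 0::real) \<longlongrightarrow> 0) (at_left 0)" by simp
    then have l: "((\<lambda>h. (flat p (0 + h) - flat p 0) / h) \<longlongrightarrow> 0) (at_left 0)"
      by (rule Lim_transform_eventually)
         (auto simp: eventually_at_left_field flat_def intro!: exI[of _ "-1"])
    have "((\<lambda>h. (flat p (0 + h) - flat p 0) / h) \<longlongrightarrow> 0) (at 0)"
      using filterlim_split_at[OF l r] .
    then show ?thesis unfolding 3 DERIV_def by (simp add: flat_def)
  qed
qed

lemma smooth_on_flat: "smooth_on UNIV (flat p)"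
proof -
  have "differentiable_times n UNIV (flat p)" for n
  proof (induction n arbitrary: p)
    case 0
    then show ?case using flat_has_derivative by (auto simp: real_differentiable_def)
  next
    case (Suc n)
    show ?case
      by (rule differentiable_times_SucI
          [OF open_UNIV flat_has_derivative[unfolded has_field_derivative_def]])
         (use Suc in simp)
  qed
  then show ?thesis by (simp add: smooth_on_iff_differentiable_times)
qed

text \<open>Bump functions on a finite cover of \<open>K\<close> by balls add up to a function \<open>\<theta>\<close> that vanishes outside the
  balls and is bounded below on \<open>K\<close>.  Composed with a smooth step it becomes constant where it exceeds
  half of that bound.\<close>

lemma smooth_cutoff_exists:
  fixes K :: "'a::euclidean_space set"
  assumes "compact K" "open D" "K \<subseteq> D"
  obtains \<eta> :: "'a \<Rightarrow> real" and V C where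
    "smooth_on UNIV \<eta>" "open V" "K \<subseteq> V" "\<And>z. z \<in> V \<Longrightarrow> \<eta> z = 1"
    "compact C" "C \<subseteq> D" "\<And>z. z \<notin> C \<Longrightarrow> \<eta> z = 0"
proof (cases "K = {}")
  case True
  show ?thesis by (rule that[of "\<lambda>z. 0" "{}" "{}"]) (use True in auto)
next
  case False
  let ?h = "flat 1"
  have h0: "?h t \<ge> 0" for t by (simp add: flat_def)
  have hpos: "?h t > 0 \<longleftrightarrow> t > 0" for t by (simp add: flat_def)
  have hz: "t \<le> 0 \<Longrightarrow> ?h t = 0" for t by (simp add: flat_def)
  have "\<exists>r>0. cball x r \<subseteq> D" if "x \<in> K" for x
    using assms that open_contains_cball by blast
  then obtain r where r: "\<And>x. x \<in> K \<Longrightarrow> r x > 0" "\<And>x. x \<in> K \<Longrightarrow> cball x (r x) \<subseteq> D" by metis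
  have "K \<subseteq> (\<Union>x\<in>K. ball x (r x))" using r(1) by force
  then obtain X where X: "X \<subseteq> K" "finite X" "K \<subseteq> (\<Union>x\<in>X. ball x (r x))"
    using compactE_image[OF assms(1), of K "\<lambda>x. ball x (r x)"] by (metis open_ball)
  define \<theta> where "\<theta> = (\<lambda>z. \<Sum>x\<in>X. ?h ((r x)\<^sup>2 - (z - x) \<bullet> (z - x)))"
  have sm\<theta>: "smooth_on UNIV \<theta>"
    unfolding \<theta>_def
    by (intro smooth_on_sum smooth_on_compose[OF open_UNIV open_UNIV UNIV_I _ smooth_on_flat]
        smooth_on_intros open_UNIV)
  have ball_iff: "(r x)\<^sup>2 - (z - x) \<bullet> (z - x) > 0 \<longleftrightarrow> z \<in> ball x (r x)" if "x \<in> X" for x z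
  proof -
    have "(r x)\<^sup>2 - (z - x) \<bullet> (z - x) > 0 \<longleftrightarrow> norm (z - x) < r x"
      using r(1)[of x] that X(1) power_strict_mono[of "norm (z - x)" "r x" 2]
        power_less_imp_less_base[of "norm (z - x)" 2 "r x"]
      by (auto simp: power2_norm_eq_inner[symmetric])
    then show ?thesis by (simp add: dist_norm norm_minus_commute)
  qed
  have \<theta>0: "\<theta> z \<ge> 0" for z unfolding \<theta>_def by (intro sum_nonneg h0)
  have \<theta>pos: "\<theta> z > 0" if "z \<in> K" for z
  proof -
    obtain x where x: "x \<in> X" "z \<in> ball x (r x)" using X(3) \<open>z \<in> K\<close> by blast
    show ?thesis unfolding \<theta>_def
      by (rule sum_pos2[OF X(2) x(1)]) (use x ball_iff hpos h0 in auto)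
  qed
  have \<theta>zero: "\<theta> z = 0" if "z \<notin> (\<Union>x\<in>X. cball x (r x))" for z
    unfolding \<theta>_def using that ball_iff
    by (intro sum.neutral ballI hz) (metis UN_I ball_subset_cball linorder_not_le subsetD)
  have cont\<theta>: "continuous_on S \<theta>" for S
    using smooth_on_continuous[OF smooth_on_subset[OF sm\<theta>]] by blast
  obtain m where m: "m \<in> K" "\<And>z. z \<in> K \<Longrightarrow> \<theta> m \<le> \<theta> z"
    using continuous_attains_inf[OF assms(1) False cont\<theta>] by blast
  define \<mu> where "\<mu> = \<theta> m"
  have \<mu>: "\<mu> > 0" unfolding \<mu>_def using \<theta>pos m by blast
  define \<sigma> where "\<sigma> = (\<lambda>t. ?h t / (?h t + ?h (1 - t)))"
  have den: "?h t + ?h (1 - t) > 0" for t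
    using h0[of t] h0[of "1 - t"] hpos[of t] hpos[of "1 - t"]
    by (cases "t > 0") (auto intro: add_pos_nonneg add_nonneg_pos)
  have "smooth_on UNIV (\<lambda>t. ?h (1 - t))"
    by (rule smooth_on_compose[OF open_UNIV open_UNIV UNIV_I _ smooth_on_flat])
       (intro smooth_on_diff smooth_on_const smooth_on_id open_UNIV)
  then have sm\<sigma>: "smooth_on UNIV \<sigma>"
    unfolding \<sigma>_def using den
    by (intro smooth_on_divide smooth_on_add open_UNIV smooth_on_flat) (simp_all add: less_imp_neq[symmetric])
  \<comment> \<open>The step reaches its value 1 at the argument 1, that is where \<open>\<theta>\<close> is half its minimum on \<open>K\<close>.\<close>
  define \<eta> where "\<eta> = (\<lambda>z. \<sigma> (2 / \<mu> * \<theta> z))"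
  show ?thesis
  proof (rule that[of \<eta> "{z. \<theta> z > \<mu> / 2}" "\<Union>x\<in>X. cball x (r x)"])
    show "smooth_on UNIV \<eta>" unfolding \<eta>_def
      by (intro smooth_on_compose[OF open_UNIV open_UNIV UNIV_I _ sm\<sigma>] smooth_on_mult
          smooth_on_const sm\<theta> open_UNIV)
    show "open {z. \<theta> z > \<mu> / 2}" by (intro open_Collect_less cont\<theta> continuous_on_const)
    show "K \<subseteq> {z. \<theta> z > \<mu> / 2}" using m(2) \<mu> unfolding \<mu>_def by fastforce
    show "\<eta> z = 1" if "z \<in> {z. \<theta> z > \<mu> / 2}" for z
    proof -
      have t: "1 - 2 / \<mu> * \<theta> z \<le> 0" using that \<mu> by (simp add: field_simps)
      then have "?h (2 / \<mu> * \<theta> z) > 0" unfolding hpos by linarith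
      then show ?thesis unfolding \<eta>_def \<sigma>_def hz[OF t] by simp
    qed
    show "compact (\<Union>x\<in>X. cball x (r x))" by (intro compact_UN X(2) compact_cball)
    show "(\<Union>x\<in>X. cball x (r x)) \<subseteq> D" using r(2) X(1) by blast
    show "\<eta> z = 0" if "z \<notin> (\<Union>x\<in>X. cball x (r x))" for z
      unfolding \<eta>_def \<sigma>_def \<theta>zero[OF that] by (simp add: flat_def)
  qed
qed

lemma smooth_compactly_supported_extension:
  fixes F :: "'a::euclidean_space \<Rightarrow> real"
  assumes "compact K" "open D" "K \<subseteq> D" "smooth_on D F"
  obtains G V C where "smooth_on UNIV G" "open V" "K \<subseteq> V" "\<And>z. z \<in> V \<Longrightarrow> G z = F z"
    "compact C" "\<And>z. z \<notin> C \<Longrightarrow> G z = 0"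
proof -
  obtain \<eta> :: "'a \<Rightarrow> real" and V C where \<eta>: "smooth_on UNIV \<eta>" "open V" "K \<subseteq> V"
    "\<And>z. z \<in> V \<Longrightarrow> \<eta> z = 1" "compact C" "C \<subseteq> D" "\<And>z. z \<notin> C \<Longrightarrow> \<eta> z = 0"
    using smooth_cutoff_exists[OF assms(1-3)] by metis
  define G where "G = (\<lambda>z. if z \<in> D then \<eta> z * F z else 0)"
  have opC: "open (- C)" using \<eta>(5) compact_imp_closed by blast
  have "smooth_on D G"
    by (rule smooth_on_cong[OF assms(2) _ smooth_on_mult[OF assms(2) smooth_on_subset[OF \<eta>(1)] assms(4)]])
       (auto simp: G_def)
  moreover have "smooth_on (- C) G"
    by (rule smooth_on_cong[OF opC _ smooth_on_const[OF opC]]) (use \<eta>(7) in \<open>auto simp: G_def\<close>)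
  ultimately have "smooth_on (D \<union> - C) G" by (rule smooth_on_Un)
  moreover have "D \<union> - C = UNIV" using \<eta>(6) by blast
  ultimately have "smooth_on UNIV G" by simp
  then show ?thesis
    by (rule that[of G "V \<inter> D" C]) (use \<eta> assms in \<open>auto simp: G_def\<close>)
qed

section \<open>Convergence with derivatives\<close>

definition C_converges ::
  "nat \<Rightarrow> 'a::euclidean_space set \<Rightarrow> (nat \<Rightarrow> 'a \<Rightarrow> 'b::real_normed_vector) \<Rightarrow> ('a \<Rightarrow> 'b) \<Rightarrow> bool" where
  "C_converges n K u F \<longleftrightarrow> (\<forall>is. set is \<subseteq> Basis \<longrightarrow> length is \<le> n \<longrightarrow>
     uniform_limit K (\<lambda>j. partials is (u j)) (partials is F) sequentially)"

lemma C_converges_0: "C_converges 0 K u F \<longleftrightarrow> uniform_limit K u F sequentially"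
  by (simp add: C_converges_def)

lemma C_converges_Suc:
  "C_converges (Suc n) K u F \<longleftrightarrow> uniform_limit K u F sequentially \<and>
     (\<forall>i\<in>Basis. C_converges n K (\<lambda>j. partials [i] (u j)) (partials [i] F))"
  (is "?A \<longleftrightarrow> ?B")
proof
  assume A: ?A
  have "uniform_limit K (\<lambda>j. partials (is @ [i]) (u j)) (partials (is @ [i]) F) sequentially"
    if "i \<in> Basis" "set is \<subseteq> Basis" "length is \<le> n" for i "is"
    using A[unfolded C_converges_def, rule_format, of "is @ [i]"] that by simp
  then show ?B
    using A[unfolded C_converges_def, rule_format, of "[]"]
    by (simp add: C_converges_def partials_append)
next
  assume B: ?B
  show ?A unfolding C_converges_def
  proof (intro allI impI)
    fix "is" :: "'a list" assume *: "set is \<subseteq> Basis" "length is \<le> Suc n"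
    show "uniform_limit K (\<lambda>j. partials is (u j)) (partials is F) sequentially"
    proof (cases "is" rule: rev_cases)
      case Nil
      then show ?thesis using B by simp
    next
      case (snoc js i)
      then show ?thesis using B * by (simp add: C_converges_def partials_append)
    qed
  qed
qed

lemma C_converges_imp_uniform_limit: "C_converges n K u F \<Longrightarrow> uniform_limit K u F sequentially"
  by (cases n) (auto simp: C_converges_0 C_converges_Suc)

lemma C_converges_SucD: "C_converges (Suc n) K u F \<Longrightarrow> C_converges n K u F"
  by (simp add: C_converges_def)

lemma C_converges_cong:
  assumes "open D" "K \<subseteq> D" "\<And>j z. z \<in> D \<Longrightarrow> u j z = v j z" "\<And>z. z \<in> D \<Longrightarrow> F z = G z"
    "C_converges n K u F"
  shows "C_converges n K v G"
  unfolding C_converges_def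
proof (intro allI impI)
  fix "is" :: "'a list" assume *: "set is \<subseteq> Basis" "length is \<le> n"
  have "partials is (u j) z = partials is (v j) z" "partials is F z = partials is G z" if "z \<in> K" for j z
    using partials_cong[OF assms(1)] assms(2-4) that by blast+
  then show "uniform_limit K (\<lambda>j. partials is (v j)) (partials is G) sequentially"
    using assms(5) * unfolding C_converges_def
    by (subst uniform_limit_cong'[of _ _ "\<lambda>j. partials is (u j)" _ "partials is F"]) auto
qed

lemma C_converges_add:
  assumes "open D" "K \<subseteq> D"
  shows "\<lbrakk>\<And>j. smooth_on D (u j); smooth_on D F; \<And>j. smooth_on D (v j); smooth_on D G;
    C_converges n K u F; C_converges n K v G\<rbrakk> \<Longrightarrow>
    C_converges n K (\<lambda>j z. u j z + v j z) (\<lambda>z. F z + G z)"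
proof (induction n arbitrary: u v F G)
  case 0
  then show ?case by (simp add: C_converges_0 uniform_limit_add)
next
  case (Suc n)
  have "C_converges n K (\<lambda>j. partials [i] (\<lambda>z. u j z + v j z)) (partials [i] (\<lambda>z. F z + G z))"
    if i: "i \<in> Basis" for i
    by (rule C_converges_cong[OF assms _ _ Suc.IH[of "\<lambda>j. partials [i] (u j)" "partials [i] F"
          "\<lambda>j. partials [i] (v j)" "partials [i] G"]])
       (use Suc.prems i partials_add[OF smooth_on_differentiable[OF Suc.prems(1)]
            smooth_on_differentiable[OF Suc.prems(3)]]
          partials_add[OF smooth_on_differentiable[OF Suc.prems(2)]
            smooth_on_differentiable[OF Suc.prems(4)]]
        in \<open>simp_all del: partials.simps add: C_converges_Suc smooth_on_partial\<close>)
  then show ?case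
    using Suc.prems by (simp add: C_converges_Suc uniform_limit_add del: partials.simps)
qed

lemma C_converges_sum:
  assumes "open D" "K \<subseteq> D"
  shows "\<lbrakk>finite I; \<And>i j. i \<in> I \<Longrightarrow> smooth_on D (u i j); \<And>i. i \<in> I \<Longrightarrow> smooth_on D (F i);
    \<And>i. i \<in> I \<Longrightarrow> C_converges n K (u i) (F i)\<rbrakk> \<Longrightarrow>
    C_converges n K (\<lambda>j z. \<Sum>i\<in>I. u i j z) (\<lambda>z. \<Sum>i\<in>I. F i z)"
proof (induction I rule: finite_induct)
  case empty
  then show ?case by (simp add: C_converges_def uniform_limit_iff)
next
  case (insert x I)
  show ?case
    unfolding sum.insert[OF insert(1,2)]
    by (rule C_converges_add[OF assms]) (use insert in \<open>auto intro: smooth_on_sum assms(1)\<close>)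
qed

lemma C_converges_linear:
  assumes "open D" "K \<subseteq> D" "bounded_linear T"
  shows "\<lbrakk>\<And>j. smooth_on D (u j); smooth_on D F; C_converges n K u F\<rbrakk> \<Longrightarrow>
    C_converges n K (\<lambda>j z. T (u j z)) (\<lambda>z. T (F z))"
proof (induction n arbitrary: u F)
  case 0
  then show ?case by (simp add: C_converges_0 bounded_linear.uniform_limit[OF assms(3)])
next
  case (Suc n)
  have "C_converges n K (\<lambda>j. partials [i] (\<lambda>z. T (u j z))) (partials [i] (\<lambda>z. T (F z)))"
    if i: "i \<in> Basis" for i
    by (rule C_converges_cong[OF assms(1,2) _ _ Suc.IH[of "\<lambda>j. partials [i] (u j)" "partials [i] F"]])
       (use Suc.prems i partials_linear[OF assms(3) smooth_on_differentiable[OF Suc.prems(1)]]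
          partials_linear[OF assms(3) smooth_on_differentiable[OF Suc.prems(2)]]
        in \<open>simp_all del: partials.simps add: C_converges_Suc smooth_on_partial\<close>)
  then show ?case
    using Suc.prems by (simp add: C_converges_Suc bounded_linear.uniform_limit[OF assms(3)] del: partials.simps)
qed

lemma C_converges_scaleR:
  assumes "open D" "K \<subseteq> D" "compact K"
  shows "\<lbrakk>smooth_on D g; \<And>j. smooth_on D (u j); smooth_on D F; C_converges n K u F\<rbrakk> \<Longrightarrow>
    C_converges n K (\<lambda>j z. g z *\<^sub>R u j z) (\<lambda>z. g z *\<^sub>R F z)"
proof (induction n arbitrary: g u F)
  have bounded: "bounded (h ` K)" if "smooth_on D h" for h :: "'a \<Rightarrow> 'c::real_normed_vector"
    using compact_imp_bounded[OF compact_continuous_image[OF _ assms(3)]]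
      smooth_on_continuous[OF smooth_on_subset[OF that assms(2)]] by blast
  have ul: "uniform_limit K (\<lambda>j z. g z *\<^sub>R u j z) (\<lambda>z. g z *\<^sub>R F z) sequentially"
    if "smooth_on D g" "smooth_on D F" "uniform_limit K u F sequentially"
    for g and u :: "nat \<Rightarrow> 'a \<Rightarrow> 'b" and F
    by (rule bounded_bilinear.bounded_uniform_limit[OF bounded_bilinear_scaleR _ that(3)
          bounded[OF that(2)] bounded[OF that(1)]])
       (simp add: uniform_limit_const)
  {
    case 0
    then show ?case by (simp add: C_converges_0 ul)
  next
    case (Suc n)
    have "C_converges n K (\<lambda>j. partials [i] (\<lambda>z. g z *\<^sub>R u j z)) (partials [i] (\<lambda>z. g z *\<^sub>R F z))"
      if i: "i \<in> Basis" for i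
    proof (rule C_converges_cong[OF assms(1,2)])
      show "C_converges n K (\<lambda>j z. g z *\<^sub>R partials [i] (u j) z + partials [i] g z *\<^sub>R u j z)
          (\<lambda>z. g z *\<^sub>R partials [i] F z + partials [i] g z *\<^sub>R F z)"
      proof (rule C_converges_add[OF assms(1,2)])
        show "C_converges n K (\<lambda>j z. g z *\<^sub>R partials [i] (u j) z) (\<lambda>z. g z *\<^sub>R partials [i] F z)"
          using Suc.prems(4) i
          by (intro Suc.IH smooth_on_partial Suc.prems i) (simp add: C_converges_Suc del: partials.simps)
        show "C_converges n K (\<lambda>j z. partials [i] g z *\<^sub>R u j z) (\<lambda>z. partials [i] g z *\<^sub>R F z)"
          using C_converges_SucD[OF Suc.prems(4)]
          by (intro Suc.IH smooth_on_partial Suc.prems i)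
      qed (intro smooth_on_scaleR smooth_on_partial Suc.prems assms(1) i)+
    qed (use partials_scaleR[OF smooth_on_differentiable[OF Suc.prems(1)]
            smooth_on_differentiable[OF Suc.prems(2)]]
          partials_scaleR[OF smooth_on_differentiable[OF Suc.prems(1)]
            smooth_on_differentiable[OF Suc.prems(3)]]
        in \<open>simp_all del: partials.simps\<close>)
    moreover have "uniform_limit K (\<lambda>j z. g z *\<^sub>R u j z) (\<lambda>z. g z *\<^sub>R F z) sequentially"
      using Suc.prems by (intro ul) (auto dest: C_converges_imp_uniform_limit)
    ultimately show ?case by (simp add: C_converges_Suc del: partials.simps)
  }
qed

lemma C_converges_compose:
  fixes \<Phi> :: "'a::euclidean_space \<Rightarrow> 'b::euclidean_space"
  assumes D: "open D" "K \<subseteq> D" "compact K" and D': "open D'" "\<And>z. z \<in> D \<Longrightarrow> \<Phi> z \<in> D'"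
    and \<Phi>: "smooth_on D \<Phi>"
  shows "\<lbrakk>\<And>j. smooth_on D' (u j); smooth_on D' F; C_converges n (\<Phi> ` K) u F\<rbrakk> \<Longrightarrow>
    C_converges n K (\<lambda>j z. u j (\<Phi> z)) (\<lambda>z. F (\<Phi> z))"
proof (induction n arbitrary: u F)
  have ul: "uniform_limit K (\<lambda>j z. u j (\<Phi> z)) (\<lambda>z. F (\<Phi> z)) sequentially"
    if "uniform_limit (\<Phi> ` K) u F sequentially" for u :: "nat \<Rightarrow> 'b \<Rightarrow> 'c" and F
    using that by (simp add: uniform_limit_iff)
  {
    case 0
    then show ?case by (simp add: C_converges_0 ul)
  next
    case (Suc n)
    have comp: "smooth_on D (\<lambda>z. h (\<Phi> z))" if "smooth_on D' h" for h :: "'b \<Rightarrow> 'c"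
      by (rule smooth_on_compose[OF D(1) D' \<Phi> that])
    have "C_converges n K (\<lambda>j. partials [i] (\<lambda>z. u j (\<Phi> z))) (partials [i] (\<lambda>z. F (\<Phi> z)))"
      if i: "i \<in> Basis" for i
    proof (rule C_converges_cong[OF D(1,2)])
      show "C_converges n K
          (\<lambda>j z. \<Sum>k\<in>Basis. (partials [i] \<Phi> z \<bullet> k) *\<^sub>R partials [k] (u j) (\<Phi> z))
          (\<lambda>z. \<Sum>k\<in>Basis. (partials [i] \<Phi> z \<bullet> k) *\<^sub>R partials [k] F (\<Phi> z))"
      proof (rule C_converges_sum[OF D(1,2) finite_Basis])
        fix k :: 'b assume k: "k \<in> Basis"
        have g: "smooth_on D (\<lambda>z. partials [i] \<Phi> z \<bullet> k)"
          by (intro smooth_on_inner smooth_on_const smooth_on_partial D(1) \<Phi> i)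
        have u: "smooth_on D (\<lambda>z. partials [k] (u j) (\<Phi> z))" for j
          by (rule comp[OF smooth_on_partial[OF Suc.prems(1) k]])
        have F: "smooth_on D (\<lambda>z. partials [k] F (\<Phi> z))"
          by (rule comp[OF smooth_on_partial[OF Suc.prems(2) k]])
        show "smooth_on D (\<lambda>z. (partials [i] \<Phi> z \<bullet> k) *\<^sub>R partials [k] (u j) (\<Phi> z))" for j
          by (rule smooth_on_scaleR[OF D(1) g u])
        show "smooth_on D (\<lambda>z. (partials [i] \<Phi> z \<bullet> k) *\<^sub>R partials [k] F (\<Phi> z))"
          by (rule smooth_on_scaleR[OF D(1) g F])
        have "C_converges n (\<Phi> ` K) (\<lambda>j. partials [k] (u j)) (partials [k] F)"
          using Suc.prems(3) k unfolding C_converges_Suc by blast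
        from Suc.IH[OF smooth_on_partial[OF Suc.prems(1) k] smooth_on_partial[OF Suc.prems(2) k] this]
        show "C_converges n K (\<lambda>j z. (partials [i] \<Phi> z \<bullet> k) *\<^sub>R partials [k] (u j) (\<Phi> z))
            (\<lambda>z. (partials [i] \<Phi> z \<bullet> k) *\<^sub>R partials [k] F (\<Phi> z))"
          by (rule C_converges_scaleR[OF D g u F])
      qed
    qed (use partials_compose[OF smooth_on_differentiable[OF \<Phi>]
            smooth_on_differentiable[OF Suc.prems(1) D'(2)]]
          partials_compose[OF smooth_on_differentiable[OF \<Phi>]
            smooth_on_differentiable[OF Suc.prems(2) D'(2)]]
        in \<open>simp_all del: partials.simps\<close>)
    moreover have "uniform_limit K (\<lambda>j z. u j (\<Phi> z)) (\<lambda>z. F (\<Phi> z)) sequentially"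
      using Suc.prems(3) by (intro ul) (rule C_converges_imp_uniform_limit)
    ultimately show ?case unfolding C_converges_Suc by blast
  }
qed

lemma C_converges_eventually_close:
  fixes K :: "'a::euclidean_space set"
  assumes "C_converges n K u F" "\<epsilon> > 0"
  shows "\<exists>j. \<forall>is. set is \<subseteq> Basis \<longrightarrow> length is \<le> n \<longrightarrow>
    (\<forall>z\<in>K. norm (partials is (u j) z - partials is F z) < \<epsilon>)"
proof -
  let ?L = "{is. set is \<subseteq> (Basis :: 'a set) \<and> length is \<le> n}"
  have "finite ?L" by (rule finite_lists_length_le) simp
  moreover have "\<forall>\<^sub>F j in sequentially. \<forall>z\<in>K. norm (partials is (u j) z - partials is F z) < \<epsilon>"
    if "is \<in> ?L" for "is"
  proof -
    have "uniform_limit K (\<lambda>j. partials is (u j)) (partials is F) sequentially"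
      using assms(1) that unfolding C_converges_def by blast
    from uniform_limitD[OF this assms(2)] show ?thesis by (simp only: dist_norm)
  qed
  ultimately have "\<forall>\<^sub>F j in sequentially. \<forall>is\<in>?L. \<forall>z\<in>K. norm (partials is (u j) z - partials is F z) < \<epsilon>"
    by (intro eventually_ball_finite) blast+
  then obtain j where "\<forall>is\<in>?L. \<forall>z\<in>K. norm (partials is (u j) z - partials is F z) < \<epsilon>"
    using eventually_happens'[OF sequentially_bot] by blast
  then show ?thesis by blast
qed

section \<open>Approximation by polynomials in the second variable\<close>

text \<open>With \<open>l\<close> the identity this is a convolution along \<open>w\<close>; with \<open>l\<close> the inclusion of an axis it
  describes the coefficients of the approximating polynomials.  All derivatives fall on \<open>F\<close>, so that
  they pass through the integral unchanged.\<close>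

lemma kernel_integral_has_derivative:
  fixes F :: "'b::euclidean_space \<Rightarrow> real" and l :: "'a::euclidean_space \<Rightarrow> 'b"
  assumes F: "smooth_on UNIV F" and a: "continuous_on {\<alpha>..\<beta>} a" and l: "bounded_linear l"
  shows "((\<lambda>x. integral {\<alpha>..\<beta>} (\<lambda>t. a t * F (l x + t *\<^sub>R w))) has_derivative
    (\<lambda>h. integral {\<alpha>..\<beta>} (\<lambda>t. a t * frechet_derivative F (at (l x + t *\<^sub>R w)) (l h)))) (at x)"
proof (rule has_derivative_integral_parameter[OF open_UNIV convex_UNIV UNIV_I])
  have dF: "(F has_derivative frechet_derivative F (at y)) (at y)" for y
    using smooth_on_derivative[OF F] by simp
  show "((\<lambda>x. a t * F (l x + t *\<^sub>R w)) has_derivative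
      (\<lambda>h. a t * frechet_derivative F (at (l x + t *\<^sub>R w)) (l h))) (at x)" for x t
  proof -
    have "((\<lambda>x. l x + t *\<^sub>R w) has_derivative l) (at x)"
      by (auto intro!: derivative_eq_intros bounded_linear_imp_has_derivative[OF l])
    from diff_chain_at[OF this dF]
    have "((\<lambda>x. F (l x + t *\<^sub>R w)) has_derivative (\<lambda>h. frechet_derivative F (at (l x + t *\<^sub>R w)) (l h))) (at x)"
      by (simp add: o_def)
    then show ?thesis by (rule has_derivative_mult_right)
  qed
  show "continuous_on {\<alpha>..\<beta>} (\<lambda>t. a t * F (l x + t *\<^sub>R w))" for x
    by (intro continuous_intros a continuous_on_compose2[OF smooth_on_continuous[OF F]]) auto
  fix i :: 'a
  have contl: "continuous_on UNIV l" using l linear_continuous_on by blast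
  have eq: "frechet_derivative F (at y) (l i) = (\<Sum>j\<in>Basis. (l i \<bullet> j) *\<^sub>R partials [j] F y)" for y
    by (rule frechet_derivative_eq_sum_partials[OF smooth_on_differentiable[OF F UNIV_I]])
  show "continuous_on (UNIV \<times> {\<alpha>..\<beta>})
      (\<lambda>z. a (snd z) * frechet_derivative F (at (l (fst z) + snd z *\<^sub>R w)) (l i))"
    unfolding eq
    by (intro continuous_intros continuous_on_compose2[OF a] continuous_on_compose2[OF contl]
        continuous_on_compose2[OF smooth_on_continuous[OF smooth_on_partial[OF F]]]) auto
qed

lemma smooth_on_kernel_integral:
  fixes F :: "'b::euclidean_space \<Rightarrow> real" and l :: "'a::euclidean_space \<Rightarrow> 'b"
  assumes F: "smooth_on UNIV F" and a: "continuous_on {\<alpha>..\<beta>} a" and l: "bounded_linear l"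
  shows "smooth_on UNIV (\<lambda>x. integral {\<alpha>..\<beta>} (\<lambda>t. a t * F (l x + t *\<^sub>R w)))"
proof -
  have "differentiable_times n UNIV (\<lambda>x. integral {\<alpha>..\<beta>} (\<lambda>t. a t * F (l x + t *\<^sub>R w)))"
    if "smooth_on UNIV F" for n and F :: "'b \<Rightarrow> real"
    using that
  proof (induction n arbitrary: F)
    case 0
    then show ?case
      using kernel_integral_has_derivative[OF 0 a l] by (auto simp: differentiable_def)
  next
    case (Suc n)
    have "smooth_on UNIV (\<lambda>y. frechet_derivative F (at y) v)" for v
    proof -
      have "smooth_on UNIV (\<lambda>y. \<Sum>j\<in>Basis. (v \<bullet> j) *\<^sub>R partials [j] F y)"
        by (intro smooth_on_sum smooth_on_scaleR smooth_on_const smooth_on_partial Suc.prems open_UNIV)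
      moreover have "frechet_derivative F (at y) v = (\<Sum>j\<in>Basis. (v \<bullet> j) *\<^sub>R partials [j] F y)" for y
        by (rule frechet_derivative_eq_sum_partials[OF smooth_on_differentiable[OF Suc.prems UNIV_I]])
      ultimately show ?thesis by simp
    qed
    then show ?case
      by (intro differentiable_times_SucI[OF open_UNIV kernel_integral_has_derivative[OF Suc.prems a l]]
          Suc.IH)
  qed
  then show ?thesis using F smooth_on_iff_differentiable_times by blast
qed

lemma tent_integral_positive:
  assumes "0 < \<delta>" "\<delta> \<le> (A::real)"
  shows "integral {-A..A} (\<lambda>t. max 0 (\<delta> - \<bar>t\<bar>)) > 0"
proof -
  have c: "continuous_on X (\<lambda>t::real. max 0 (\<delta> - \<bar>t\<bar>))" for X by (intro continuous_intros)
  have "\<delta> / 2 * (\<delta> / 2) = integral {0..\<delta>/2} (\<lambda>t. \<delta> / 2)" using assms by simp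
  also have "\<dots> \<le> integral {0..\<delta>/2} (\<lambda>t. max 0 (\<delta> - \<bar>t\<bar>))"
    by (rule integral_le) (use assms c in \<open>auto intro!: integrable_continuous_real\<close>)
  also have "\<dots> \<le> integral {-A..A} (\<lambda>t. max 0 (\<delta> - \<bar>t\<bar>))"
    by (rule integral_subset_le) (use assms c in \<open>auto intro!: integrable_continuous_real\<close>)
  finally show ?thesis using assms by (smt (verit) mult_pos_pos half_gt_zero)
qed

text \<open>Normalised tents of width tending to 0 form an approximate identity, and each tent is uniformly
  close on \<open>[-A, A]\<close> to a polynomial.  The kernels do not depend on \<open>F\<close>, so that the same sequence serves
  a function together with all its derivatives.\<close>

lemma polynomial_approximate_identity_exists:
  fixes A :: real
  assumes "A \<ge> 1"
  obtains p :: "nat \<Rightarrow> real \<Rightarrow> real" where "\<And>j. real_polynomial_function (p j)"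
    "\<And>K (F :: 'a::euclidean_space \<Rightarrow> real) w. compact K \<Longrightarrow> continuous_on UNIV F \<Longrightarrow>
      uniform_limit K (\<lambda>j z. integral {-A..A} (\<lambda>t. p j t * F (z + t *\<^sub>R w))) F sequentially"
proof -
  define \<delta> where "\<delta> = (\<lambda>j::nat. inverse (real (Suc j)))"
  have \<delta>: "0 < \<delta> j" "\<delta> j \<le> 1" for j
    by (auto simp: \<delta>_def inverse_eq_divide)
  define I where "I = (\<lambda>j. integral {-A..A} (\<lambda>t. max 0 (\<delta> j - \<bar>t\<bar>)))"
  have I: "I j > 0" for j
    unfolding I_def using tent_integral_positive[of "\<delta> j" A] \<delta>[of j] assms by auto
  define \<rho> where "\<rho> = (\<lambda>j t. max 0 (\<delta> j - \<bar>t\<bar>) / I j)"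
  have \<rho>cont: "continuous_on X (\<rho> j)" for j X
    unfolding \<rho>_def using I[of j] by (intro continuous_intros) auto
  have \<rho>0: "\<rho> j t \<ge> 0" for j t unfolding \<rho>_def using I[of j] by simp
  have \<rho>1: "integral {-A..A} (\<rho> j) = 1" for j
    using I[of j] integral_divide[of "{-A..A}" "\<lambda>t. max 0 (\<delta> j - \<bar>t\<bar>)" "I j"]
    unfolding \<rho>_def I_def by simp
  have "\<exists>g. real_polynomial_function g \<and> (\<forall>t\<in>{-A..A}. \<bar>\<rho> j t - g t\<bar> < \<delta> j)" for j
    using Stone_Weierstrass_real_polynomial_function[OF compact_Icc \<rho>cont \<delta>(1)] by metis
  then obtain p where p: "\<And>j. real_polynomial_function (p j)"
    "\<And>j t. t \<in> {-A..A} \<Longrightarrow> \<bar>\<rho> j t - p j t\<bar> < \<delta> j" by metis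
  have pcont: "continuous_on X (p j)" for X j
    using continuous_on_polymonial_function p(1) real_polynomial_function_eq by blast
  have "uniform_limit K (\<lambda>j z. integral {-A..A} (\<lambda>t. p j t * F (z + t *\<^sub>R w))) F sequentially"
    if K: "compact K" and F: "continuous_on UNIV F" for K and F :: "'a \<Rightarrow> real" and w
  proof (rule uniform_limitI)
    fix e :: real assume "e > 0"
    define K' where "K' = (\<lambda>x. fst x + snd x *\<^sub>R w) ` (K \<times> {-A..A})"
    have "compact K'" unfolding K'_def
      by (intro compact_continuous_image compact_Times K compact_Icc continuous_intros)
    have inK': "z + t *\<^sub>R w \<in> K'" if "z \<in> K" "t \<in> {-A..A}" for z t
      unfolding K'_def using that by (intro image_eqI[of _ _ "(z, t)"]) auto
    have "bounded (F ` K')"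
      by (intro compact_imp_bounded compact_continuous_image \<open>compact K'\<close> continuous_on_subset[OF F]) auto
    then obtain M where M: "M > 0" "\<And>y. y \<in> K' \<Longrightarrow> \<bar>F y\<bar> \<le> M"
      unfolding bounded_pos by auto
    have "uniformly_continuous_on K' F"
      by (intro compact_uniformly_continuous \<open>compact K'\<close> continuous_on_subset[OF F]) auto
    then obtain d where d: "d > 0" "\<And>x y. x \<in> K' \<Longrightarrow> y \<in> K' \<Longrightarrow> dist y x < d \<Longrightarrow> dist (F y) (F x) < e / 3"
      unfolding uniformly_continuous_on_def using \<open>e > 0\<close> by (metis divide_pos_pos zero_less_numeral)
    \<comment> \<open>The first bound keeps the shifted point within the modulus of continuity, the second
      makes the error of the polynomial kernel, integrated over an interval of length \<open>2 * A\<close>, at most \<open>e / 3\<close>.\<close>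
    define \<eta> where "\<eta> = min (d / (norm w + 1)) (e / (6 * A * M))"
    have "\<eta> > 0" unfolding \<eta>_def using d(1) \<open>e > 0\<close> M(1) assms
      by (auto intro!: divide_pos_pos mult_pos_pos add_nonneg_pos)
    have "(\<lambda>j. \<delta> j) \<longlonglongrightarrow> 0" unfolding \<delta>_def by (rule LIMSEQ_inverse_real_of_nat)
    then have "\<forall>\<^sub>F j in sequentially. \<delta> j < \<eta>" using \<open>\<eta> > 0\<close> order_tendstoD(2) by blast
    then show "\<forall>\<^sub>F j in sequentially. \<forall>z\<in>K.
        dist (integral {-A..A} (\<lambda>t. p j t * F (z + t *\<^sub>R w))) (F z) < e"
    proof (rule eventually_mono, intro ballI)
      fix j z assume j: "\<delta> j < \<eta>" and z: "z \<in> K"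
      have zK': "z \<in> K'" using inK'[OF z, of 0] assms by simp
      have int1: "(\<lambda>t. p j t * F (z + t *\<^sub>R w)) integrable_on {-A..A}"
        by (intro integrable_continuous_real continuous_intros pcont continuous_on_compose2[OF F]) auto
      have int2: "(\<lambda>t. \<rho> j t * F z) integrable_on {-A..A}"
        by (intro integrable_continuous_real continuous_intros \<rho>cont)
      have int3: "(\<lambda>t. \<delta> j * M + \<rho> j t * (e / 3)) integrable_on {-A..A}"
        by (intro integrable_continuous_real continuous_intros \<rho>cont)
      have ptw: "norm (p j t * F (z + t *\<^sub>R w) - \<rho> j t * F z) \<le> \<delta> j * M + \<rho> j t * (e / 3)"
        if t: "t \<in> {-A..A}" for t
      proof -
        have "\<bar>p j t - \<rho> j t\<bar> * \<bar>F (z + t *\<^sub>R w)\<bar> \<le> \<delta> j * M"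
          using p(2)[OF t, of j] M(2)[OF inK'[OF z t]] \<delta>[of j] by (intro mult_mono) auto
        moreover have "\<rho> j t * \<bar>F (z + t *\<^sub>R w) - F z\<bar> \<le> \<rho> j t * (e / 3)"
        proof (cases "\<bar>t\<bar> < \<delta> j")
          case True
          have "\<bar>t\<bar> * norm w \<le> \<eta> * norm w" using True j by (intro mult_right_mono) auto
          also have "\<dots> < \<eta> * (norm w + 1)" using \<open>\<eta> > 0\<close> by simp
          also have "\<dots> \<le> d / (norm w + 1) * (norm w + 1)"
            unfolding \<eta>_def by (intro mult_right_mono) auto
          also have "\<dots> = d" by (simp add: add_nonneg_eq_0_iff)
          finally have "dist (F (z + t *\<^sub>R w)) (F z) < e / 3"
            by (intro d(2) zK' inK' z t) (simp add: dist_norm)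
          then show ?thesis using \<rho>0 by (intro mult_left_mono) (auto simp: dist_real_def)
        qed (simp add: \<rho>_def)
        moreover have "p j t * F (z + t *\<^sub>R w) - \<rho> j t * F z =
            (p j t - \<rho> j t) * F (z + t *\<^sub>R w) + \<rho> j t * (F (z + t *\<^sub>R w) - F z)"
          by (simp add: algebra_simps)
        ultimately show ?thesis
          using abs_triangle_ineq[of "(p j t - \<rho> j t) * F (z + t *\<^sub>R w)" "\<rho> j t * (F (z + t *\<^sub>R w) - F z)"] \<rho>0[of j t]
          by (simp add: abs_mult)
      qed
      have "norm (integral {-A..A} (\<lambda>t. p j t * F (z + t *\<^sub>R w) - \<rho> j t * F z)) \<le>
          integral {-A..A} (\<lambda>t. \<delta> j * M + \<rho> j t * (e / 3))"
        by (rule integral_norm_bound_integral[OF integrable_diff[OF int1 int2] int3 ptw])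
      also have "\<dots> = 2 * A * (\<delta> j * M) + e / 3"
        using \<rho>1[of j] assms
        by (subst integral_add) (auto intro!: integrable_continuous_real continuous_intros \<rho>cont)
      also have "\<dots> < e"
      proof -
        have "\<delta> j < e / (6 * A * M)" using j unfolding \<eta>_def by simp
        then have "2 * A * M * \<delta> j < 2 * A * M * (e / (6 * A * M))"
          using assms M(1) by (intro mult_strict_left_mono) auto
        also have "\<dots> = e / 3" using assms M(1) by simp
        finally show ?thesis using \<open>e > 0\<close> by (simp add: ac_simps)
      qed
      also have "integral {-A..A} (\<lambda>t. p j t * F (z + t *\<^sub>R w) - \<rho> j t * F z) =
          integral {-A..A} (\<lambda>t. p j t * F (z + t *\<^sub>R w)) - F z"
        using integral_diff[OF int1 int2] \<rho>1[of j] by simp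
      finally show "dist (integral {-A..A} (\<lambda>t. p j t * F (z + t *\<^sub>R w))) (F z) < e"
        by (simp add: dist_real_def)
    qed
  qed
  with p(1) show ?thesis using that by blast
qed

text \<open>Expansion in powers of \<open>y\<close> turns a convolution in the variable \<open>y\<close> with a polynomial kernel into a
  polynomial in \<open>y\<close>.\<close>

lemma real_polynomial_function_of_difference:
  assumes "real_polynomial_function (q :: real \<Rightarrow> real)"
  obtains n and a :: "nat \<Rightarrow> real \<Rightarrow> real" where
    "\<And>k X. continuous_on X (a k)" "\<And>t y. q (t - y) = (\<Sum>k\<le>n. a k t * y ^ k)"
proof -
  obtain b n where q: "q = (\<lambda>x. \<Sum>i\<le>n. b i * x ^ i)"
    using assms real_polynomial_function_iff_sum[of q] by blast
  define a where "a = (\<lambda>k t. \<Sum>i\<le>n. b i * (of_nat (i choose k) * (-1) ^ k * t ^ (i - k)) :: real)"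
  have "(t - y) ^ i = (\<Sum>k\<le>n. of_nat (i choose k) * (-1) ^ k * t ^ (i - k) * y ^ k)" if "i \<le> n" for t y :: real and i
  proof -
    have "t - y = - y + t" by simp
    then have "(t - y) ^ i = (- y + t) ^ i" by (rule arg_cong)
    also have "\<dots> = (\<Sum>k\<le>i. of_nat (i choose k) * (- y) ^ k * t ^ (i - k))" by (rule binomial_ring)
    also have "\<dots> = (\<Sum>k\<le>n. of_nat (i choose k) * (- y) ^ k * t ^ (i - k))"
      using that by (intro sum.mono_neutral_left) (auto simp: binomial_eq_0)
    finally show ?thesis by (simp add: power_minus[of y] ac_simps)
  qed
  then have "q (t - y) = (\<Sum>i\<le>n. b i * (\<Sum>k\<le>n. of_nat (i choose k) * (-1) ^ k * t ^ (i - k) * y ^ k))" for t y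
    unfolding q by (intro sum.cong refl) auto
  also have "\<dots> t y = (\<Sum>k\<le>n. a k t * y ^ k)" for t y
    unfolding a_def sum_distrib_left sum_distrib_right
    by (subst sum.swap) (simp add: ac_simps)
  finally have "q (t - y) = (\<Sum>k\<le>n. a k t * y ^ k)" for t y .
  moreover have "continuous_on X (a k)" for k X unfolding a_def by (intro continuous_intros)
  ultimately show ?thesis using that by blast
qed

text \<open>A cutoff gives \<open>F\<close> compact support, so that its convolutions in the second variable with the
  polynomial kernels are integrals over a fixed interval and hence polynomial in that variable.
  Convolution commutes with differentiation, which upgrades uniform convergence to convergence of
  all derivatives.\<close>

theorem smooth_approximation_by_fibrewise_polynomials:
  fixes F :: "real \<times> real \<Rightarrow> real"
  assumes "compact K" "open D" "K \<subseteq> D" "smooth_on D F"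
  obtains f :: "nat \<Rightarrow> nat \<Rightarrow> real \<Rightarrow> real" and N :: "nat \<Rightarrow> nat" where
    "\<And>j k. smooth_on UNIV (f j k)"
    "\<And>n. C_converges n K (\<lambda>j z. \<Sum>k\<le>N j. f j k (fst z) * snd z ^ k) F"
proof -
  obtain G V C where G: "smooth_on UNIV G" "open V" "K \<subseteq> V" "\<And>z. z \<in> V \<Longrightarrow> G z = F z"
    "compact C" "\<And>z. z \<notin> C \<Longrightarrow> G z = 0"
    using smooth_compactly_supported_extension[OF assms] by metis
  have "bounded (C \<union> K)" using G(5) assms(1) compact_imp_bounded by auto
  then obtain R0 where R0: "R0 > 0" "\<And>z. z \<in> C \<union> K \<Longrightarrow> norm z \<le> R0" unfolding bounded_pos by auto
  define R where "R = R0 + 1"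
  have R: "R \<ge> 1" unfolding R_def using R0 by simp
  have snd_le: "\<bar>snd z\<bar> \<le> norm z" for z :: "real \<times> real"
    using norm_snd_le[of "snd z" "fst z"] by simp
  have supp: "G (s, t) = 0" if "t \<notin> {-R..R}" for s t
  proof -
    have "(s, t) \<notin> C" using R0(2)[of "(s, t)"] snd_le[of "(s, t)"] that unfolding R_def by auto
    then show ?thesis by (rule G(6))
  qed
  \<comment> \<open>For \<open>\<bar>y\<bar> \<le> R\<close> the interval of radius \<open>2 * R\<close> around \<open>y\<close> still contains the support.\<close>
  define A where "A = 2 * R"
  have A: "A \<ge> 1" unfolding A_def using R by simp
  obtain p where p: "\<And>j. real_polynomial_function (p j)"
    "\<And>K (F :: real \<times> real \<Rightarrow> real) w. compact K \<Longrightarrow> continuous_on UNIV F \<Longrightarrow>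
      uniform_limit K (\<lambda>j z. integral {-A..A} (\<lambda>t. p j t * F (z + t *\<^sub>R w))) F sequentially"
    by (rule polynomial_approximate_identity_exists[OF A]) (rule that)
  have pcont: "continuous_on X (p j)" for X j
    using continuous_on_polymonial_function p(1) real_polynomial_function_eq by blast
  define w where "w = (0 :: real, 1 :: real)"
  define conv where "conv = (\<lambda>j H z. integral {-A..A} (\<lambda>t. p j t * (H (z + t *\<^sub>R w) :: real)))"
  have conv_partial: "partials [i] (conv j H) = conv j (partials [i] H)"
    if "smooth_on UNIV H" for i j H
    using partials_eq_derivative[OF kernel_integral_has_derivative[OF that pcont bounded_linear_ident]]
    unfolding conv_def by (intro ext) simp
  have conv_conv: "C_converges n K (\<lambda>j. conv j H) H" if "smooth_on UNIV H" for n H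
    using that
  proof (induction n arbitrary: H)
    case 0
    then show ?case unfolding C_converges_0 conv_def
      by (intro p(2) assms(1) smooth_on_continuous)
  next
    case (Suc n)
    have "uniform_limit K (\<lambda>j. conv j H) H sequentially"
      unfolding conv_def by (intro p(2) assms(1) smooth_on_continuous Suc.prems)
    moreover have "C_converges n K (\<lambda>j. partials [i] (conv j H)) (partials [i] H)" if "i \<in> Basis" for i
      unfolding conv_partial[OF Suc.prems] by (rule Suc.IH[OF smooth_on_partial[OF Suc.prems that]])
    ultimately show ?case unfolding C_converges_Suc by blast
  qed
  have "\<forall>j. \<exists>n a. (\<forall>k X. continuous_on X (a k)) \<and> (\<forall>t y. p j (t - y) = (\<Sum>k\<le>n. a k t * y ^ k))"
    using real_polynomial_function_of_difference[OF p(1)] by metis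
  then obtain N a where a: "\<And>j k X. continuous_on X (a j k)"
    "\<And>j t y. p j (t - y) = (\<Sum>k\<le>N j. a j k t * y ^ k)" by metis
  define f where "f = (\<lambda>j k s. integral {-R..R} (\<lambda>t. a j k t * G ((s, 0) + t *\<^sub>R w)))"
  have smf: "smooth_on UNIV (f j k)" for j k
    unfolding f_def
    by (rule smooth_on_kernel_integral[OF G(1) a(1)
          bounded_linear_Pair[OF bounded_linear_ident bounded_linear_zero]])
  have expand: "conv j G z = (\<Sum>k\<le>N j. f j k (fst z) * snd z ^ k)" if "\<bar>snd z\<bar> < R" for j z
  proof -
    obtain s y where z: "z = (s, y)" by (cases z)
    have y: "\<bar>y\<bar> < R" using that z by simp
    let ?h = "\<lambda>t. p j (t - y) * G (s, t)"
    have "conv j G z = integral {-A..A} (?h \<circ> (+) y)"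
      unfolding conv_def z w_def by (simp add: o_def)
    also have "\<dots> = integral {-A + y..A + y} ?h" by (rule integral_shift_Icc_real)
    also have "\<dots> = integral {-A + y..A + y} (\<lambda>t. if t \<in> {-R..R} then ?h t else 0)"
      using supp by (intro integral_cong) auto
    also have "\<dots> = integral ({-R..R} \<inter> {-A + y..A + y}) ?h" by (rule integral_restrict_Int)
    also have "{-R..R} \<inter> {-A + y..A + y} = {-R..R}" using y unfolding A_def by auto
    also have "integral {-R..R} ?h = integral {-R..R} (\<lambda>t. \<Sum>k\<le>N j. a j k t * G (s, t) * y ^ k)"
      by (intro integral_cong) (simp add: a(2) sum_distrib_left sum_distrib_right ac_simps)
    also have "\<dots> = (\<Sum>k\<le>N j. integral {-R..R} (\<lambda>t. a j k t * G (s, t) * y ^ k))"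
      by (intro integral_sum integrable_continuous_real continuous_intros a(1)
          continuous_on_compose2[OF smooth_on_continuous[OF G(1)]]) auto
    finally show ?thesis unfolding f_def z w_def by simp
  qed
  have opU: "open (V \<inter> {z. \<bar>snd z\<bar> < R})"
    by (intro open_Int G(2) open_Collect_less continuous_intros)
  have KU: "K \<subseteq> V \<inter> {z. \<bar>snd z\<bar> < R}"
  proof
    fix z assume "z \<in> K"
    then show "z \<in> V \<inter> {z. \<bar>snd z\<bar> < R}"
      using G(3) R0(2)[of z] snd_le[of z] unfolding R_def by auto
  qed
  have "C_converges n K (\<lambda>j z. \<Sum>k\<le>N j. f j k (fst z) * snd z ^ k) F" for n
    by (rule C_converges_cong[OF opU KU _ _ conv_conv[OF G(1)]]) (use expand G(4) in auto)
  with smf show ?thesis using that by blast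
qed

section \<open>Hamiltonian vector fields in the plane\<close>

text \<open>The factor \<open>P\<close> is the reciprocal of the density of the symplectic form.\<close>

definition hamiltonian_field ::
  "(real \<times> real \<Rightarrow> real) \<Rightarrow> (real \<times> real \<Rightarrow> real) \<Rightarrow> real \<times> real \<Rightarrow> real \<times> real" where
  "hamiltonian_field P H z = (- (P z * partials [(0, 1)] H z), P z * partials [(1, 0)] H z)"

definition poisson_bracket ::
  "(real \<times> real \<Rightarrow> real) \<Rightarrow> (real \<times> real \<Rightarrow> real) \<Rightarrow> (real \<times> real \<Rightarrow> real) \<Rightarrow> real \<times> real \<Rightarrow> real" where
  "poisson_bracket P A B z = P z * (partials [(1, 0)] A z * partials [(0, 1)] B z
     - partials [(0, 1)] A z * partials [(1, 0)] B z)"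

lemma smooth_on_hamiltonian_field:
  assumes "open D" "smooth_on D P" "smooth_on D H"
  shows "smooth_on D (hamiltonian_field P H)"
  unfolding hamiltonian_field_def
  by (intro smooth_on_Pair smooth_on_minus smooth_on_mult smooth_on_partial assms Basis_plane_mem)

lemma smooth_on_poisson_bracket:
  assumes "open D" "smooth_on D P" "smooth_on D A" "smooth_on D B"
  shows "smooth_on D (poisson_bracket P A B)"
  unfolding poisson_bracket_def
  by (intro smooth_on_diff smooth_on_mult smooth_on_partial assms Basis_plane_mem)

lemma hamiltonian_field_cong:
  assumes "open D" "\<And>z. z \<in> D \<Longrightarrow> A z = B z" "z \<in> D"
  shows "hamiltonian_field P A z = hamiltonian_field P B z"
  unfolding hamiltonian_field_def
  using partials_cong[where F=A and G=B, OF assms] by (simp del: partials.simps)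

lemma hamiltonian_field_add:
  assumes "smooth_on D A" "smooth_on D B" "z \<in> D"
  shows "hamiltonian_field P (\<lambda>z. A z + B z) z = hamiltonian_field P A z + hamiltonian_field P B z"
  using partials_add[OF smooth_on_differentiable[OF assms(1,3)] smooth_on_differentiable[OF assms(2,3)]]
  unfolding hamiltonian_field_def by (simp add: algebra_simps del: partials.simps)

lemma hamiltonian_field_scale:
  assumes "smooth_on D A" "z \<in> D"
  shows "hamiltonian_field P (\<lambda>z. k * A z) z = k *\<^sub>R hamiltonian_field P A z"
  using partials_linear[OF bounded_linear_mult_right smooth_on_differentiable[OF assms]]
  unfolding hamiltonian_field_def by (simp add: algebra_simps del: partials.simps)

lemma partials_hamiltonian_field:
  assumes D: "open D" "smooth_on D P" "smooth_on D H" "z \<in> D" and i: "i \<in> Basis"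
  shows "partials [i] (hamiltonian_field P H) z =
    (- (P z * partials [i, (0, 1)] H z + partials [i] P z * partials [(0, 1)] H z),
     P z * partials [i, (1, 0)] H z + partials [i] P z * partials [(1, 0)] H z)"
proof -
  have H: "partials [j] H differentiable (at z)" if "j \<in> Basis" for j
    by (rule smooth_on_differentiable[OF smooth_on_partial[OF D(3) that] D(4)])
  have P: "P differentiable (at z)" by (rule smooth_on_differentiable[OF D(2,4)])
  have PH: "(\<lambda>z. P z * partials [j] H z) differentiable (at z)" if "j \<in> Basis" for j
    using P H[OF that] by (rule differentiable_mult)
  have eq: "partials [i] (\<lambda>z. P z * partials [j] H z) z =
      P z * partials [i, j] H z + partials [i] P z * partials [j] H z" if "j \<in> Basis" for j
    using partials_mult[OF P H[OF that], of i] by simp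
  have "partials [i] (hamiltonian_field P H) z =
      (partials [i] (\<lambda>z. - (P z * partials [(0, 1)] H z)) z, partials [i] (\<lambda>z. P z * partials [(1, 0)] H z) z)"
    unfolding hamiltonian_field_def
    by (intro partials_Pair differentiable_minus PH Basis_plane_mem)
  then show ?thesis
    by (simp only: partials_minus[OF PH[OF Basis_plane_mem(2)]] eq[OF Basis_plane_mem(1)]
        eq[OF Basis_plane_mem(2)])
qed

lemma partials_poisson_bracket:
  assumes D: "open D" "smooth_on D P" "smooth_on D A" "smooth_on D B" "z \<in> D" and i: "i \<in> Basis"
  shows "partials [i] (poisson_bracket P A B) z =
    P z * (partials [(1, 0)] A z * partials [i, (0, 1)] B z + partials [i, (1, 0)] A z * partials [(0, 1)] B z
      - (partials [(0, 1)] A z * partials [i, (1, 0)] B z + partials [i, (0, 1)] A z * partials [(1, 0)] B z))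
    + partials [i] P z * (partials [(1, 0)] A z * partials [(0, 1)] B z
      - partials [(0, 1)] A z * partials [(1, 0)] B z)"
proof -
  have dA: "partials [j] A differentiable (at z)" if "j \<in> Basis" for j
    by (rule smooth_on_differentiable[OF smooth_on_partial[OF D(3) that] D(5)])
  have dB: "partials [j] B differentiable (at z)" if "j \<in> Basis" for j
    by (rule smooth_on_differentiable[OF smooth_on_partial[OF D(4) that] D(5)])
  have dP: "P differentiable (at z)" by (rule smooth_on_differentiable[OF D(2,5)])
  have dAB: "(\<lambda>z. partials [j] A z * partials [k] B z) differentiable (at z)"
    if "j \<in> Basis" "k \<in> Basis" for j k
    using dA[OF that(1)] dB[OF that(2)] by (rule differentiable_mult)
  have AB: "partials [i] (\<lambda>z. partials [j] A z * partials [k] B z) z =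
      partials [j] A z * partials [i, k] B z + partials [i, j] A z * partials [k] B z"
    if "j \<in> Basis" "k \<in> Basis" for j k
    using partials_mult[OF dA[OF that(1)] dB[OF that(2)], of i] by simp
  note b = Basis_plane_mem
  have "partials [i] (poisson_bracket P A B) z =
      P z * partials [i] (\<lambda>z. partials [(1, 0)] A z * partials [(0, 1)] B z
        - partials [(0, 1)] A z * partials [(1, 0)] B z) z
      + partials [i] P z * (partials [(1, 0)] A z * partials [(0, 1)] B z
        - partials [(0, 1)] A z * partials [(1, 0)] B z)"
    unfolding poisson_bracket_def
    by (intro partials_mult[OF dP differentiable_diff] dAB b)
  then show ?thesis
    by (simp only: partials_diff[OF dAB[OF b(1,2)] dAB[OF b(2,1)]] AB[OF b(1,2)] AB[OF b(2,1)])
qed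

text \<open>Every bivector field in the plane is Poisson, so that \<open>P\<close> is arbitrary here.  Once the mixed second
  derivatives of \<open>A\<close> and \<open>B\<close> are identified, both sides are the same polynomial in the partial
  derivatives.\<close>

theorem lie_bracket_hamiltonian_fields:
  assumes D: "open D" "smooth_on D P" "smooth_on D A" "smooth_on D B" and z: "z \<in> D"
  shows "lie_bracket (hamiltonian_field P A) (hamiltonian_field P B) z =
    hamiltonian_field P (poisson_bracket P A B) z"
proof -
  note b = Basis_plane_mem
  have dA: "hamiltonian_field P A differentiable (at z)"
    by (rule smooth_on_differentiable[OF smooth_on_hamiltonian_field[OF D(1,2,3)] z])
  have dB: "hamiltonian_field P B differentiable (at z)"
    by (rule smooth_on_differentiable[OF smooth_on_hamiltonian_field[OF D(1,2,4)] z])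
  have symA: "partials [(0, 1), (1, 0)] A z = partials [(1, 0), (0, 1)] A z"
    by (rule partials_commute[OF D(1,3) z b(2,1)])
  have symB: "partials [(0, 1), (1, 0)] B z = partials [(1, 0), (0, 1)] B z"
    by (rule partials_commute[OF D(1,4) z b(2,1)])
  show ?thesis
    unfolding lie_bracket_def frechet_derivative_plane[OF dA] frechet_derivative_plane[OF dB]
      partials_hamiltonian_field[OF D(1,2,3) z b(1)] partials_hamiltonian_field[OF D(1,2,3) z b(2)]
      partials_hamiltonian_field[OF D(1,2,4) z b(1)] partials_hamiltonian_field[OF D(1,2,4) z b(2)]
      hamiltonian_field_def[of P A z] hamiltonian_field_def[of P B z]
      hamiltonian_field_def[of P "poisson_bracket P A B" z]
      partials_poisson_bracket[OF D z b(1)] partials_poisson_bracket[OF D z b(2)] symA symB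
    by (simp add: algebra_simps del: partials.simps)
qed

lemma lie_bracket_cong:
  assumes "open D" "z \<in> D" "\<And>y. y \<in> D \<Longrightarrow> X y = X' y" "\<And>y. y \<in> D \<Longrightarrow> Y y = Y' y"
  shows "lie_bracket X Y z = lie_bracket X' Y' z"
proof -
  have "partials [i] X z = partials [i] X' z" "partials [i] Y z = partials [i] Y' z" for i
    by (rule partials_cong[OF assms(1) _ assms(2)], rule assms, assumption)+
  then have "frechet_derivative X (at z) = frechet_derivative X' (at z)"
    "frechet_derivative Y (at z) = frechet_derivative Y' (at z)" by (auto simp: fun_eq_iff)
  then show ?thesis unfolding lie_bracket_def using assms by simp
qed

lemma generated_lie_algebra_hamiltonian:
  assumes D: "open D" "smooth_on D P"
    and G: "\<And>X. X \<in> G \<Longrightarrow> \<exists>H. smooth_on D H \<and> (\<forall>z\<in>D. X z = hamiltonian_field P H z)"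
    and X: "X \<in> generated_lie_algebra G"
  shows "\<exists>H. smooth_on D H \<and> (\<forall>z\<in>D. X z = hamiltonian_field P H z)"
  using X
proof induction
  case (generator X)
  then show ?case by (rule G)
next
  case zero
  show ?case
    by (rule exI[of _ "\<lambda>z. 0"]) (auto simp: hamiltonian_field_def zero_prod_def intro: smooth_on_const D(1))
next
  case (add X Y)
  then obtain A B where "smooth_on D A" "\<forall>z\<in>D. X z = hamiltonian_field P A z"
    "smooth_on D B" "\<forall>z\<in>D. Y z = hamiltonian_field P B z" by blast
  then show ?case
    by (intro exI[of _ "\<lambda>z. A z + B z"]) (simp add: hamiltonian_field_add[of D] smooth_on_add D(1))
next
  case (scale X k)
  then obtain A where "smooth_on D A" "\<forall>z\<in>D. X z = hamiltonian_field P A z" by blast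
  then show ?case
    by (intro exI[of _ "\<lambda>z. k * A z"])
       (simp add: hamiltonian_field_scale[of D] smooth_on_mult smooth_on_const D(1))
next
  case (bracket X Y)
  then obtain A B where AB: "smooth_on D A" "\<forall>z\<in>D. X z = hamiltonian_field P A z"
    "smooth_on D B" "\<forall>z\<in>D. Y z = hamiltonian_field P B z" by blast
  have "lie_bracket X Y z = hamiltonian_field P (poisson_bracket P A B) z" if "z \<in> D" for z
    using lie_bracket_cong[OF D(1) that, of X "hamiltonian_field P A" Y "hamiltonian_field P B"] AB
      lie_bracket_hamiltonian_fields[OF D AB(1,3) that] by simp
  then show ?case
    using smooth_on_poisson_bracket[OF D AB(1,3)] by blast
qed

text \<open>One order of convergence is spent on the gradient of the Hamiltonian.\<close>

lemma C_converges_hamiltonian_field: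
  assumes D: "open D" "K \<subseteq> D" "compact K" and P: "smooth_on D P"
    and u: "\<And>j. smooth_on D (u j)" and H: "smooth_on D H" and conv: "C_converges (Suc n) K u H"
  shows "C_converges n K (\<lambda>j. hamiltonian_field P (u j)) (hamiltonian_field P H)"
proof -
  have c: "C_converges n K (\<lambda>j. partials [i] (u j)) (partials [i] H)" if "i \<in> Basis" for i
    using conv that unfolding C_converges_Suc by blast
  have bl: "bounded_linear (\<lambda>x::real. (- x, 0::real))" "bounded_linear (\<lambda>x::real. (0::real, x))"
    by (intro bounded_linear_Pair bounded_linear_minus bounded_linear_ident bounded_linear_zero)+
  note b = Basis_plane_mem
  have sm: "smooth_on D (\<lambda>z. P z *\<^sub>R partials [i] G z)" if "smooth_on D G" "i \<in> Basis" for i and G :: "real \<times> real \<Rightarrow> real"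
    by (intro smooth_on_scaleR D(1) P smooth_on_partial that)
  have PC: "C_converges n K (\<lambda>j z. P z *\<^sub>R partials [i] (u j) z) (\<lambda>z. P z *\<^sub>R partials [i] H z)"
    if "i \<in> Basis" for i
    by (rule C_converges_scaleR[OF D P smooth_on_partial[OF u that] smooth_on_partial[OF H that] c[OF that]])
  have "C_converges n K
      (\<lambda>j z. (- (P z *\<^sub>R partials [(0, 1)] (u j) z), 0) + (0, P z *\<^sub>R partials [(1, 0)] (u j) z))
      (\<lambda>z. (- (P z *\<^sub>R partials [(0, 1)] H z), 0) + (0, P z *\<^sub>R partials [(1, 0)] H z))"
    by (rule C_converges_add[OF D(1,2) _ _ _ _
          C_converges_linear[OF D(1,2) bl(1) sm[OF u b(2)] sm[OF H b(2)] PC[OF b(2)]]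
          C_converges_linear[OF D(1,2) bl(2) sm[OF u b(1)] sm[OF H b(1)] PC[OF b(1)]]])
       (rule smooth_on_linear[OF bl(1) D(1) sm[OF u b(2)]] smooth_on_linear[OF bl(1) D(1) sm[OF H b(2)]]
          smooth_on_linear[OF bl(2) D(1) sm[OF u b(1)]] smooth_on_linear[OF bl(2) D(1) sm[OF H b(1)]])+
  then show ?thesis
    by (rule C_converges_cong[OF D(1,2), rotated 2])
       (simp_all add: hamiltonian_field_def del: partials.simps)
qed

text \<open>On the strip over the interval \<open>f ds\<close> is a closed one-form; its primitive, restricted to the axis, is
  an antiderivative.\<close>

lemma smooth_antiderivative_exists:
  fixes f :: "real \<Rightarrow> real"
  assumes "smooth_on {a<..<b} f"
  obtains E where "smooth_on {a<..<b} E" "\<And>s. s \<in> {a<..<b} \<Longrightarrow> (E has_real_derivative f s) (at s)"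
proof -
  let ?D = "{a<..<b} \<times> (UNIV :: real set)"
  have D: "open ?D" "contractible ?D"
    by (auto intro!: open_Times convex_imp_contractible convex_Times)
  have f: "smooth_on ?D (\<lambda>z. f (fst z))"
    by (rule smooth_on_compose[OF D(1) open_greaterThanLessThan _ smooth_on_fst[OF D(1) smooth_on_id[OF D(1)]] assms])
       auto
  have "partials [(0, 1)] (\<lambda>z. f (fst z)) z = partials [(1, 0)] (\<lambda>z. 0 :: real) z" if "z \<in> ?D" for z
  proof -
    have "(f has_derivative frechet_derivative f (at (fst z))) (at (fst z))"
      using that by (intro smooth_on_derivative[OF assms]) auto
    from diff_chain_at[OF bounded_linear_imp_has_derivative[OF bounded_linear_fst] this]
    have "((\<lambda>z. f (fst z)) has_derivative (\<lambda>h. frechet_derivative f (at (fst z)) (fst h))) (at z)"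
      by (simp add: o_def)
    from partials_eq_derivative[OF this, of "(0, 1)"] linear_0[OF has_derivative_linear[OF \<open>(f has_derivative _) _\<close>]]
    show ?thesis by simp
  qed
  from closed_form_has_primitive[OF D f smooth_on_const[OF D(1)] this]
  obtain H where H: "smooth_on ?D H" "\<And>z. z \<in> ?D \<Longrightarrow> (H has_derivative (\<lambda>h. f (fst z) * fst h + 0 * snd h)) (at z)"
    by blast
  define E where "E = (\<lambda>s. H (s, 0))"
  have dE: "(E has_real_derivative f s) (at s)" if "s \<in> {a<..<b}" for s
  proof -
    have d: "((\<lambda>s. (s, 0)) has_derivative (\<lambda>h. (h, 0))) (at s)"
      by (auto intro!: derivative_eq_intros)
    have "(s, 0) \<in> ?D" using that by simp
    from diff_chain_at[OF d H(2)[OF this]]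
    show ?thesis unfolding has_field_derivative_def E_def by (simp add: o_def)
  qed
  have "smooth_on {a<..<b} E"
  proof (rule smooth_on_if_derivative[OF open_greaterThanLessThan])
    show "(E has_derivative (\<lambda>h. f s * h)) (at s)" if "s \<in> {a<..<b}" for s
      using dE[OF that] unfolding has_field_derivative_def .
    show "smooth_on {a<..<b} (\<lambda>s. f s * i)" for i
      by (intro smooth_on_mult smooth_on_const assms open_greaterThanLessThan)
  qed
  then show ?thesis using dE that by blast
qed

section \<open>Symplectic fields are Hamiltonian\<close>

text \<open>For the form \<open>\<mu> dq \<and> ds\<close> the Lie derivative is the divergence of \<open>\<mu> X\<close> times the area form.\<close>

lemma lie_derivative_area_form:
  assumes D: "open D" "z \<in> D" and \<mu>: "\<mu> differentiable (at z)" and X: "X differentiable (at z)"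
    and \<omega>: "\<And>y v w. y \<in> D \<Longrightarrow> \<omega> y v w = \<mu> y * (snd v * fst w - snd w * fst v)"
  shows "lie_derivative_2form X \<omega> z v w =
    (partials [(1, 0)] (\<lambda>y. \<mu> y * fst (X y)) z + partials [(0, 1)] (\<lambda>y. \<mu> y * snd (X y)) z)
      * (snd v * fst w - snd w * fst v)"
proof -
  let ?k = "snd v * fst w - snd w * fst v"
  have "partials [i] (\<lambda>y. \<omega> y v w) z = partials [i] (\<lambda>y. \<mu> y * ?k) z" for i
    by (rule partials_cong[OF D(1) _ D(2)]) (rule \<omega>)
  then have "frechet_derivative (\<lambda>y. \<omega> y v w) (at z) h = frechet_derivative (\<lambda>y. \<mu> y * ?k) (at z) h" for h
    by simp
  moreover have "((\<lambda>y. \<mu> y * ?k) has_derivative (\<lambda>h. frechet_derivative \<mu> (at z) h * ?k)) (at z)"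
    by (intro has_derivative_mult_left \<mu>[unfolded frechet_derivative_works])
  ultimately have 1: "frechet_derivative (\<lambda>y. \<omega> y v w) (at z) h = frechet_derivative \<mu> (at z) h * ?k" for h
    using frechet_derivative_at by metis
  have fX: "(\<lambda>y. fst (X y)) differentiable (at z)" "(\<lambda>y. snd (X y)) differentiable (at z)"
    using bounded_linear.has_derivative[OF bounded_linear_fst X[unfolded frechet_derivative_works]]
      bounded_linear.has_derivative[OF bounded_linear_snd X[unfolded frechet_derivative_works]]
    by (auto simp: differentiable_def)
  have 2: "partials [i] (\<lambda>y. fst (X y)) z = fst (partials [i] X z)"
    "partials [i] (\<lambda>y. snd (X y)) z = snd (partials [i] X z)" for i
    by (rule partials_linear[OF bounded_linear_fst X] partials_linear[OF bounded_linear_snd X])+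
  show ?thesis
    unfolding lie_derivative_2form_def 1 \<omega>[OF D(2)] frechet_derivative_plane[OF \<mu>]
      frechet_derivative_plane[OF X] partials_mult[OF \<mu> fX(1)] partials_mult[OF \<mu> fX(2)] 2
    by (simp add: algebra_simps del: partials.simps)
qed

text \<open>A field \<open>\<mu> X\<close> without divergence is a closed one-form turned by a right angle; contractibility of
  the domain provides its primitive, the Hamiltonian.\<close>

theorem symplectic_fields_area_form:
  assumes D: "open D" "contractible D" and \<mu>: "smooth_on D \<mu>" "\<And>z. z \<in> D \<Longrightarrow> \<mu> z \<noteq> 0"
    and \<omega>: "\<And>y v w. y \<in> D \<Longrightarrow> \<omega> y v w = \<mu> y * (snd v * fst w - snd w * fst v)"
  shows "X \<in> symplectic_fields D \<omega> \<longleftrightarrow>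
    (\<exists>H. smooth_on D H \<and> (\<forall>z\<in>D. X z = hamiltonian_field (\<lambda>z. 1 / \<mu> z) H z))"
proof
  assume "X \<in> symplectic_fields D \<omega>"
  then have X: "smooth_on D X" "\<And>z v w. z \<in> D \<Longrightarrow> lie_derivative_2form X \<omega> z v w = 0"
    unfolding symplectic_fields_def by auto
  let ?A = "\<lambda>y. \<mu> y * snd (X y)" and ?B = "\<lambda>y. - (\<mu> y * fst (X y))"
  have smA: "smooth_on D ?A" by (intro smooth_on_mult smooth_on_snd D(1) \<mu> X)
  have smB': "smooth_on D (\<lambda>y. \<mu> y * fst (X y))" by (intro smooth_on_mult smooth_on_fst D(1) \<mu> X)
  then have smB: "smooth_on D ?B" by (intro smooth_on_minus D(1))
  have "partials [(0, 1)] ?A z = partials [(1, 0)] ?B z" if z: "z \<in> D" for z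
    using X(2)[OF z, of "(0, 1)" "(1, 0)"]
      lie_derivative_area_form[OF D(1) z smooth_on_differentiable[OF \<mu>(1) z]
        smooth_on_differentiable[OF X(1) z] \<omega>, of "(0, 1)" "(1, 0)"]
      partials_minus[OF smooth_on_differentiable[OF smB' z], of "(1, 0)"]
    by (simp del: partials.simps)
  from closed_form_has_primitive[OF D smA smB this]
  obtain H where H: "smooth_on D H"
    "\<And>z. z \<in> D \<Longrightarrow> (H has_derivative (\<lambda>h. ?A z * fst h + ?B z * snd h)) (at z)" by blast
  have "X z = hamiltonian_field (\<lambda>z. 1 / \<mu> z) H z" if z: "z \<in> D" for z
    using partials_eq_derivative[OF H(2)[OF z], of "(1, 0)"]
      partials_eq_derivative[OF H(2)[OF z], of "(0, 1)"] \<mu>(2)[OF z]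
    unfolding hamiltonian_field_def by (simp add: prod_eq_iff del: partials.simps)
  with H(1) show "\<exists>H. smooth_on D H \<and> (\<forall>z\<in>D. X z = hamiltonian_field (\<lambda>z. 1 / \<mu> z) H z)" by blast
next
  assume "\<exists>H. smooth_on D H \<and> (\<forall>z\<in>D. X z = hamiltonian_field (\<lambda>z. 1 / \<mu> z) H z)"
  then obtain H where H: "smooth_on D H" "\<And>z. z \<in> D \<Longrightarrow> X z = hamiltonian_field (\<lambda>z. 1 / \<mu> z) H z" by blast
  have smP: "smooth_on D (\<lambda>z. 1 / \<mu> z)" by (intro smooth_on_divide smooth_on_const D(1) \<mu>)
  have smX: "smooth_on D X"
    by (rule smooth_on_cong[OF D(1) _ smooth_on_hamiltonian_field[OF D(1) smP H(1)]]) (simp add: H(2))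
  note b = Basis_plane_mem
  have "lie_derivative_2form X \<omega> z v w = 0" if z: "z \<in> D" for z v w
  proof -
    have "partials [(1, 0)] (\<lambda>y. \<mu> y * fst (X y)) z = partials [(1, 0)] (\<lambda>y. - partials [(0, 1)] H y) z"
      by (rule partials_cong[OF D(1) _ z]) (use H(2) \<mu>(2) in \<open>simp add: hamiltonian_field_def\<close>)
    moreover have "partials [(0, 1)] (\<lambda>y. \<mu> y * snd (X y)) z = partials [(0, 1)] (partials [(1, 0)] H) z"
      by (rule partials_cong[OF D(1) _ z]) (use H(2) \<mu>(2) in \<open>simp add: hamiltonian_field_def\<close>)
    moreover have "partials [(1, 0)] (\<lambda>y. - partials [(0, 1)] H y) z = - partials [(1, 0), (0, 1)] H z"
      using partials_minus[OF smooth_on_differentiable[OF smooth_on_partial[OF H(1) b(2)] z]] by simp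
    moreover have "partials [(0, 1), (1, 0)] H z = partials [(1, 0), (0, 1)] H z"
      by (rule partials_commute[OF D(1) H(1) z b(2,1)])
    ultimately have "partials [(1, 0)] (\<lambda>y. \<mu> y * fst (X y)) z + partials [(0, 1)] (\<lambda>y. \<mu> y * snd (X y)) z = 0"
      by simp
    then show ?thesis
      using lie_derivative_area_form[OF D(1) z smooth_on_differentiable[OF \<mu>(1) z]
        smooth_on_differentiable[OF smX z] \<omega>, of v w] by simp
  qed
  with smX show "X \<in> symplectic_fields D \<omega>" unfolding symplectic_fields_def by blast
qed

section \<open>Density of the Lie algebra generated by multiples of the cosine\<close>

text \<open>What the argument needs of the curve: \<open>vel\<close> is its speed, and \<open>lam\<close> converts the second coordinate,
  measured along a coordinate axis, into the signed length of the tangent vector \<open>w\<close>.\<close>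

locale tangent_coordinates =
  fixes a b :: real and D :: "(real \<times> real) set" and vel lam :: "real \<Rightarrow> real"
  assumes D: "open D" "contractible D"
    and base: "\<And>z. z \<in> D \<Longrightarrow> fst z \<in> {a<..<b}"
    and vel: "smooth_on {a<..<b} vel" "\<And>s. s \<in> {a<..<b} \<Longrightarrow> vel s > 0"
    and lam: "smooth_on {a<..<b} lam" "\<And>s. s \<in> {a<..<b} \<Longrightarrow> lam s \<noteq> 0"
    and transverse: "\<And>z. z \<in> D \<Longrightarrow> (lam (fst z) * snd z)\<^sup>2 < 1"
begin

text \<open>The functions \<open>sine\<close>, \<open>cosine\<close> and \<open>slope\<close> are the sine, cosine and tangent of the angle between the line and the
  normal of the curve.\<close>

definition sine :: "real \<times> real \<Rightarrow> real" where "sine z = lam (fst z) * snd z"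
definition cosine :: "real \<times> real \<Rightarrow> real" where "cosine z = sqrt (1 - (sine z)\<^sup>2)"
definition slope :: "real \<times> real \<Rightarrow> real" where "slope z = sine z / cosine z"
definition area :: "real \<times> real \<Rightarrow> real" where "area z = vel (fst z) * lam (fst z)"

abbreviation Ham :: "(real \<times> real \<Rightarrow> real) \<Rightarrow> real \<times> real \<Rightarrow> real \<times> real" where
  "Ham \<equiv> hamiltonian_field (\<lambda>z. 1 / area z)"

lemma smooth_on_base:
  fixes F :: "real \<Rightarrow> real"
  shows "smooth_on {a<..<b} F \<Longrightarrow> smooth_on D (\<lambda>z. F (fst z))"
  by (rule smooth_on_compose[OF D(1) open_greaterThanLessThan base smooth_on_fst[OF D(1) smooth_on_id[OF D(1)]]])

lemma smooth_on_sine: "smooth_on D sine"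
  unfolding sine_def by (intro smooth_on_mult smooth_on_base lam smooth_on_snd smooth_on_id D(1))

lemma cosine_pos: "z \<in> D \<Longrightarrow> cosine z > 0"
  using transverse unfolding cosine_def sine_def by simp

lemma smooth_on_cosine: "smooth_on D cosine"
  unfolding cosine_def using transverse
  by (intro smooth_on_sqrt smooth_on_diff smooth_on_const smooth_on_power smooth_on_sine D(1))
     (simp add: sine_def)

lemma smooth_on_slope: "smooth_on D slope"
  unfolding slope_def using cosine_pos
  by (intro smooth_on_divide smooth_on_cosine smooth_on_sine D(1)) (metis less_irrefl)

lemma area_nonzero: "z \<in> D \<Longrightarrow> area z \<noteq> 0"
  using vel(2)[OF base] lam(2)[OF base] unfolding area_def by fastforce

lemma smooth_on_area: "smooth_on D area"
  unfolding area_def by (intro smooth_on_mult smooth_on_base vel lam D(1))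

lemma smooth_on_inverse_area: "smooth_on D (\<lambda>z. 1 / area z)"
  by (intro smooth_on_divide smooth_on_const smooth_on_area area_nonzero D(1))

lemma partials_separated:
  fixes F \<phi> :: "real \<Rightarrow> real"
  assumes z: "z \<in> D" and F: "(F has_real_derivative F') (at (fst z))"
    and \<phi>: "(\<phi> has_real_derivative d) (at (sine z))"
  shows "partials [(1, 0)] (\<lambda>z. F (fst z) * \<phi> (sine z)) z =
      F' * \<phi> (sine z) + F (fst z) * d * (partials [1] lam (fst z) * snd z)"
    and "partials [(0, 1)] (\<lambda>z. F (fst z) * \<phi> (sine z)) z = F (fst z) * d * lam (fst z)"
proof -
  have dfst: "(fst has_derivative fst) (at z)" "(snd has_derivative snd) (at z)"
    by (intro bounded_linear_imp_has_derivative bounded_linear_fst bounded_linear_snd)+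
  have lam': "(lam has_real_derivative partials [1] lam (fst z)) (at (fst z))"
    using smooth_on_real_has_derivative[OF lam(1) base[OF z]]
    by (simp add: has_real_derivative_iff_has_vector_derivative)
  have "((\<lambda>z. lam (fst z) * snd z) has_derivative
      (\<lambda>h. lam (fst z) * snd h + (fst h * partials [1] lam (fst z)) * snd z)) (at z)"
    by (rule has_derivative_mult[OF DERIV_compose_FDERIV[OF lam' dfst(1)] dfst(2)])
  then have "(sine has_derivative
      (\<lambda>h. lam (fst z) * snd h + (fst h * partials [1] lam (fst z)) * snd z)) (at z)"
    unfolding sine_def .
  from has_derivative_mult[OF DERIV_compose_FDERIV[OF F dfst(1)] DERIV_compose_FDERIV[OF \<phi> this]]
  have *: "((\<lambda>z. F (fst z) * \<phi> (sine z)) has_derivative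
      (\<lambda>h. F (fst z) * ((lam (fst z) * snd h + (fst h * partials [1] lam (fst z)) * snd z) * d)
        + fst h * F' * \<phi> (sine z))) (at z)" .
  show "partials [(1, 0)] (\<lambda>z. F (fst z) * \<phi> (sine z)) z =
      F' * \<phi> (sine z) + F (fst z) * d * (partials [1] lam (fst z) * snd z)"
    unfolding partials_eq_derivative[OF *] by (simp add: algebra_simps)
  show "partials [(0, 1)] (\<lambda>z. F (fst z) * \<phi> (sine z)) z = F (fst z) * d * lam (fst z)"
    unfolding partials_eq_derivative[OF *] by (simp add: algebra_simps)
qed

lemma cosine_profile_derivative:
  assumes z: "z \<in> D"
  shows "((\<lambda>u. sqrt (1 - u\<^sup>2)) has_real_derivative - slope z) (at (sine z))"
proof -
  have pos: "1 - (sine z)\<^sup>2 > 0" using transverse[OF z] by (simp add: sine_def)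
  have "((\<lambda>u. 1 - u\<^sup>2) has_real_derivative - (2 * sine z)) (at (sine z))"
    by (auto intro!: derivative_eq_intros)
  from DERIV_chain2[OF DERIV_real_sqrt[OF pos] this]
  have "((\<lambda>u. sqrt (1 - u\<^sup>2)) has_real_derivative inverse (cosine z) / 2 * - (2 * sine z)) (at (sine z))"
    unfolding cosine_def .
  moreover have "inverse (cosine z) / 2 * - (2 * sine z) = - slope z"
    using cosine_pos[OF z] by (simp add: slope_def field_simps)
  ultimately show ?thesis by metis
qed

text \<open>Both functions depend on the second coordinate through \<open>sine\<close> alone, so that the derivatives of \<open>lam\<close>
  cancel and only the derivative of the coefficient \<open>F\<close> survives.\<close>

lemma poisson_bracket_with_cosine:
  fixes F \<phi> :: "real \<Rightarrow> real"
  assumes z: "z \<in> D" and F: "(F has_real_derivative F') (at (fst z))"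
    and \<phi>: "(\<phi> has_real_derivative d) (at (sine z))"
  shows "poisson_bracket (\<lambda>z. 1 / area z) (\<lambda>z. F (fst z) * \<phi> (sine z)) cosine z =
    - (F' / vel (fst z) * \<phi> (sine z) * slope z)"
proof -
  let ?\<rho> = "\<lambda>u. sqrt (1 - u\<^sup>2)"
  have c: "((\<lambda>s. 1 :: real) has_real_derivative 0) (at (fst z))" by simp
  have eq: "cosine = (\<lambda>z. 1 * ?\<rho> (sine z))" by (simp add: cosine_def fun_eq_iff)
  have *: "partials [(1, 0)] cosine z = - slope z * (partials [1] lam (fst z) * snd z)"
    "partials [(0, 1)] cosine z = - slope z * lam (fst z)"
    unfolding eq partials_separated[OF z c cosine_profile_derivative[OF z]] by (simp_all only: mult_zero_left add_0_left mult_1_left)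
  have alg: "1 / (v * l) * ((F' * x + f * d * (l' * q)) * (- S * l) - f * d * l * (- S * (l' * q))) =
      - (F' / v * x * S)" if "v \<noteq> 0" "l \<noteq> 0" for v l x f l' q S
    using that by (simp add: field_simps)
  show ?thesis
    unfolding poisson_bracket_def * partials_separated[OF z F \<phi>] area_def
    using vel(2)[OF base[OF z]] lam(2)[OF base[OF z]] by (intro alg) auto
qed

text \<open>The bracket with \<open>cosine\<close> raises the power of \<open>slope\<close> by one and differentiates the coefficient.  It is
  therefore applied to an antiderivative of the coefficient, weighted with the speed.\<close>

lemma cosine_slope_powers_generated:
  fixes F :: "real \<Rightarrow> real"
  assumes gen: "\<And>F. smooth_on {a<..<b} F \<Longrightarrow>
      \<exists>X\<in>G. \<forall>z\<in>D. X z = Ham (\<lambda>z. - 2 * (F (fst z) * cosine z)) z"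
    and F: "smooth_on {a<..<b} F"
  shows "\<exists>Y\<in>generated_lie_algebra G. \<forall>z\<in>D. Y z = Ham (\<lambda>z. F (fst z) * (cosine z * slope z ^ k)) z"
  using F
proof (induction k arbitrary: F)
  case 0
  obtain X where X: "X \<in> G" "\<And>z. z \<in> D \<Longrightarrow> X z = Ham (\<lambda>z. - 2 * (F (fst z) * cosine z)) z"
    using gen[OF 0] by blast
  have "smooth_on D (\<lambda>z. F (fst z) * cosine z)"
    by (intro smooth_on_mult smooth_on_base 0 smooth_on_cosine D(1))
  then have *: "(- 1 / 2) *\<^sub>R X z = Ham (\<lambda>z. F (fst z) * (cosine z * slope z ^ 0)) z" if "z \<in> D" for z
    using X(2)[OF that] hamiltonian_field_scale[of D "\<lambda>z. F (fst z) * cosine z" z _ "- 2"] that by simp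
  show ?case
    by (rule bexI[OF _ generated_lie_algebra.scale[OF generated_lie_algebra.generator[OF X(1)]]])
       (rule ballI, erule *)
next
  case (Suc k)
  have "smooth_on {a<..<b} (\<lambda>s. - (F s * vel s))"
    by (intro smooth_on_minus smooth_on_mult Suc.prems vel open_greaterThanLessThan)
  then obtain E where E: "smooth_on {a<..<b} E"
    "\<And>s. s \<in> {a<..<b} \<Longrightarrow> (E has_real_derivative - (F s * vel s)) (at s)"
    by (rule smooth_antiderivative_exists) (rule that)
  let ?A = "\<lambda>z. E (fst z) * (cosine z * slope z ^ k)"
  have smA: "smooth_on D ?A"
    by (intro smooth_on_mult smooth_on_base E smooth_on_cosine smooth_on_power smooth_on_slope D(1))
  obtain Y where Y: "Y \<in> generated_lie_algebra G" "\<And>z. z \<in> D \<Longrightarrow> Y z = Ham ?A z"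
    using Suc.IH[OF E(1)] by blast
  \<comment> \<open>The coefficient \<open>- 1 / 2\<close> gives the generator with Hamiltonian \<open>cosine\<close>.\<close>
  have one: "smooth_on {a<..<b} (\<lambda>s. - 1 / 2 :: real)" by (intro smooth_on_const open_greaterThanLessThan)
  obtain Z where Z: "Z \<in> G" "\<And>z. z \<in> D \<Longrightarrow> Z z = Ham cosine z"
    using gen[OF one] by auto
  let ?\<phi> = "\<lambda>u::real. sqrt (1 - u\<^sup>2) * (u / sqrt (1 - u\<^sup>2)) ^ k"
  have op: "open {u::real. u\<^sup>2 < 1}" by (intro open_Collect_less continuous_intros)
  have sm\<rho>: "smooth_on {u::real. u\<^sup>2 < 1} (\<lambda>u. sqrt (1 - u\<^sup>2))"
    by (intro smooth_on_sqrt smooth_on_diff smooth_on_const smooth_on_power smooth_on_id op) simp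
  have sm\<phi>: "smooth_on {u. u\<^sup>2 < 1} ?\<phi>"
    by (intro smooth_on_mult smooth_on_power smooth_on_divide sm\<rho> smooth_on_id op) simp
  have A: "?A = (\<lambda>z. E (fst z) * ?\<phi> (sine z))" by (simp add: slope_def cosine_def)
  have pb: "poisson_bracket (\<lambda>z. 1 / area z) ?A cosine z = F (fst z) * (cosine z * slope z ^ Suc k)"
    if z: "z \<in> D" for z
  proof -
    have "sine z \<in> {u. u\<^sup>2 < 1}" using transverse[OF z] by (simp add: sine_def)
    from smooth_on_real_has_derivative[OF sm\<phi> this]
    have d: "(?\<phi> has_real_derivative partials [1] ?\<phi> (sine z)) (at (sine z))"
      by (simp add: has_real_derivative_iff_has_vector_derivative)
    show ?thesis
      unfolding A poisson_bracket_with_cosine[OF z E(2)[OF base[OF z]] d]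
      using vel(2)[OF base[OF z]] by (simp add: slope_def cosine_def)
  qed
  have *: "lie_bracket Y Z z = Ham (\<lambda>z. F (fst z) * (cosine z * slope z ^ Suc k)) z"
    if z: "z \<in> D" for z
  proof -
    have "lie_bracket Y Z z = lie_bracket (Ham ?A) (Ham cosine) z"
      by (rule lie_bracket_cong[OF D(1) z Y(2) Z(2)])
    also have "\<dots> = Ham (poisson_bracket (\<lambda>z. 1 / area z) ?A cosine) z"
      by (rule lie_bracket_hamiltonian_fields[OF D(1) smooth_on_inverse_area smA smooth_on_cosine z])
    also have "\<dots> = Ham (\<lambda>z. F (fst z) * (cosine z * slope z ^ Suc k)) z"
      by (rule hamiltonian_field_cong[OF D(1) pb z])
    finally show ?thesis .
  qed
  show ?case
    by (rule bexI[OF _ generated_lie_algebra.bracket[OF Y(1) generated_lie_algebra.generator[OF Z(1)]]])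
       (rule ballI, erule *)
qed

lemma cosine_slope_polynomials_generated:
  fixes f :: "nat \<Rightarrow> real \<Rightarrow> real"
  assumes gen: "\<And>F. smooth_on {a<..<b} F \<Longrightarrow>
      \<exists>X\<in>G. \<forall>z\<in>D. X z = Ham (\<lambda>z. - 2 * (F (fst z) * cosine z)) z"
    and f: "\<And>k. smooth_on {a<..<b} (f k)"
  shows "\<exists>Y\<in>generated_lie_algebra G.
    \<forall>z\<in>D. Y z = Ham (\<lambda>z. \<Sum>k<n. f k (fst z) * (cosine z * slope z ^ k)) z"
proof (induction n)
  case 0
  have "(\<lambda>z. 0) \<in> generated_lie_algebra G" by (rule generated_lie_algebra.zero)
  moreover have "Ham (\<lambda>z. \<Sum>k<0. f k (fst z) * (cosine z * slope z ^ k)) z = 0" for z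
    by (simp add: hamiltonian_field_def zero_prod_def)
  ultimately show ?case by (intro bexI[of _ "\<lambda>z. 0"]) simp_all
next
  case (Suc n)
  let ?S = "\<lambda>z. \<Sum>k<n. f k (fst z) * (cosine z * slope z ^ k)"
  let ?T = "\<lambda>z. f n (fst z) * (cosine z * slope z ^ n)"
  have T: "smooth_on D (\<lambda>z. f k (fst z) * (cosine z * slope z ^ k))" for k
    by (intro smooth_on_mult smooth_on_base f smooth_on_cosine smooth_on_power smooth_on_slope D(1))
  have S: "smooth_on D ?S" by (intro smooth_on_sum T D(1))
  obtain Y where Y: "Y \<in> generated_lie_algebra G" "\<And>z. z \<in> D \<Longrightarrow> Y z = Ham ?S z"
    using Suc by blast
  obtain Z where Z: "Z \<in> generated_lie_algebra G" "\<And>z. z \<in> D \<Longrightarrow> Z z = Ham ?T z"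
    using cosine_slope_powers_generated[OF gen f] by blast
  have *: "Y z + Z z = Ham (\<lambda>z. \<Sum>k<Suc n. f k (fst z) * (cosine z * slope z ^ k)) z" if "z \<in> D" for z
    using hamiltonian_field_add[OF S T[of n] that] Y(2)[OF that] Z(2)[OF that] by simp
  show ?case by (rule bexI[OF _ generated_lie_algebra.add[OF Y(1) Z(1)]])
       (rule ballI, erule *)
qed

text \<open>In the coordinates \<open>(s, slope)\<close> the generated Hamiltonians, divided by \<open>cosine\<close>, include
  all polynomials in the second variable with smooth coefficients in the first.\<close>

definition straighten :: "real \<times> real \<Rightarrow> real \<times> real" where "straighten z = (fst z, slope z)"

definition unstraighten :: "real \<times> real \<Rightarrow> real \<times> real" where
  "unstraighten x = (fst x, snd x / sqrt (1 + (snd x)\<^sup>2) / lam (fst x))"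

lemma one_plus_slope_square: "z \<in> D \<Longrightarrow> sqrt (1 + (slope z)\<^sup>2) = 1 / cosine z"
proof -
  assume z: "z \<in> D"
  have "(cosine z)\<^sup>2 = 1 - (sine z)\<^sup>2"
    using transverse[OF z] by (simp add: cosine_def sine_def)
  then have "1 + (slope z)\<^sup>2 = (1 / cosine z)\<^sup>2"
    using cosine_pos[OF z] by (simp add: slope_def power_divide field_simps)
  then show ?thesis using cosine_pos[OF z] by simp
qed

lemma unstraighten_straighten: "z \<in> D \<Longrightarrow> unstraighten (straighten z) = z"
  using cosine_pos[of z] lam(2)[OF base, of z]
  by (simp add: unstraighten_def straighten_def one_plus_slope_square)
     (simp add: slope_def sine_def prod_eq_iff)

lemma smooth_on_unstraighten: "smooth_on ({a<..<b} \<times> UNIV) unstraighten"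
proof -
  have op: "open ({a<..<b} \<times> (UNIV :: real set))" by (intro open_Times) auto
  have pos: "1 + x\<^sup>2 > 0" for x :: real by (simp add: add_pos_nonneg)
  have "smooth_on ({a<..<b} \<times> (UNIV :: real set)) (\<lambda>x. lam (fst x))"
    by (rule smooth_on_compose[OF op open_greaterThanLessThan _ smooth_on_fst[OF op smooth_on_id[OF op]] lam(1)])
       auto
  moreover have "sqrt (1 + x\<^sup>2) \<noteq> 0" for x :: real
    using pos[of x] by simp
  ultimately show ?thesis
    unfolding unstraighten_def using lam(2)
    by (intro smooth_on_Pair smooth_on_divide smooth_on_sqrt smooth_on_add smooth_on_power smooth_on_fst
        smooth_on_snd smooth_on_const smooth_on_id op pos) auto
qed

text \<open>A Hamiltonian divided by \<open>cosine\<close> and expressed in the straightened coordinates is approximated by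
  fibrewise polynomials.  Composition with \<open>straighten\<close> and multiplication by \<open>cosine\<close> preserve convergence
  with derivatives and lead back to Hamiltonians of generated fields.\<close>

theorem generated_lie_algebra_dense:
  assumes gen: "\<And>F. smooth_on {a<..<b} F \<Longrightarrow>
      \<exists>X\<in>G. \<forall>z\<in>D. X z = Ham (\<lambda>z. - 2 * (F (fst z) * cosine z)) z"
    and ham: "\<And>X. X \<in> G \<Longrightarrow> \<exists>H. smooth_on D H \<and> (\<forall>z\<in>D. X z = Ham H z)"
    and \<omega>: "\<And>z v w. z \<in> D \<Longrightarrow> \<omega> z v w = area z * (snd v * fst w - snd w * fst v)"
  shows "C_infinity_dense D (generated_lie_algebra G) (symplectic_fields D \<omega>)"
  unfolding C_infinity_dense_def
proof (intro conjI subsetI ballI allI impI)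
  note iff = symplectic_fields_area_form[OF D smooth_on_area area_nonzero, of \<omega>]
  show "X \<in> symplectic_fields D \<omega>" if "X \<in> generated_lie_algebra G" for X
    using generated_lie_algebra_hamiltonian[OF D(1) smooth_on_inverse_area ham that] iff[OF _ \<omega>] by blast
  fix X K k and \<epsilon> :: real
  assume X: "X \<in> symplectic_fields D \<omega>" and "\<epsilon> > 0" and K: "compact K" "K \<subseteq> D"
  obtain H where H: "smooth_on D H" "\<And>z. z \<in> D \<Longrightarrow> X z = Ham H z"
    using X iff[OF _ \<omega>] by blast
  define D' where "D' = ({a<..<b} \<times> UNIV) \<inter> unstraighten -` D"
  have op: "open ({a<..<b} \<times> (UNIV :: real set))" by (intro open_Times) auto
  have opD': "open D'"
    unfolding D'_def
    by (rule continuous_open_preimage[OF smooth_on_continuous[OF smooth_on_unstraighten] op D(1)])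
  have sm: "smooth_on D straighten"
    unfolding straighten_def by (intro smooth_on_Pair smooth_on_fst smooth_on_id smooth_on_slope D(1))
  have mem: "straighten z \<in> D'" if "z \<in> D" for z
    using unstraighten_straighten[OF that] base[OF that] that
    unfolding D'_def by (simp add: straighten_def)
  \<comment> \<open>This is the quotient \<open>H / cosine\<close> in the straightened coordinates, where
    \<open>cosine\<close> is \<open>1 / sqrt (1 + y\<^sup>2)\<close>.\<close>
  define H' where "H' = (\<lambda>x. H (unstraighten x) * sqrt (1 + (snd x)\<^sup>2))"
  have "smooth_on D' (\<lambda>x. H (unstraighten x))"
    by (rule smooth_on_compose[OF opD' D(1) _ smooth_on_subset[OF smooth_on_unstraighten] H(1)])
       (auto simp: D'_def)
  then have smH': "smooth_on D' H'"
    unfolding H'_def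
    by (intro smooth_on_mult smooth_on_sqrt smooth_on_add smooth_on_const smooth_on_power
        smooth_on_snd smooth_on_id opD') (auto intro: add_pos_nonneg)
  have H'_eq: "cosine z *\<^sub>R H' (straighten z) = H z" if "z \<in> D" for z
    using unstraighten_straighten[OF that] one_plus_slope_square[OF that] cosine_pos[OF that]
    by (simp add: H'_def) (simp add: straighten_def)
  have K': "compact (straighten ` K)" "straighten ` K \<subseteq> D'"
    using compact_continuous_image[OF continuous_on_subset[OF smooth_on_continuous[OF sm] K(2)] K(1)]
      mem K(2) by auto
  obtain f and N :: "nat \<Rightarrow> nat" where f: "\<And>j k. smooth_on UNIV (f j k)"
    "\<And>n. C_converges n (straighten ` K) (\<lambda>j z. \<Sum>k\<le>N j. f j k (fst z) * snd z ^ k) H'"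
    by (rule smooth_approximation_by_fibrewise_polynomials[OF K'(1) opD' K'(2) smH']) (rule that)
  define u where "u = (\<lambda>j x. \<Sum>k\<le>N j. f j k (fst x) * snd x ^ k)"
  have smu: "smooth_on D' (u j)" for j
    unfolding u_def
    by (intro smooth_on_sum smooth_on_mult smooth_on_power smooth_on_snd smooth_on_id opD'
        smooth_on_compose[OF opD' open_UNIV UNIV_I smooth_on_fst[OF opD' smooth_on_id[OF opD']] f(1)])
  have smuz: "smooth_on D (\<lambda>z. u j (straighten z))" for j
    by (rule smooth_on_compose[OF D(1) opD' mem sm smu])
  have smH'z: "smooth_on D (\<lambda>z. H' (straighten z))"
    by (rule smooth_on_compose[OF D(1) opD' mem sm smH'])
  define V where "V = (\<lambda>j z. cosine z *\<^sub>R u j (straighten z))"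
  have smV: "smooth_on D (V j)" for j
    unfolding V_def by (intro smooth_on_scaleR smooth_on_cosine smuz D(1))
  have "C_converges (Suc k) (straighten ` K) u H'" unfolding u_def by (rule f(2))
  from C_converges_compose[OF D(1) K(2,1) opD' mem sm smu smH' this]
  have "C_converges (Suc k) K (\<lambda>j z. u j (straighten z)) (\<lambda>z. H' (straighten z))" .
  from C_converges_scaleR[OF D(1) K(2,1) smooth_on_cosine smuz smH'z this]
  have "C_converges (Suc k) K V H"
    by (rule C_converges_cong[OF D(1) K(2), rotated 2]) (simp_all only: V_def H'_eq)
  from C_converges_hamiltonian_field[OF D(1) K(2,1) smooth_on_inverse_area smV H(1) this]
  have "C_converges k K (\<lambda>j. Ham (V j)) (Ham H)" .
  from C_converges_eventually_close[OF this \<open>\<epsilon> > 0\<close>]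
  obtain j where j: "\<And>is z. set is \<subseteq> Basis \<Longrightarrow> length is \<le> k \<Longrightarrow> z \<in> K \<Longrightarrow>
      norm (partials is (Ham (V j)) z - partials is (Ham H) z) < \<epsilon>" by blast
  have fj: "smooth_on {a<..<b} (f j k)" for k by (rule smooth_on_subset[OF f(1)]) simp
  obtain Y where Y: "Y \<in> generated_lie_algebra G"
    "\<And>z. z \<in> D \<Longrightarrow> Y z = Ham (\<lambda>z. \<Sum>k<Suc (N j). f j k (fst z) * (cosine z * slope z ^ k)) z"
    using cosine_slope_polynomials_generated[where f="f j" and n="Suc (N j)", OF gen fj] by blast
  have "(\<lambda>z. \<Sum>k<Suc (N j). f j k (fst z) * (cosine z * slope z ^ k)) = V j"
    unfolding V_def u_def straighten_def by (simp add: sum_distrib_left lessThan_Suc_atMost ac_simps)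
  then have YV: "Y z = Ham (V j) z" if "z \<in> D" for z using Y(2)[OF that] by simp
  have "norm (partials is Y z - partials is X z) < \<epsilon>"
    if "set is \<subseteq> Basis" "length is \<le> k" "z \<in> K" for "is" z
    using j[OF that] partials_cong[where F=Y and G="Ham (V j)", OF D(1) YV, of z "is"]
      partials_cong[where F=X and G="Ham H", OF D(1) H(2), of z "is"] K(2) that(3)
    by (simp add: subsetD)
  then show "\<exists>Y\<in>generated_lie_algebra G. \<forall>is. set is \<subseteq> Basis \<longrightarrow> length is \<le> k \<longrightarrow>
      (\<forall>z\<in>K. norm (partials is Y z - partials is X z) < \<epsilon>)"
    using Y(1) by blast
qed

end

section \<open>The crossing with a deformed curve\<close>

text \<open>On an interval \<open>J\<close> around \<open>t\<close> the derivative of \<open>A\<close> is bounded below by a positive \<open>\<alpha>\<close>.  For small \<open>\<epsilon>\<close> the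
  perturbed function is still increasing on \<open>J\<close> and changes sign there; its unique zero in \<open>J\<close> is
  the closest of all zeros, as the others are outside \<open>J\<close>.  Its distance from \<open>t\<close> is \<open>O(\<epsilon>)\<close>, and dividing
  \<open>A = - \<epsilon> B\<close> by \<open>\<epsilon>\<close> gives the derivative.\<close>

lemma closest_zero_of_perturbation_pos:
  fixes A B A' B' :: "real \<Rightarrow> real"
  assumes I: "open I" "t \<in> I"
    and A: "\<And>s. s \<in> I \<Longrightarrow> (A has_real_derivative A' s) (at s)" "continuous_on I A'"
    and B: "\<And>s. s \<in> I \<Longrightarrow> (B has_real_derivative B' s) (at s)" "continuous_on I B'"
    and t: "A t = 0" "A' t > 0"
  defines "\<sigma> \<equiv> (\<lambda>\<epsilon>. ARG_MIN (\<lambda>s. dist s t) s. s \<in> I \<and> A s + \<epsilon> * B s = 0)"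
  shows "\<forall>\<^sub>F \<epsilon> in nhds 0. \<sigma> \<epsilon> \<in> I \<and> A (\<sigma> \<epsilon>) + \<epsilon> * B (\<sigma> \<epsilon>) = 0"
    and "\<sigma> 0 = t" and "(\<sigma> has_real_derivative - (B t / A' t)) (at 0)"
proof -
  define \<alpha> where "\<alpha> = A' t / 2"
  have \<alpha>: "\<alpha> > 0" using t by (simp add: \<alpha>_def)
  have "isCont A' t" using A(2) I continuous_on_eq_continuous_at by blast
  then have "\<forall>\<^sub>F s in nhds t. A' s > \<alpha>"
    using t(2) unfolding isCont_def tendsto_at_iff_tendsto_nhds
    by (intro order_tendstoD(1)) (auto simp: \<alpha>_def)
  moreover have "\<forall>\<^sub>F s in nhds t. s \<in> I" using I by (rule eventually_nhds_in_open)
  ultimately have "\<forall>\<^sub>F s in nhds t. A' s > \<alpha> \<and> s \<in> I" by eventually_elim auto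
  then obtain \<delta>0 where \<delta>0: "\<delta>0 > 0" "\<And>s. dist s t < \<delta>0 \<Longrightarrow> A' s > \<alpha> \<and> s \<in> I"
    unfolding eventually_nhds_metric by blast
  define \<delta> where "\<delta> = \<delta>0 / 2"
  have \<delta>: "\<delta> > 0" using \<delta>0 by (simp add: \<delta>_def)
  let ?J = "{t - \<delta>..t + \<delta>}"
  have J: "A' s > \<alpha>" "s \<in> I" if "s \<in> ?J" for s
    using \<delta>0(2)[of s] that \<delta>0(1) by (auto simp: \<delta>_def dist_real_def abs_if)
  have JI: "?J \<subseteq> I" using J(2) by blast
  have contB: "continuous_on I B" "continuous_on I A"
    using A(1) B(1) by (auto intro!: continuous_at_imp_continuous_on DERIV_isCont)
  have "bounded (B ` ?J \<union> B' ` ?J)"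
    using compact_continuous_image[OF continuous_on_subset[OF contB(1) JI]]
      compact_continuous_image[OF continuous_on_subset[OF B(2) JI]]
    by (auto intro: compact_imp_bounded)
  then obtain M where M: "M > 0" "\<And>s. s \<in> ?J \<Longrightarrow> \<bar>B s\<bar> \<le> M" "\<And>s. s \<in> ?J \<Longrightarrow> \<bar>B' s\<bar> \<le> M"
    unfolding bounded_pos by auto
  have grow: "\<alpha> * \<bar>s - t\<bar> \<le> \<bar>A s\<bar> \<and> (s > t \<longrightarrow> A s > 0) \<and> (s < t \<longrightarrow> A s < 0)" if s: "s \<in> ?J" for s
  proof -
    consider "s = t" | "s > t" | "s < t" by linarith
    then show ?thesis
    proof cases
      case 2
      obtain x where x: "t < x" "x < s" "A s - A t = (s - t) * A' x"
        using MVT2[OF 2, of A A'] A(1) J s by (auto simp: subset_iff)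
      then have "A s \<ge> (s - t) * \<alpha>" using J(1)[of x] s t(1) by (simp add: mult_left_mono)
      moreover have "(s - t) * \<alpha> > 0" using 2 \<alpha> by simp
      ultimately show ?thesis using 2 by (simp add: mult.commute)
    next
      case 3
      obtain x where x: "s < x" "x < t" "A t - A s = (t - s) * A' x"
        using MVT2[OF 3, of A A'] A(1) J s by (auto simp: subset_iff)
      then have "- A s \<ge> (t - s) * \<alpha>" using J(1)[of x] s t(1) by (simp add: mult_left_mono)
      moreover have "(t - s) * \<alpha> > 0" using 3 \<alpha> by simp
      ultimately show ?thesis using 3 by (simp add: mult.commute)
    qed (simp add: t)
  qed
  \<comment> \<open>The first bound keeps the perturbed derivative positive on \<open>J\<close>, the second the signs at its two ends.\<close>
  define d where "d = min (\<alpha> / M) (\<alpha> * \<delta> / M)"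
  have d: "d > 0" using \<alpha> M \<delta> by (simp add: d_def)
  have key: "\<sigma> \<epsilon> \<in> ?J \<and> A (\<sigma> \<epsilon>) + \<epsilon> * B (\<sigma> \<epsilon>) = 0 \<and> \<bar>\<sigma> \<epsilon> - t\<bar> \<le> \<bar>\<epsilon>\<bar> * M / \<alpha>"
    if \<epsilon>: "\<bar>\<epsilon>\<bar> < d" for \<epsilon>
  proof -
    have e1: "\<bar>\<epsilon>\<bar> * M < \<alpha>" and e2: "\<bar>\<epsilon>\<bar> * M < \<alpha> * \<delta>"
      using \<epsilon> M(1) by (auto simp: d_def pos_less_divide_eq)
    let ?h = "\<lambda>s. A s + \<epsilon> * B s"
    have eB: "\<bar>\<epsilon> * B s\<bar> \<le> \<bar>\<epsilon>\<bar> * M" "\<bar>\<epsilon> * B' s\<bar> \<le> \<bar>\<epsilon>\<bar> * M" if "s \<in> ?J" for s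
      using M(2,3)[OF that] by (auto simp: abs_mult intro: mult_left_mono)
    have dh: "(?h has_real_derivative A' s + \<epsilon> * B' s) (at s)" if "s \<in> ?J" for s
      using A(1)[OF J(2)[OF that]] B(1)[OF J(2)[OF that]] by (auto intro!: derivative_eq_intros)
    have incr: "?h s1 < ?h s2" if "s1 < s2" "s1 \<in> ?J" "s2 \<in> ?J" for s1 s2
    proof (rule DERIV_pos_imp_increasing[OF that(1)])
      fix x assume "s1 \<le> x" "x \<le> s2"
      then have x: "x \<in> ?J" using that by auto
      have "A' x + \<epsilon> * B' x > 0" using J(1)[OF x] eB(2)[OF x] e1 by linarith
      then show "\<exists>y. (?h has_real_derivative y) (at x) \<and> y > 0" using dh[OF x] by blast
    qed
    have ends: "t - \<delta> \<in> ?J" "t + \<delta> \<in> ?J" using \<delta> by auto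
    have "?h (t - \<delta>) \<le> 0" using grow[OF ends(1)] eB(1)[OF ends(1)] e2 \<delta> by (simp add: abs_if split: if_splits)
    moreover have "0 \<le> ?h (t + \<delta>)" using grow[OF ends(2)] eB(1)[OF ends(2)] e2 \<delta> by (simp add: abs_if split: if_splits)
    moreover have "continuous_on ?J ?h"
      by (intro continuous_intros continuous_on_subset[OF contB(1) JI] continuous_on_subset[OF contB(2) JI])
    ultimately obtain s0 where s0: "s0 \<in> ?J" "?h s0 = 0"
      using IVT'[of ?h "t - \<delta>" 0 "t + \<delta>"] \<delta> by auto
    have uniq: "s = s0" if "s \<in> ?J" "?h s = 0" for s
      using incr[of s s0] incr[of s0 s] that s0 by (metis less_irrefl linorder_neqE_linordered_idom)
    have "\<sigma> \<epsilon> = s0"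
      unfolding \<sigma>_def
    proof (rule arg_minI)
      show "s0 \<in> I \<and> ?h s0 = 0" using s0 J(2) by blast
      have near: "x = s0" if "x \<in> I \<and> ?h x = 0" "dist x t \<le> dist s0 t" for x
        using uniq[of x] that s0(1) by (auto simp: dist_real_def abs_if split: if_splits)
      show "\<not> dist y t < dist s0 t" if "y \<in> I \<and> ?h y = 0" for y using near[OF that] by force
      show "x = s0" if "x \<in> I \<and> ?h x = 0" "\<forall>y. y \<in> I \<and> ?h y = 0 \<longrightarrow> \<not> dist y t < dist x t" for x
        using near[OF that(1)] that(2) s0 J(2) by (metis not_less)
    qed
    moreover have "\<alpha> * \<bar>s0 - t\<bar> \<le> \<bar>\<epsilon>\<bar> * M"
      using grow[OF s0(1)] eB(1)[OF s0(1)] s0(2) by linarith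
    then have "\<bar>s0 - t\<bar> \<le> \<bar>\<epsilon>\<bar> * M / \<alpha>" using \<alpha> by (simp add: pos_le_divide_eq mult.commute)
    ultimately show ?thesis using s0 by simp
  qed
  have evd: "\<forall>\<^sub>F \<epsilon>::real in nhds 0. \<bar>\<epsilon>\<bar> < d"
    unfolding eventually_nhds_metric using d by (auto simp: dist_real_def)
  then show "\<forall>\<^sub>F \<epsilon> in nhds 0. \<sigma> \<epsilon> \<in> I \<and> A (\<sigma> \<epsilon>) + \<epsilon> * B (\<sigma> \<epsilon>) = 0"
    by eventually_elim (use key JI in blast)
  show \<sigma>0: "\<sigma> 0 = t" using key[of 0] d by simp
  have evd0: "\<forall>\<^sub>F \<epsilon> in at 0. \<bar>\<epsilon>\<bar> < d" using evd eventually_nhds_conv_at by blast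
  have lim\<sigma>: "(\<sigma> \<longlongrightarrow> t) (at 0)"
  proof -
    have "((\<lambda>\<epsilon>. \<sigma> \<epsilon> - t) \<longlongrightarrow> 0) (at 0)"
    proof (rule Lim_null_comparison)
      show "\<forall>\<^sub>F \<epsilon> in at 0. norm (\<sigma> \<epsilon> - t) \<le> \<bar>\<epsilon>\<bar> * M / \<alpha>"
        using evd0 by eventually_elim (use key in auto)
      have "((\<lambda>\<epsilon>. \<bar>\<epsilon>\<bar> * M / \<alpha>) \<longlongrightarrow> \<bar>0::real\<bar> * M / \<alpha>) (at 0)"
        by (intro tendsto_intros) (use \<alpha> in auto)
      then show "((\<lambda>\<epsilon>. \<bar>\<epsilon>\<bar> * M / \<alpha>) \<longlongrightarrow> 0) (at 0)" by simp
    qed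
    then show ?thesis by (simp add: LIM_zero_iff)
  qed
  obtain g where g: "\<And>s. A s - A t = g s * (s - t)" "isCont g t" "g t = A' t"
    using A(1)[OF I(2)] unfolding CARAT_DERIV by blast
  have limB: "((\<lambda>\<epsilon>. B (\<sigma> \<epsilon>)) \<longlongrightarrow> B t) (at 0)"
    by (rule isCont_tendsto_compose[OF DERIV_isCont[OF B(1)[OF I(2)]] lim\<sigma>])
  have limg: "((\<lambda>\<epsilon>. g (\<sigma> \<epsilon>)) \<longlongrightarrow> A' t) (at 0)"
    using isCont_tendsto_compose[OF g(2) lim\<sigma>] g(3) by simp
  have "((\<lambda>\<epsilon>. - (B (\<sigma> \<epsilon>) / g (\<sigma> \<epsilon>))) \<longlongrightarrow> - (B t / A' t)) (at 0)"
    by (intro tendsto_intros limB limg) (use t in auto)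
  moreover have "\<forall>\<^sub>F \<epsilon> in at 0. - (B (\<sigma> \<epsilon>) / g (\<sigma> \<epsilon>)) = (\<sigma> (0 + \<epsilon>) - \<sigma> 0) / \<epsilon>"
  proof -
    have "\<forall>\<^sub>F \<epsilon> in at 0. g (\<sigma> \<epsilon>) > 0" using order_tendstoD(1)[OF limg t(2)] .
    moreover have "\<forall>\<^sub>F \<epsilon>::real in at 0. \<epsilon> \<noteq> 0" by (simp add: eventually_at_filter)
    ultimately show ?thesis using evd0
    proof eventually_elim
      case (elim \<epsilon>)
      have "g (\<sigma> \<epsilon>) * (\<sigma> \<epsilon> - t) = - (\<epsilon> * B (\<sigma> \<epsilon>))"
        using key[OF elim(3)] g(1)[of "\<sigma> \<epsilon>"] t(1) by simp
      then show ?case using elim \<sigma>0 by (simp add: field_simps)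
    qed
  qed
  ultimately show "(\<sigma> has_real_derivative - (B t / A' t)) (at 0)"
    unfolding DERIV_def by (rule Lim_transform_eventually)
qed

lemma closest_zero_of_perturbation:
  fixes A B A' B' :: "real \<Rightarrow> real"
  assumes I: "open I" "t \<in> I"
    and A: "\<And>s. s \<in> I \<Longrightarrow> (A has_real_derivative A' s) (at s)" "continuous_on I A'"
    and B: "\<And>s. s \<in> I \<Longrightarrow> (B has_real_derivative B' s) (at s)" "continuous_on I B'"
    and t: "A t = 0" "A' t \<noteq> 0"
  defines "\<sigma> \<equiv> (\<lambda>\<epsilon>. ARG_MIN (\<lambda>s. dist s t) s. s \<in> I \<and> A s + \<epsilon> * B s = 0)"
  shows "\<forall>\<^sub>F \<epsilon> in nhds 0. \<sigma> \<epsilon> \<in> I \<and> A (\<sigma> \<epsilon>) + \<epsilon> * B (\<sigma> \<epsilon>) = 0"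
    and "\<sigma> 0 = t" and "(\<sigma> has_real_derivative - (B t / A' t)) (at 0)"
proof -
  have *: "(\<forall>\<^sub>F \<epsilon> in nhds 0. \<sigma> \<epsilon> \<in> I \<and> A (\<sigma> \<epsilon>) + \<epsilon> * B (\<sigma> \<epsilon>) = 0) \<and> \<sigma> 0 = t
      \<and> (\<sigma> has_real_derivative - (B t / A' t)) (at 0)"
  proof (cases "A' t > 0")
    case True
    then show ?thesis
      using closest_zero_of_perturbation_pos[OF I A B t(1)] unfolding \<sigma>_def by blast
  next
    case False
    have neg: "- A s + \<epsilon> * - B s = 0 \<longleftrightarrow> A s + \<epsilon> * B s = 0" for s \<epsilon> by auto
    have A2: "((\<lambda>s. - A s) has_real_derivative - A' s) (at s)" if "s \<in> I" for s
      using A(1)[OF that] by (rule DERIV_minus)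
    have B2: "((\<lambda>s. - B s) has_real_derivative - B' s) (at s)" if "s \<in> I" for s
      using B(1)[OF that] by (rule DERIV_minus)
    have "- A t = 0" "- A' t > 0" using False t by auto
    from closest_zero_of_perturbation_pos[OF I A2 continuous_on_minus[OF A(2)] B2
        continuous_on_minus[OF B(2)] this]
    show ?thesis unfolding neg \<sigma>_def by simp
  qed
  then show "\<forall>\<^sub>F \<epsilon> in nhds 0. \<sigma> \<epsilon> \<in> I \<and> A (\<sigma> \<epsilon>) + \<epsilon> * B (\<sigma> \<epsilon>) = 0"
    and "\<sigma> 0 = t" and "(\<sigma> has_real_derivative - (B t / A' t)) (at 0)" by auto
qed

section \<open>Reflections\<close>

text \<open>The reflection in the line spanned by \<open>V\<close>, in a form that is rational in \<open>V\<close> and hence differentiable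
  along a moving tangent.\<close>

definition mirror :: "plane \<Rightarrow> plane \<Rightarrow> plane" where
  "mirror V u = u - (2 * (u \<bullet> rot90 V) / (V \<bullet> V)) *\<^sub>R rot90 V"

lemma rot90_inner [simp]: "rot90 x \<bullet> rot90 y = x \<bullet> y" "rot90 x \<bullet> x = 0" "x \<bullet> rot90 x = 0"
  by (simp_all add: rot90_def inner_prod_def)

lemma rot90_antisymmetric: "x \<bullet> rot90 y = - (y \<bullet> rot90 x)"
  by (simp add: rot90_def inner_prod_def)

lemma bounded_linear_rot90: "bounded_linear rot90"
  unfolding rot90_def
  by (intro bounded_linear_Pair bounded_linear_minus bounded_linear_fst bounded_linear_snd)

lemma reflection_eq_mirror:
  "reflection g s L = line_through (g s) (mirror (velocity g s) (direction L))"
proof -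
  have "(2 * (u \<bullet> normal g s)) *\<^sub>R normal g s =
      (2 * (u \<bullet> rot90 V) / (V \<bullet> V)) *\<^sub>R rot90 V" if "V = velocity g s" for u V
    unfolding normal_def that by (simp add: dot_square_norm power2_eq_square field_simps)
  then show ?thesis by (simp add: reflection_def mirror_def)
qed

lemma mirror_inner:
  assumes "V \<noteq> 0"
  shows "mirror V u \<bullet> V = u \<bullet> V" "mirror V u \<bullet> rot90 V = - (u \<bullet> rot90 V)"
    "mirror V u \<bullet> mirror V u = u \<bullet> u"
proof -
  have nz: "V \<bullet> V \<noteq> 0" using assms by simp
  show "mirror V u \<bullet> V = u \<bullet> V" by (simp add: mirror_def inner_diff_left)
  show 2: "mirror V u \<bullet> rot90 V = - (u \<bullet> rot90 V)"
    using nz by (simp add: mirror_def inner_diff_left)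
  have "mirror V u \<bullet> mirror V u = mirror V u \<bullet> u - 2 * (u \<bullet> rot90 V) / (V \<bullet> V) * (mirror V u \<bullet> rot90 V)"
    unfolding mirror_def[of V u] by (simp only: inner_diff_right inner_scaleR_right)
  also have "mirror V u \<bullet> u = u \<bullet> u - 2 * (u \<bullet> rot90 V) / (V \<bullet> V) * (u \<bullet> rot90 V)"
    unfolding mirror_def by (simp add: inner_diff_left inner_commute[of "rot90 V" u])
  finally show "mirror V u \<bullet> mirror V u = u \<bullet> u" unfolding 2 by simp
qed

lemma mirror_mirror: "V \<noteq> 0 \<Longrightarrow> mirror V (mirror V u) = u"
  unfolding mirror_def[of V "mirror V u"] by (simp add: mirror_inner) (simp add: mirror_def)

lemma crosses_iff:
  assumes "velocity g s \<noteq> 0"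
  shows "L \<in> lines_crossing g s \<longleftrightarrow> norm (direction L) = 1 \<and> g s \<bullet> rot90 (direction L) = snd L
    \<and> direction L \<bullet> rot90 (velocity g s) \<noteq> 0"
  using assms by (cases L) (auto simp: lines_crossing_def oriented_lines_def points_def normal_def)

text \<open>The reflection at a fixed point of a curve is an involution of the lines crossing there.\<close>

lemma inv_reflection:
  assumes V: "velocity g s \<noteq> 0" and R: "R \<in> lines_crossing g s"
  shows "inv_into (lines_crossing g s) (reflection g s) R =
    line_through (g s) (mirror (velocity g s) (direction R))"
proof -
  let ?T = "reflection g s"
  have refl: "?T L \<in> lines_crossing g s \<and> ?T (?T L) = L" if L: "L \<in> lines_crossing g s" for L
  proof
    show "?T L \<in> lines_crossing g s"
      using L unfolding crosses_iff[OF V] reflection_eq_mirror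
      by (simp add: line_through_def mirror_inner[OF V] norm_eq_1)
    show "?T (?T L) = L"
      using L unfolding crosses_iff[OF V] reflection_eq_mirror
      by (cases L) (simp add: line_through_def mirror_mirror[OF V])
  qed
  have "inj_on ?T (lines_crossing g s)" by (rule inj_on_inverseI[of _ ?T]) (use refl in blast)
  from inv_into_f_f[OF this, of "?T R"] show ?thesis
    using refl[OF R] by (simp add: reflection_eq_mirror)
qed

text \<open>The number \<open>\<kappa>\<close> is the length of \<open>T\<close> with a sign that records the orientation of \<open>(T, n)\<close>.  Keeping it
  avoids a distinction of cases according to the side of the curve on which the normal lies.\<close>

lemma unit_normal_frame:
  fixes T n :: plane
  assumes "norm n = 1" "n \<bullet> T = 0" "T \<noteq> 0"
  obtains \<kappa> where "\<kappa> \<noteq> 0" "\<kappa>\<^sup>2 = T \<bullet> T" "rot90 T = \<kappa> *\<^sub>R n" "rot90 n = (- 1 / \<kappa>) *\<^sub>R T"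
    "\<And>x. x = (x \<bullet> T / \<kappa>\<^sup>2) *\<^sub>R T + (x \<bullet> n) *\<^sub>R n"
proof -
  obtain T1 T2 n1 n2 where T: "T = (T1, T2)" and n: "n = (n1, n2)" by fastforce
  have n1: "n1 * n1 + n2 * n2 = 1" and nT: "n1 * T1 + n2 * T2 = 0"
    using assms(1,2) by (simp_all add: T n norm_eq_1)
  define \<kappa> where "\<kappa> = T1 * n2 - T2 * n1"
  have a1: "- T2 = \<kappa> * n1" and a2: "T1 = \<kappa> * n2" unfolding \<kappa>_def using n1 nT by algebra+
  have \<kappa>0: "\<kappa> \<noteq> 0" using a1 a2 assms(3) by (auto simp: T zero_prod_def)
  have sq: "\<kappa>\<^sup>2 = T1 * T1 + T2 * T2"
    using a1 a2 n1 by (simp add: power2_eq_square) algebra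
  show ?thesis
  proof (rule that[of \<kappa>])
    show "\<kappa> \<noteq> 0" by fact
    show "\<kappa>\<^sup>2 = T \<bullet> T" using sq by (simp add: T)
    show "rot90 T = \<kappa> *\<^sub>R n" using a1 a2 by (simp add: T n rot90_def)
    show "rot90 n = (- 1 / \<kappa>) *\<^sub>R T" using a1 a2 \<kappa>0 by (simp add: T n rot90_def field_simps)
    show "x = (x \<bullet> T / \<kappa>\<^sup>2) *\<^sub>R T + (x \<bullet> n) *\<^sub>R n" for x
    proof -
      obtain x1 x2 where x: "x = (x1, x2)" by fastforce
      have T2: "T2 = - \<kappa> * n1" using a1 by simp
      have e: "(x1 * T1 + x2 * T2) / \<kappa>\<^sup>2 * T1 = (x1 * n2 - x2 * n1) * n2"
        "(x1 * T1 + x2 * T2) / \<kappa>\<^sup>2 * T2 = - (x1 * n2 - x2 * n1) * n1"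
        unfolding a2 T2 using \<kappa>0 by (simp_all add: power2_eq_square field_simps)
      have "x1 = (x1 * n2 - x2 * n1) * n2 + (x1 * n1 + x2 * n2) * n1"
        "x2 = - (x1 * n2 - x2 * n1) * n1 + (x1 * n1 + x2 * n2) * n2" using n1 by algebra+
      then show ?thesis using e by (simp add: x T n)
    qed
  qed
qed

lemma mirror_frame:
  assumes "\<kappa> \<noteq> 0" "\<kappa>\<^sup>2 = T \<bullet> T" "rot90 T = \<kappa> *\<^sub>R n"
  shows "mirror T u = u - (2 * (u \<bullet> n)) *\<^sub>R n"
  using assms(1) unfolding mirror_def assms(2)[symmetric] assms(3)
  by (simp add: power2_eq_square)

lemma mirror_differentiable:
  assumes "(V has_vector_derivative V1) (at x)" "V x \<noteq> 0"
  obtains u1 where "((\<lambda>\<epsilon>. mirror (V \<epsilon>) u) has_vector_derivative u1) (at x)"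
proof -
  have r: "((\<lambda>\<epsilon>. rot90 (V \<epsilon>)) has_vector_derivative rot90 V1) (at x)"
    by (rule bounded_linear.has_vector_derivative[OF bounded_linear_rot90 assms(1)])
  have nz: "V x \<bullet> V x \<noteq> 0" using assms(2) by simp
  have d: "(\<lambda>\<epsilon>. rot90 (V \<epsilon>)) differentiable (at x)" "V differentiable (at x)"
    using r assms(1) by (auto intro: differentiableI_vector)
  have "(\<lambda>\<epsilon>. mirror (V \<epsilon>) u) differentiable (at x)"
    unfolding mirror_def
    by (intro differentiable_diff differentiable_const differentiable_scaleR differentiable_divide
        differentiable_mult differentiable_inner d nz)
  then show ?thesis using that vector_derivative_works by blast
qed

section \<open>The deformation fields\<close>

lemma has_vector_derivative_eventually_cong:
  fixes f g :: "real \<Rightarrow> 'b::real_normed_vector"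
  assumes "(f has_vector_derivative f') (at x)" and eq: "\<forall>\<^sub>F \<epsilon> in nhds x. f \<epsilon> = g \<epsilon>"
  shows "(g has_vector_derivative f') (at x)"
proof -
  have "\<forall>\<^sub>F \<epsilon> in at x. f \<epsilon> = g \<epsilon>" "f x = g x"
    using eq unfolding eventually_nhds_conv_at by auto
  from has_derivative_transform_eventually[OF assms(1)[unfolded has_vector_derivative_def] this]
  show ?thesis unfolding has_vector_derivative_def by simp
qed

lemma vector_derivative_unique_if_eventually_eq:
  fixes f g :: "real \<Rightarrow> 'b::real_normed_vector"
  assumes "(f has_vector_derivative f') (at x)" "(g has_vector_derivative g') (at x)"
    "\<forall>\<^sub>F \<epsilon> in nhds x. f \<epsilon> = g \<epsilon>"
  shows "f' = g'"
  using vector_derivative_unique_at[OF has_vector_derivative_eventually_cong[OF assms(1,3)] assms(2)] .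

locale billiard_curve =
  fixes a b :: real and I :: "real set" and c :: "real \<Rightarrow> plane" and e :: plane
    and N :: "plane \<Rightarrow> plane" and P :: "oriented_line set" and D :: "(real \<times> real) set"
  assumes I: "I = {a<..<b}"
    and smooth: "smooth_on I c"
    and axis: "\<And>t. t \<in> I \<Longrightarrow> velocity c t \<bullet> e \<noteq> 0"
    and domain: "openin (top_of_set oriented_lines) P"
    and one_crossing: "\<And>L. L \<in> P \<Longrightarrow> \<exists>!t. t \<in> I \<and> c t \<in> points L"
    and normal_field: "smooth_on I (N \<circ> c)"
      "\<And>t. t \<in> I \<Longrightarrow> norm (N (c t)) = 1 \<and> N (c t) \<bullet> velocity c t = 0"
    and normal_side: "\<And>L t. L \<in> P \<Longrightarrow> t \<in> I \<Longrightarrow> c t \<in> points L \<Longrightarrow> direction L \<bullet> N (c t) > 0"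
    and chart: "diffeomorphism P D (xw_chart I c e)" "open D" "contractible D"
begin

lemma open_I: "open I" by (simp add: I)

lemma velocity_eq: "t \<in> I \<Longrightarrow> velocity c t = partials [1] c t"
  by (rule vector_derivative_at[OF smooth_on_real_has_derivative[OF smooth]])

lemma smooth_velocity: "smooth_on I (velocity c)"
  by (rule smooth_on_cong[OF open_I _ smooth_on_partial[OF smooth]]) (auto simp: velocity_eq)

definition acceleration :: "real \<Rightarrow> plane" where "acceleration = partials [1] (velocity c)"

lemma has_acceleration: "t \<in> I \<Longrightarrow> (velocity c has_vector_derivative acceleration t) (at t)"
  unfolding acceleration_def by (rule smooth_on_real_has_derivative[OF smooth_velocity])

lemma has_velocity: "t \<in> I \<Longrightarrow> (c has_vector_derivative velocity c t) (at t)"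
  using smooth_on_real_has_derivative[OF smooth] velocity_eq by metis

lemma velocity_nonzero: "t \<in> I \<Longrightarrow> velocity c t \<noteq> 0"
  using axis by fastforce

definition speed :: "real \<Rightarrow> real" where "speed t = sqrt (velocity c t \<bullet> velocity c t)"

text \<open>The signed length of the tangent vector whose component along \<open>e\<close> is 1.\<close>

definition stretch :: "real \<Rightarrow> real" where "stretch t = speed t / (velocity c t \<bullet> e)"

lemma speed_pos: "t \<in> I \<Longrightarrow> speed t > 0"
  using velocity_nonzero by (simp add: speed_def)

lemma speed_square: "speed t * speed t = velocity c t \<bullet> velocity c t"
  by (simp add: speed_def)

lemma smooth_speed: "smooth_on I speed"
  unfolding speed_def
  by (intro smooth_on_sqrt smooth_on_inner smooth_velocity open_I) (simp add: velocity_nonzero)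

lemma smooth_stretch: "smooth_on I stretch"
  unfolding stretch_def
  by (intro smooth_on_divide smooth_on_inner smooth_on_const smooth_speed smooth_velocity open_I axis)

lemma stretch_nonzero: "t \<in> I \<Longrightarrow> stretch t \<noteq> 0"
  using speed_pos axis by (fastforce simp: stretch_def)

lemma crossing_parameter:
  assumes "L \<in> P"
  shows "crossing_parameter I c L \<in> I" "c (crossing_parameter I c L) \<in> points L"
  using theI'[OF one_crossing[OF assms]] unfolding crossing_parameter_def by auto

lemma chart_eq:
  "xw_chart I c e L = (let t = crossing_parameter I c L in
     (t, direction L \<bullet> velocity c t / (speed t * stretch t)))"
proof -
  have "x / (s * s) * y = x / (s * (s / y))" for x s y :: real by simp
  then show ?thesis
    unfolding xw_chart_def tangential_part_def stretch_def Let_def speed_square[symmetric]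
    by simp
qed

lemma norm_direction: "L \<in> P \<Longrightarrow> norm (direction L) = 1"
  using openin_imp_subset[OF domain] by (auto simp: oriented_lines_def)

text \<open>The tangential and normal components of a unit vector are the sine and cosine of the angle with the
  normal.\<close>

lemma direction_decomposition:
  assumes L: "L \<in> P"
  defines "t \<equiv> crossing_parameter I c L"
  shows "(direction L \<bullet> velocity c t / speed t)\<^sup>2 + (direction L \<bullet> N (c t))\<^sup>2 = 1"
    "direction L \<bullet> N (c t) > 0"
proof -
  have t: "t \<in> I" "c t \<in> points L" using crossing_parameter[OF L] by (simp_all add: t_def)
  show "direction L \<bullet> N (c t) > 0" by (rule normal_side[OF L t])
  obtain \<kappa> where \<kappa>: "\<kappa> \<noteq> 0" "\<kappa>\<^sup>2 = velocity c t \<bullet> velocity c t"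
    "\<And>x. x = (x \<bullet> velocity c t / \<kappa>\<^sup>2) *\<^sub>R velocity c t + (x \<bullet> N (c t)) *\<^sub>R N (c t)"
    using unit_normal_frame[of "N (c t)" "velocity c t"] normal_field(2)[OF t(1)] velocity_nonzero[OF t(1)]
    by metis
  let ?u = "direction L"
  have "?u \<bullet> ?u = ?u \<bullet> ((?u \<bullet> velocity c t / \<kappa>\<^sup>2) *\<^sub>R velocity c t + (?u \<bullet> N (c t)) *\<^sub>R N (c t))"
    using \<kappa>(3)[of ?u] by simp
  also have "\<dots> = (?u \<bullet> velocity c t)\<^sup>2 / \<kappa>\<^sup>2 + (?u \<bullet> N (c t))\<^sup>2"
    by (simp add: inner_add_right power2_eq_square)
  also have "\<kappa>\<^sup>2 = (speed t)\<^sup>2" using \<kappa>(2) speed_square[of t] by (simp add: power2_eq_square)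
  finally show "(?u \<bullet> velocity c t / speed t)\<^sup>2 + (?u \<bullet> N (c t))\<^sup>2 = 1"
    using norm_direction[OF L] by (simp add: power_divide norm_eq_1)
qed

lemma point_of_line:
  assumes "z \<in> D"
  obtains L where "L \<in> P" "xw_chart I c e L = z" "the_inv_into P (xw_chart I c e) z = L"
    "crossing_parameter I c L = fst z"
    "stretch (fst z) * snd z = direction L \<bullet> velocity c (fst z) / speed (fst z)"
proof -
  have bij: "bij_betw (xw_chart I c e) P D" using chart(1) by (simp add: diffeomorphism_def)
  then obtain L where L: "L \<in> P" "xw_chart I c e L = z"
    using assms unfolding bij_betw_def by blast
  moreover have "the_inv_into P (xw_chart I c e) z = L"
    by (rule the_inv_into_f_eq[OF bij_betw_imp_inj_on[OF bij] L(2,1)])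
  moreover have t: "crossing_parameter I c L = fst z"
    using L(2) by (auto simp: chart_eq Let_def)
  moreover have "stretch (fst z) * snd z = direction L \<bullet> velocity c (fst z) / speed (fst z)"
  proof -
    have "snd z = direction L \<bullet> velocity c (fst z) / (speed (fst z) * stretch (fst z))"
      using arg_cong[OF L(2), of snd] by (simp add: chart_eq Let_def t)
    moreover have "fst z \<in> I" using crossing_parameter(1)[OF L(1)] t by simp
    ultimately show ?thesis using stretch_nonzero by (simp add: field_simps)
  qed
  ultimately show ?thesis using that by blast
qed

sublocale tangent_coordinates a b D speed stretch
proof
  show "open D" "contractible D" by (rule chart)+
  show "smooth_on {a<..<b} speed" "smooth_on {a<..<b} stretch"
    using smooth_speed smooth_stretch by (simp_all add: I)
  show "speed s > 0" "stretch s \<noteq> 0" if "s \<in> {a<..<b}" for s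
    using speed_pos stretch_nonzero that by (simp_all add: I)
  fix z assume "z \<in> D"
  then obtain L where L: "L \<in> P" "crossing_parameter I c L = fst z"
    "stretch (fst z) * snd z = direction L \<bullet> velocity c (fst z) / speed (fst z)"
    by (rule point_of_line)
  show "fst z \<in> {a<..<b}" using crossing_parameter(1)[OF L(1)] L(2) by (simp add: I)
  show "(stretch (fst z) * snd z)\<^sup>2 < 1"
    using direction_decomposition[OF L(1)] unfolding L(2,3)
    by (smt (verit) zero_less_power)
qed

lemma area_form:
  assumes "z \<in> D"
  shows "exterior_derivative (liouville_form c e) z v w = area z * (snd v * fst w - snd w * fst v)"
proof -
  have l: "liouville_form c e y k = area y * snd y * fst k" for y k
  proof -
    have "x / y * (k * (s * s)) = s * (s / y) * x * k" for x y k s :: real by simp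
    then show ?thesis
      by (simp add: liouville_form_def tangent_vector_def area_def stretch_def speed_square[symmetric])
  qed
  define m where "m = (\<lambda>s. speed s * stretch s)"
  have "smooth_on {a<..<b} m" unfolding m_def by (intro smooth_on_mult vel lam open_greaterThanLessThan)
  from smooth_on_real_has_derivative[OF this base[OF assms]]
  have dm: "(m has_real_derivative partials [1] m (fst z)) (at (fst z))"
    by (simp add: has_real_derivative_iff_has_vector_derivative)
  have dfst: "(fst has_derivative fst) (at z)" "(snd has_derivative snd) (at z)"
    by (intro bounded_linear_imp_has_derivative bounded_linear_fst bounded_linear_snd)+
  have d: "((\<lambda>y. m (fst y) * snd y * fst k) has_derivative
      (\<lambda>h. (m (fst z) * snd h + (fst h * partials [1] m (fst z)) * snd z) * fst k)) (at z)" for k :: "real \<times> real"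
    by (rule has_derivative_mult_left[OF has_derivative_mult[OF DERIV_compose_FDERIV[OF dm dfst(1)] dfst(2)]])
  have eq: "(\<lambda>y. liouville_form c e y k) = (\<lambda>y. m (fst y) * snd y * fst k)" for k
    by (simp add: l area_def m_def)
  have "frechet_derivative (\<lambda>y. liouville_form c e y k) (at z) h =
      (m (fst z) * snd h + (fst h * partials [1] m (fst z)) * snd z) * fst k" for k h
    unfolding eq frechet_derivative_at[OF d, symmetric] ..
  then show ?thesis
    unfolding exterior_derivative_def by (simp add: area_def m_def algebra_simps del: partials.simps)
qed

text \<open>A velocity that is never orthogonal to \<open>e\<close> makes the component along \<open>e\<close> monotone.  Consequently every function of the
  parameter is a function of the point of the curve.\<close>

lemma curve_injective: "inj_on c I"
proof (rule inj_onI, rule ccontr)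
  have *: False if xy: "x < y" "x \<in> I" "y \<in> I" "c x = c y" for x y
  proof -
    have sub: "s \<in> I" if "x \<le> s" "s \<le> y" for s using that \<open>x \<in> I\<close> \<open>y \<in> I\<close> by (auto simp: I)
    have d: "((\<lambda>s. c s \<bullet> e) has_real_derivative velocity c s \<bullet> e) (at s)" if "s \<in> I" for s
      unfolding has_real_derivative_iff_has_vector_derivative
      by (rule bounded_linear.has_vector_derivative[OF bounded_linear_inner_left has_velocity[OF that]])
    obtain s where "x < s" "s < y" "c y \<bullet> e - c x \<bullet> e = (y - x) * (velocity c s \<bullet> e)"
      using MVT2[OF xy(1), of "\<lambda>s. c s \<bullet> e" "\<lambda>s. velocity c s \<bullet> e"] d sub by blast
    then show False using axis[OF sub[of s]] xy by simp
  qed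
  fix x y assume "x \<in> I" "y \<in> I" "c x = c y" "x \<noteq> y"
  then show False using *[of x y] *[of y x] by (metis linorder_neqE_linordered_idom)
qed

definition displacement :: "(plane \<Rightarrow> real) \<Rightarrow> real \<Rightarrow> plane" where
  "displacement f s = f (c s) *\<^sub>R N (c s)"

definition displaced_velocity :: "(plane \<Rightarrow> real) \<Rightarrow> real \<Rightarrow> real \<Rightarrow> plane" where
  "displaced_velocity f \<epsilon> s = velocity c s + \<epsilon> *\<^sub>R partials [1] (displacement f) s"

lemma smooth_displacement: "smooth_on I (f \<circ> c) \<Longrightarrow> smooth_on I (displacement f)"
  using smooth_on_scaleR[OF open_I _ normal_field(1), of "f \<circ> c"] by (simp add: displacement_def[abs_def] o_def)

lemma deformed_eq: "deformed c N f \<epsilon> = (\<lambda>s. c s + \<epsilon> *\<^sub>R displacement f s)"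
  by (simp add: deformed_def displacement_def fun_eq_iff)

lemma velocity_deformed:
  assumes "smooth_on I (f \<circ> c)" "s \<in> I"
  shows "velocity (deformed c N f \<epsilon>) s = displaced_velocity f \<epsilon> s"
  unfolding deformed_eq displaced_velocity_def
  by (intro vector_derivative_at has_vector_derivative_add has_velocity assms(2)
      bounded_linear.has_vector_derivative[OF bounded_linear_scaleR_right]
      smooth_on_real_has_derivative[OF smooth_displacement[OF assms(1)]])

lemma transversality:
  assumes L: "L \<in> P"
  defines "t \<equiv> crossing_parameter I c L"
  shows "direction L \<bullet> rot90 (velocity c t) \<noteq> 0"
proof -
  have t: "t \<in> I" using crossing_parameter[OF L] by (simp add: t_def)
  obtain \<kappa> where "\<kappa> \<noteq> 0" "rot90 (velocity c t) = \<kappa> *\<^sub>R N (c t)"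
    using unit_normal_frame[of "N (c t)" "velocity c t"] normal_field(2)[OF t] velocity_nonzero[OF t]
    by metis
  then show ?thesis using direction_decomposition(2)[OF L] by (simp add: t_def)
qed

text \<open>The reflected line is fixed, with direction \<open>u'\<close>, so that its crossings with the deformed curves are
  the zeros of an affine perturbation in \<open>\<epsilon>\<close>.  Transversality persists for small \<open>\<epsilon>\<close>, and there the inverse
  reflection is a reflection.\<close>

lemma deformation_map_curve:
  assumes L: "L \<in> P" and f: "smooth_on I (f \<circ> c)"
  defines "t \<equiv> crossing_parameter I c L"
  defines "u' \<equiv> mirror (velocity c t) (direction L)"
  obtains \<sigma> where "\<sigma> 0 = t"
    "(\<sigma> has_real_derivative - (displacement f t \<bullet> rot90 u' / (velocity c t \<bullet> rot90 u'))) (at 0)"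
    "\<forall>\<^sub>F \<epsilon> in nhds 0. deformation_map I c N f \<epsilon> L =
      line_through (deformed c N f \<epsilon> (\<sigma> \<epsilon>)) (mirror (displaced_velocity f \<epsilon> (\<sigma> \<epsilon>)) u')"
    "\<forall>\<^sub>F \<epsilon> in nhds 0. \<sigma> \<epsilon> \<in> I \<and> displaced_velocity f \<epsilon> (\<sigma> \<epsilon>) \<noteq> 0"
proof -
  let ?T = "velocity c t" and ?u = "direction L" and ?B = "displacement f"
  have t: "t \<in> I" using crossing_parameter[OF L] by (simp add: t_def)
  have T: "?T \<noteq> 0" by (rule velocity_nonzero[OF t])
  have cross: "?u \<bullet> rot90 ?T \<noteq> 0" using transversality[OF L] by (simp add: t_def)
  have u'rot: "u' \<bullet> rot90 ?T = - (?u \<bullet> rot90 ?T)" unfolding u'_def by (rule mirror_inner[OF T])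
  have unit: "norm u' = 1"
    using mirror_inner(3)[OF T, of ?u] norm_direction[OF L] by (simp add: u'_def norm_eq_1)
  define A where "A = (\<lambda>s. (c s - c t) \<bullet> rot90 u')"
  define b where "b = (\<lambda>s. ?B s \<bullet> rot90 u')"
  have smB: "smooth_on I ?B" by (rule smooth_displacement[OF f])
  have dA: "(A has_real_derivative velocity c s \<bullet> rot90 u') (at s)" if "s \<in> I" for s
  proof -
    have "((\<lambda>s. c s - c t) has_vector_derivative velocity c s - 0) (at s)"
      by (intro has_vector_derivative_diff has_velocity that has_vector_derivative_const)
    from bounded_linear.has_vector_derivative[OF bounded_linear_inner_left this]
    show ?thesis unfolding A_def has_real_derivative_iff_has_vector_derivative by simp
  qed
  have db: "(b has_real_derivative partials [1] ?B s \<bullet> rot90 u') (at s)" if "s \<in> I" for s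
    unfolding b_def has_real_derivative_iff_has_vector_derivative
    by (rule bounded_linear.has_vector_derivative[OF bounded_linear_inner_left
          smooth_on_real_has_derivative[OF smB that]])
  have cA: "continuous_on I (\<lambda>s. velocity c s \<bullet> rot90 u')"
    by (intro continuous_intros smooth_on_continuous[OF smooth_velocity])
  have cb: "continuous_on I (\<lambda>s. partials [1] ?B s \<bullet> rot90 u')"
    by (intro continuous_intros smooth_on_continuous[OF smooth_on_partial[OF smB]]) simp
  have At: "A t = 0" "?T \<bullet> rot90 u' \<noteq> 0"
    using cross rot90_antisymmetric[of ?T u'] u'rot by (simp_all add: A_def)
  define \<sigma> where "\<sigma> = (\<lambda>\<epsilon>. ARG_MIN (\<lambda>s. dist s t) s. s \<in> I \<and> A s + \<epsilon> * b s = 0)"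
  have \<sigma>: "\<forall>\<^sub>F \<epsilon> in nhds 0. \<sigma> \<epsilon> \<in> I \<and> A (\<sigma> \<epsilon>) + \<epsilon> * b (\<sigma> \<epsilon>) = 0" "\<sigma> 0 = t"
    "(\<sigma> has_real_derivative - (b t / (?T \<bullet> rot90 u'))) (at 0)"
    unfolding \<sigma>_def by (rule closest_zero_of_perturbation[OF open_I t dA cA db cb At], assumption+)+
  define V where "V = (\<lambda>\<epsilon>. displaced_velocity f \<epsilon> (\<sigma> \<epsilon>))"
  have V0: "V 0 = ?T" by (simp add: V_def displaced_velocity_def \<sigma>(2))
  have contV: "isCont V 0"
  proof -
    have ct: "isCont g t" if "continuous_on I g" for g :: "real \<Rightarrow> plane"
      using that t open_I continuous_on_eq_continuous_at by blast
    have c\<sigma>: "isCont \<sigma> 0" by (rule DERIV_isCont[OF \<sigma>(3)])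
    have "isCont (\<lambda>\<epsilon>. velocity c (\<sigma> \<epsilon>)) 0" "isCont (\<lambda>\<epsilon>. partials [1] ?B (\<sigma> \<epsilon>)) 0"
      using smooth_on_continuous[OF smooth_velocity] smooth_on_continuous[OF smooth_on_partial[OF smB]]
      by (intro isCont_o2[OF c\<sigma>] ct; simp add: \<sigma>(2) ct del: partials.simps)+
    then show ?thesis unfolding V_def displaced_velocity_def by (intro continuous_intros)
  qed
  have limV: "(V \<longlongrightarrow> ?T) (nhds 0)"
    using contV unfolding isCont_def tendsto_at_iff_tendsto_nhds by (simp only: V0)
  have evV: "\<forall>\<^sub>F \<epsilon> in nhds 0. V \<epsilon> \<noteq> 0" by (rule tendsto_imp_eventually_ne[OF limV T])
  have "((\<lambda>\<epsilon>. u' \<bullet> rot90 (V \<epsilon>)) \<longlongrightarrow> u' \<bullet> rot90 ?T) (nhds 0)"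
    by (intro tendsto_intros bounded_linear.tendsto[OF bounded_linear_rot90] limV)
  then have evc: "\<forall>\<^sub>F \<epsilon> in nhds 0. u' \<bullet> rot90 (V \<epsilon>) \<noteq> 0"
    by (rule tendsto_imp_eventually_ne) (use u'rot cross in simp)
  have R: "reflection c t L = line_through (c t) u'" by (simp add: reflection_eq_mirror u'_def)
  have pts: "deformed c N f \<epsilon> s \<in> points (line_through (c t) u') \<longleftrightarrow> A s + \<epsilon> * b s = 0" for \<epsilon> s
    by (simp add: points_def line_through_def deformed_eq A_def b_def inner_add_left inner_diff_left
        algebra_simps)
  have cc: "closest_crossing I (deformed c N f \<epsilon>) (line_through (c t) u') t = \<sigma> \<epsilon>" for \<epsilon>
    unfolding closest_crossing_def \<sigma>_def pts ..
  have map: "\<forall>\<^sub>F \<epsilon> in nhds 0. deformation_map I c N f \<epsilon> L =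
      line_through (deformed c N f \<epsilon> (\<sigma> \<epsilon>)) (mirror (V \<epsilon>) u')"
    using \<sigma>(1) evV evc
  proof eventually_elim
    case (elim \<epsilon>)
    let ?g = "deformed c N f \<epsilon>" and ?s = "\<sigma> \<epsilon>"
    have v: "velocity ?g ?s = V \<epsilon>" using velocity_deformed[OF f] elim(1) by (simp add: V_def)
    have nz: "velocity ?g ?s \<noteq> 0" using elim(2) v by simp
    have "?g ?s \<in> points (line_through (c t) u')" using pts elim(1) by blast
    then have "line_through (c t) u' \<in> lines_crossing ?g ?s"
      unfolding crosses_iff[OF nz] v using unit elim(3) by (simp add: line_through_def points_def)
    from inv_reflection[OF nz this]
    show ?case unfolding deformation_map_def Let_def t_def[symmetric] R cc v
      by (simp add: line_through_def)
  qed
  show ?thesis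
  proof (rule that[of \<sigma>])
    show "\<forall>\<^sub>F \<epsilon> in nhds 0. \<sigma> \<epsilon> \<in> I \<and> displaced_velocity f \<epsilon> (\<sigma> \<epsilon>) \<noteq> 0"
      using \<sigma>(1) evV by eventually_elim (simp add: V_def)
  qed (use \<sigma> map in \<open>simp_all add: b_def V_def\<close>)
qed

lemma chart_components:
  assumes "L \<in> P" "xw_chart I c e L = (\<tau>, q)"
  shows "\<tau> \<in> I" "c \<tau> \<bullet> rot90 (direction L) = snd L"
    "q = direction L \<bullet> velocity c \<tau> * (1 / area (\<tau>, q))"
  using crossing_parameter[OF assms(1)] assms(2)
  by (auto simp: chart_eq Let_def points_def area_def)

text \<open>Lines form a surface in a three-dimensional space, on which the chart is the restriction of a smooth
  function; this function transports differentiability along a curve of lines.\<close>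

lemma chart_curve_differentiable:
  assumes L: "\<Lambda> 0 \<in> P" and line: "\<And>\<epsilon>. \<Lambda> \<epsilon> \<in> oriented_lines"
    and d: "(\<Lambda> has_vector_derivative \<Lambda>') (at 0)"
  obtains X where "((\<lambda>\<epsilon>. xw_chart I c e (\<Lambda> \<epsilon>)) has_vector_derivative X) (at 0)"
    "\<forall>\<^sub>F \<epsilon> in nhds 0. \<Lambda> \<epsilon> \<in> P"
proof -
  obtain W where W: "open W" "P = oriented_lines \<inter> W"
    using domain unfolding openin_open by (auto simp: Int_commute)
  obtain U G where U: "open U" "\<Lambda> 0 \<in> U" "smooth_on U G" "\<And>y. y \<in> P \<inter> U \<Longrightarrow> G y = xw_chart I c e y"
    using chart(1) L unfolding diffeomorphism_def smooth_map_on_def by blast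
  have "isCont \<Lambda> 0" using d has_vector_derivative_continuous by blast
  then have lim: "(\<Lambda> \<longlongrightarrow> \<Lambda> 0) (nhds 0)" unfolding isCont_def tendsto_at_iff_tendsto_nhds .
  have evW: "\<forall>\<^sub>F \<epsilon> in nhds 0. \<Lambda> \<epsilon> \<in> W" using topological_tendstoD[OF lim W(1)] L W(2) by blast
  have evU: "\<forall>\<^sub>F \<epsilon> in nhds 0. \<Lambda> \<epsilon> \<in> U" by (rule topological_tendstoD[OF lim U(1,2)])
  have evP: "\<forall>\<^sub>F \<epsilon> in nhds 0. \<Lambda> \<epsilon> \<in> P" using evW by eventually_elim (use line W(2) in blast)
  have dG: "(G has_derivative frechet_derivative G (at (\<Lambda> 0))) (at (\<Lambda> 0))"
    by (rule smooth_on_derivative[OF U(3,2)])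
  have "((\<lambda>\<epsilon>. G (\<Lambda> \<epsilon>)) has_derivative (\<lambda>h. frechet_derivative G (at (\<Lambda> 0)) (h *\<^sub>R \<Lambda>'))) (at 0)"
    using diff_chain_at[OF d[unfolded has_vector_derivative_def] dG] by (simp add: o_def)
  then have "((\<lambda>\<epsilon>. G (\<Lambda> \<epsilon>)) has_vector_derivative frechet_derivative G (at (\<Lambda> 0)) \<Lambda>') (at 0)"
    unfolding has_vector_derivative_def by (simp add: linear_cmul[OF has_derivative_linear[OF dG]])
  moreover have "\<forall>\<^sub>F \<epsilon> in nhds 0. G (\<Lambda> \<epsilon>) = xw_chart I c e (\<Lambda> \<epsilon>)"
    using evU evP by eventually_elim (use U(4) in blast)
  ultimately have "((\<lambda>\<epsilon>. xw_chart I c e (\<Lambda> \<epsilon>)) has_vector_derivative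
      frechet_derivative G (at (\<Lambda> 0)) \<Lambda>') (at 0)"
    by (rule has_vector_derivative_eventually_cong)
  then show ?thesis using that evP by blast
qed

text \<open>Let \<open>\<sigma>\<close> be the parameter of the crossing of the reflected line with the deformed curve, and \<open>\<tau>\<close> that of
  the crossing of the resulting line with the original curve.  Differentiability being known, the
  velocity follows from three identities in \<open>\<epsilon>\<close>: the resulting line passes through both points, its
  direction has the same component along the deformed curve as the reflected direction, and \<open>q\<close> is a
  multiple of its component along the original curve.  The normal component of the acceleration
  cancels because \<open>\<tau>\<close> moves exactly twice as fast as \<open>\<sigma>\<close>.\<close>

lemma deformation_curve_derivative:
  assumes L: "L \<in> P" and f: "smooth_on I (f \<circ> c)"
  defines "t \<equiv> crossing_parameter I c L"
  defines "T \<equiv> velocity c t" and "u \<equiv> direction L"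
  defines "W \<equiv> u \<bullet> T" and "r \<equiv> u \<bullet> N (c t)"
  assumes \<mu>': "((\<lambda>s. 1 / (speed s * stretch s)) has_real_derivative \<mu>') (at t)"
  defines "X1 \<equiv> - (2 * f (c t) * W / (r * (T \<bullet> T)))"
  defines "X2 \<equiv> \<mu>' * X1 * W + 1 / (speed t * stretch t) *
      (- (2 * r * partials [1] (f \<circ> c) t) + X1 * (W / (T \<bullet> T)) * (T \<bullet> acceleration t))"
  shows "((\<lambda>\<epsilon>. xw_chart I c e (deformation_map I c N f \<epsilon> L)) has_vector_derivative (X1, X2)) (at 0)"
proof -
  let ?B = "displacement f" and ?n = "N (c t)"
  define u' where "u' = mirror T u"
  have t: "t \<in> I" using crossing_parameter[OF L] by (simp add: t_def)
  have ct: "c t \<bullet> rot90 u = snd L"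
    using crossing_parameter(2)[OF L] by (simp add: t_def u_def points_def)
  have T: "T \<noteq> 0" unfolding T_def by (rule velocity_nonzero[OF t])
  have r: "r > 0" using direction_decomposition(2)[OF L] by (simp add: r_def u_def t_def)
  have nn: "?n \<bullet> ?n = 1" "?n \<bullet> T = 0" "T \<bullet> ?n = 0"
    using normal_field(2)[OF t] by (auto simp: T_def norm_eq_1 inner_commute)
  obtain \<kappa> where \<kappa>: "\<kappa> \<noteq> 0" "\<kappa>\<^sup>2 = T \<bullet> T" "rot90 T = \<kappa> *\<^sub>R ?n" "rot90 ?n = (- 1 / \<kappa>) *\<^sub>R T"
    "\<And>x. x = (x \<bullet> T / \<kappa>\<^sup>2) *\<^sub>R T + (x \<bullet> ?n) *\<^sub>R ?n"
    using unit_normal_frame[of ?n T] normal_field(2)[OF t] T unfolding T_def by metis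
  have lin: "rot90 (x + y) = rot90 x + rot90 y" "rot90 (k *\<^sub>R x) = k *\<^sub>R rot90 x" for x y k
    by (simp_all add: rot90_def prod_eq_iff)
  have u: "u = (W / \<kappa>\<^sup>2) *\<^sub>R T + r *\<^sub>R ?n" using \<kappa>(5)[of u] by (simp add: W_def r_def)
  have u': "u' = u - (2 * r) *\<^sub>R ?n" unfolding u'_def mirror_frame[OF \<kappa>(1-3)] r_def ..
  have rot_u: "rot90 u = (W / \<kappa>) *\<^sub>R ?n - (r / \<kappa>) *\<^sub>R T"
    by (subst u) (simp add: lin \<kappa>(1,3,4) power2_eq_square)
  have rot_u': "rot90 u' = (W / \<kappa>) *\<^sub>R ?n + (r / \<kappa>) *\<^sub>R T"
  proof -
    have "u' = (W / \<kappa>\<^sup>2) *\<^sub>R T + (- r) *\<^sub>R ?n" unfolding u' by (subst u) (simp add: algebra_simps flip: scaleR_2)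
    then have "rot90 u' = (W / \<kappa>\<^sup>2) *\<^sub>R rot90 T + (- r) *\<^sub>R rot90 ?n" by (simp only: lin)
    then show ?thesis by (simp add: \<kappa>(1,3,4) power2_eq_square)
  qed
  have TT: "T \<bullet> T = \<kappa> * \<kappa>" using \<kappa>(2) by (simp add: power2_eq_square)
  have T_rot: "T \<bullet> rot90 u' = r * \<kappa>" "T \<bullet> rot90 u = - (r * \<kappa>)"
    unfolding rot_u rot_u' by (simp_all add: inner_add_right inner_diff_right nn TT \<kappa>(1))
  have B_rot: "?B t \<bullet> rot90 u' = f (c t) * W / \<kappa>" "?B t \<bullet> rot90 u = f (c t) * W / \<kappa>"
    unfolding rot_u rot_u' displacement_def by (simp_all add: inner_add_right inner_diff_right nn)
  obtain \<sigma> where \<sigma>: "\<sigma> 0 = t"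
    "(\<sigma> has_real_derivative - (?B t \<bullet> rot90 u' / (T \<bullet> rot90 u'))) (at 0)"
    "\<forall>\<^sub>F \<epsilon> in nhds 0. deformation_map I c N f \<epsilon> L =
      line_through (deformed c N f \<epsilon> (\<sigma> \<epsilon>)) (mirror (displaced_velocity f \<epsilon> (\<sigma> \<epsilon>)) u')"
    "\<forall>\<^sub>F \<epsilon> in nhds 0. \<sigma> \<epsilon> \<in> I \<and> displaced_velocity f \<epsilon> (\<sigma> \<epsilon>) \<noteq> 0"
    using deformation_map_curve[OF L f] unfolding t_def[symmetric] T_def[symmetric] u_def[symmetric]
      u'_def[symmetric] by blast
  define s1 where "s1 = - (f (c t) * W / (r * (T \<bullet> T)))"
  have s1: "- (?B t \<bullet> rot90 u' / (T \<bullet> rot90 u')) = s1"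
    unfolding B_rot T_rot s1_def TT by (simp add: field_simps)
  have d\<sigma>: "(\<sigma> has_vector_derivative s1) (at 0)"
    using \<sigma>(2) unfolding s1 has_real_derivative_iff_has_vector_derivative .
  have X1: "X1 = 2 * s1" by (simp add: X1_def s1_def)
  have smB: "smooth_on I ?B" by (rule smooth_displacement[OF f])
  define B1 where "B1 = partials [1] ?B t"
  have along: "((\<lambda>\<epsilon>. g (\<sigma> \<epsilon>)) has_vector_derivative s1 *\<^sub>R g') (at 0)"
    if "(g has_vector_derivative g') (at t)" for g :: "real \<Rightarrow> plane" and g'
    using vector_diff_chain_at[OF d\<sigma>, of g g'] that \<sigma>(1) by (simp add: o_def)
  have mult_id: "((\<lambda>\<epsilon>. \<epsilon> *\<^sub>R g (\<sigma> \<epsilon>)) has_vector_derivative g t) (at 0)"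
    if "(g has_vector_derivative g') (at t)" for g :: "real \<Rightarrow> plane" and g'
    using has_vector_derivative_scaleR[OF DERIV_ident along[OF that]] \<sigma>(1) by simp
  define p where "p = (\<lambda>\<epsilon>. deformed c N f \<epsilon> (\<sigma> \<epsilon>))"
  define V where "V = (\<lambda>\<epsilon>. displaced_velocity f \<epsilon> (\<sigma> \<epsilon>))"
  define V1 where "V1 = s1 *\<^sub>R acceleration t + B1"
  have p0: "p 0 = c t" and V0: "V 0 = T"
    by (simp_all add: p_def V_def deformed_eq displaced_velocity_def \<sigma>(1) T_def)
  have dp: "(p has_vector_derivative s1 *\<^sub>R T + ?B t) (at 0)"
    unfolding p_def deformed_eq T_def
    by (intro has_vector_derivative_add along has_velocity t
        mult_id[OF smooth_on_real_has_derivative[OF smB t]])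
  have dV: "(V has_vector_derivative V1) (at 0)"
    unfolding V_def displaced_velocity_def V1_def B1_def
    by (intro has_vector_derivative_add along has_acceleration t
        mult_id[OF smooth_on_real_has_derivative[OF smooth_on_partial[OF smB] t]]) simp
  obtain u1 where du: "((\<lambda>\<epsilon>. mirror (V \<epsilon>) u') has_vector_derivative u1) (at 0)"
    by (rule mirror_differentiable[OF dV]) (use V0 T in auto)
  have u0: "mirror (V 0) u' = u" unfolding V0 u'_def by (rule mirror_mirror[OF T])
  have inner_deriv: "((\<lambda>\<epsilon>. g \<epsilon> \<bullet> h \<epsilon>) has_vector_derivative g 0 \<bullet> h' + g' \<bullet> h 0) (at 0)"
    if "(g has_vector_derivative g') (at 0)" "(h has_vector_derivative h') (at 0)"
    for g h :: "real \<Rightarrow> plane" and g' h'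
    using has_derivative_inner[OF that[unfolded has_vector_derivative_def]]
    unfolding has_vector_derivative_def by (simp add: algebra_simps)
  have drot: "((\<lambda>\<epsilon>. rot90 (mirror (V \<epsilon>) u')) has_vector_derivative rot90 u1) (at 0)"
    by (rule bounded_linear.has_vector_derivative[OF bounded_linear_rot90 du])
  define \<Lambda> where "\<Lambda> = (\<lambda>\<epsilon>. line_through (p \<epsilon>) (mirror (V \<epsilon>) u'))"
  have d\<Lambda>: "(\<Lambda> has_vector_derivative (u1, p 0 \<bullet> rot90 u1 + (s1 *\<^sub>R T + ?B t) \<bullet> rot90 (mirror (V 0) u'))) (at 0)"
    unfolding \<Lambda>_def line_through_def
    by (intro has_vector_derivative_Pair du inner_deriv[OF dp drot])
  have \<Lambda>0: "\<Lambda> 0 = L" unfolding \<Lambda>_def line_through_def p0 u0 ct by (simp add: u_def)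
  have unit: "norm u' = 1"
    using mirror_inner(3)[OF T, of u] norm_direction[OF L] by (simp add: u'_def u_def norm_eq_1)
  have line: "\<Lambda> \<epsilon> \<in> oriented_lines" for \<epsilon>
  proof -
    have "norm (mirror v u') = 1" for v
      using mirror_inner(3)[of v u'] unit by (cases "v = 0") (auto simp: norm_eq_1 mirror_def)
    then show ?thesis by (simp add: \<Lambda>_def line_through_def oriented_lines_def)
  qed
  obtain X where X: "((\<lambda>\<epsilon>. xw_chart I c e (\<Lambda> \<epsilon>)) has_vector_derivative X) (at 0)"
    and evP: "\<forall>\<^sub>F \<epsilon> in nhds 0. \<Lambda> \<epsilon> \<in> P"
    by (rule chart_curve_differentiable[of \<Lambda>]) (use \<Lambda>0 L line d\<Lambda> in auto)
  define \<tau> where "\<tau> = (\<lambda>\<epsilon>. fst (xw_chart I c e (\<Lambda> \<epsilon>)))"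
  define q where "q = (\<lambda>\<epsilon>. snd (xw_chart I c e (\<Lambda> \<epsilon>)))"
  have d\<tau>: "(\<tau> has_vector_derivative fst X) (at 0)"
    unfolding \<tau>_def by (rule bounded_linear.has_vector_derivative[OF bounded_linear_fst X])
  have dq: "(q has_vector_derivative snd X) (at 0)"
    unfolding q_def by (rule bounded_linear.has_vector_derivative[OF bounded_linear_snd X])
  have \<tau>0: "\<tau> 0 = t" by (simp add: \<tau>_def \<Lambda>0 chart_eq Let_def t_def)
  have along_\<tau>: "((\<lambda>\<epsilon>. g (\<tau> \<epsilon>)) has_vector_derivative fst X *\<^sub>R g') (at 0)"
    if "(g has_vector_derivative g') (at t)" for g :: "real \<Rightarrow> plane" and g'
    using vector_diff_chain_at[OF d\<tau>, of g g'] that \<tau>0 by (simp add: o_def)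
  have comp: "\<forall>\<^sub>F \<epsilon> in nhds 0. c (\<tau> \<epsilon>) \<bullet> rot90 (mirror (V \<epsilon>) u') = p \<epsilon> \<bullet> rot90 (mirror (V \<epsilon>) u') \<and>
      q \<epsilon> = mirror (V \<epsilon>) u' \<bullet> velocity c (\<tau> \<epsilon>) * (1 / (speed (\<tau> \<epsilon>) * stretch (\<tau> \<epsilon>)))"
    using evP
  proof eventually_elim
    case (elim \<epsilon>)
    have "xw_chart I c e (\<Lambda> \<epsilon>) = (\<tau> \<epsilon>, q \<epsilon>)" by (simp add: \<tau>_def q_def)
    from chart_components[OF elim this] show ?case
      by (simp add: \<Lambda>_def line_through_def area_def)
  qed
  \<comment> \<open>The line passes through the crossing points with both curves.\<close>
  have "c t \<bullet> rot90 u1 + (fst X *\<^sub>R T) \<bullet> rot90 u = c t \<bullet> rot90 u1 + (s1 *\<^sub>R T + ?B t) \<bullet> rot90 u"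
    using vector_derivative_unique_if_eventually_eq[OF
        inner_deriv[OF along_\<tau>[OF has_velocity[OF t]] drot] inner_deriv[OF dp drot]
        eventually_mono[OF comp conjunct1]]
    unfolding \<tau>0 p0 u0 T_def .
  then have "fst X * - (r * \<kappa>) = s1 * - (r * \<kappa>) + f (c t) * W / \<kappa>"
    by (simp add: inner_add_left T_rot B_rot)
  then have fstX: "fst X = X1"
    unfolding X1 s1_def TT using r \<kappa>(1) by (simp add: field_simps)
  \<comment> \<open>A reflection preserves the component along the mirror.\<close>
  have "\<forall>\<^sub>F \<epsilon> in nhds 0. mirror (V \<epsilon>) u' \<bullet> V \<epsilon> = u' \<bullet> V \<epsilon>"
    using \<sigma>(4) by eventually_elim (simp add: V_def mirror_inner)
  from vector_derivative_unique_if_eventually_eq[OF inner_deriv[OF du dV]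
      inner_deriv[OF has_vector_derivative_const dV] this]
  have "u \<bullet> V1 + u1 \<bullet> T = u' \<bullet> V1" using u0 by (simp add: V0)
  then have "u1 \<bullet> T = - (2 * r) * (?n \<bullet> V1)" unfolding u' by (simp add: inner_diff_left)
  moreover have "?n \<bullet> B1 = partials [1] (f \<circ> c) t"
  proof -
    have dN: "((\<lambda>s. N (c s)) has_vector_derivative partials [1] (N \<circ> c) t) (at t)"
      using smooth_on_real_has_derivative[OF normal_field(1) t] by (simp add: o_def)
    have dF: "((\<lambda>s. f (c s)) has_vector_derivative partials [1] (f \<circ> c) t) (at t)"
      using smooth_on_real_has_derivative[OF f t] by (simp add: o_def)
    let ?N' = "partials [1] (N \<circ> c) t" and ?F' = "partials [1] (f \<circ> c) t"
    have "((\<lambda>s. N (c s) \<bullet> N (c s)) has_vector_derivative ?n \<bullet> ?N' + ?N' \<bullet> ?n) (at t)"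
      using has_derivative_inner[OF dN[unfolded has_vector_derivative_def] dN[unfolded has_vector_derivative_def]]
      unfolding has_vector_derivative_def by (simp add: algebra_simps)
    moreover have "\<forall>\<^sub>F s in nhds t. N (c s) \<bullet> N (c s) = 1"
      using eventually_nhds_in_open[OF open_I t]
      by eventually_elim (use normal_field(2) in \<open>simp add: norm_eq_1\<close>)
    ultimately have "?n \<bullet> ?N' + ?N' \<bullet> ?n = 0"
      using vector_derivative_unique_if_eventually_eq[OF _ has_vector_derivative_const] by blast
    then have nN: "?n \<bullet> ?N' = 0" by (simp add: inner_commute)
    have "(?B has_vector_derivative f (c t) *\<^sub>R ?N' + ?F' *\<^sub>R ?n) (at t)"
      unfolding displacement_def[abs_def]
      by (rule has_vector_derivative_scaleR[OF _ dN])
         (use dF in \<open>simp add: has_real_derivative_iff_has_vector_derivative\<close>)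
    then have "B1 = f (c t) *\<^sub>R ?N' + ?F' *\<^sub>R ?n"
      unfolding B1_def using smooth_on_real_has_derivative[OF smB t] vector_derivative_unique_at by blast
    then show ?thesis by (simp add: inner_add_right nN nn del: partials.simps)
  qed
  ultimately have u1T: "u1 \<bullet> T = - (2 * r) * (s1 * (?n \<bullet> acceleration t) + partials [1] (f \<circ> c) t)"
    by (simp add: V1_def inner_add_right del: partials.simps)
  \<comment> \<open>The coordinate \<open>q\<close> is the component of the direction along the curve, rescaled.\<close>
  have d\<mu>: "((\<lambda>\<epsilon>. 1 / (speed (\<tau> \<epsilon>) * stretch (\<tau> \<epsilon>))) has_real_derivative \<mu>' * fst X) (at 0)"
    using DERIV_chain2[of "\<lambda>s. 1 / (speed s * stretch s)" \<mu>' \<tau> 0 "fst X"] \<mu>' d\<tau> \<tau>0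
    by (simp add: has_real_derivative_iff_has_vector_derivative)
  have dW: "((\<lambda>\<epsilon>. mirror (V \<epsilon>) u' \<bullet> velocity c (\<tau> \<epsilon>)) has_real_derivative
      u \<bullet> (fst X *\<^sub>R acceleration t) + u1 \<bullet> T) (at 0)"
    using inner_deriv[OF du along_\<tau>[OF has_acceleration[OF t]]]
    unfolding u0 \<tau>0 T_def has_real_derivative_iff_has_vector_derivative .
  have "snd X = u \<bullet> T * (\<mu>' * fst X) + (u \<bullet> (fst X *\<^sub>R acceleration t) + u1 \<bullet> T) * (1 / (speed t * stretch t))"
    using vector_derivative_unique_if_eventually_eq[OF dq
        DERIV_mult'[OF dW d\<mu>, unfolded has_real_derivative_iff_has_vector_derivative]
        eventually_mono[OF comp conjunct2]]
    unfolding u0 \<tau>0 T_def .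
  moreover have "u \<bullet> acceleration t = W / (T \<bullet> T) * (T \<bullet> acceleration t) + r * (?n \<bullet> acceleration t)"
    by (subst u) (simp add: inner_add_left \<kappa>(2))
  ultimately have sndX: "snd X = X2"
    unfolding X2_def u1T fstX W_def[symmetric] by (simp add: X1 algebra_simps del: partials.simps)
  have "X = (X1, X2)" using fstX sndX by (simp add: prod_eq_iff)
  moreover have ev: "\<forall>\<^sub>F \<epsilon> in nhds 0. xw_chart I c e (\<Lambda> \<epsilon>) = xw_chart I c e (deformation_map I c N f \<epsilon> L)"
    using \<sigma>(3) by eventually_elim (simp add: \<Lambda>_def p_def V_def)
  ultimately show ?thesis using has_vector_derivative_eventually_cong[OF X ev] by simp
qed

lemma speed_derivative:
  assumes t: "t \<in> I"
  shows "speed t * partials [1] speed t = velocity c t \<bullet> acceleration t"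
proof -
  have ds: "(speed has_real_derivative partials [1] speed t) (at t)"
    using smooth_on_real_has_derivative[OF smooth_speed t]
    by (simp add: has_real_derivative_iff_has_vector_derivative)
  have "((\<lambda>t. speed t * speed t) has_vector_derivative
      speed t * partials [1] speed t + partials [1] speed t * speed t) (at t)"
    using DERIV_mult'[OF ds ds] unfolding has_real_derivative_iff_has_vector_derivative .
  moreover have "((\<lambda>t. speed t * speed t) has_vector_derivative
      velocity c t \<bullet> acceleration t + acceleration t \<bullet> velocity c t) (at t)"
    using has_derivative_inner[OF has_acceleration[OF t, unfolded has_vector_derivative_def]
        has_acceleration[OF t, unfolded has_vector_derivative_def]]
    unfolding has_vector_derivative_def speed_square by (simp add: algebra_simps)
  ultimately have "speed t * partials [1] speed t + partials [1] speed t * speed t =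
      velocity c t \<bullet> acceleration t + acceleration t \<bullet> velocity c t"
    by (rule vector_derivative_unique_at)
  then show ?thesis by (simp add: inner_commute[of "acceleration t"] mult.commute del: partials.simps)
qed

text \<open>With \<open>sine = W / v\<close> and \<open>cosine = r\<close> the velocity of the deformed line is the Hamiltonian field of
  \<open>-2 f cosine\<close>: the tangential acceleration is the derivative of the speed, and its contribution
  cancels against that of the speed in the density of the symplectic form.\<close>

theorem deformation_field_eq_hamiltonian_field:
  assumes f: "smooth_on I (f \<circ> c)" and z: "z \<in> D"
  shows "deformation_field I c N e P f z = Ham (\<lambda>z. - 2 * (f (c (fst z)) * cosine z)) z"
proof -
  obtain L where L: "L \<in> P" "the_inv_into P (xw_chart I c e) z = L"
    "crossing_parameter I c L = fst z"
    "stretch (fst z) * snd z = direction L \<bullet> velocity c (fst z) / speed (fst z)"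
    using point_of_line[OF z] by metis
  define t where "t = fst z"
  have t: "t \<in> I" using base[OF z] by (simp add: t_def I)
  let ?T = "velocity c t" and ?u = "direction L"
  define W where "W = ?u \<bullet> ?T"
  define r where "r = ?u \<bullet> N (c t)"
  define v where "v = speed t"
  define l where "l = stretch t"
  define v1 where "v1 = partials [1] speed t"
  define l1 where "l1 = partials [1] stretch t"
  define F where "F = f (c t)"
  define F1 where "F1 = partials [1] (f \<circ> c) t"
  have v: "v > 0" "?T \<bullet> ?T = v * v" "?T \<bullet> acceleration t = v * v1"
    using speed_pos[OF t] speed_square[of t] speed_derivative[OF t] by (simp_all add: v_def v1_def)
  have l: "l \<noteq> 0" unfolding l_def by (rule stretch_nonzero[OF t])
  have dec: "(W / v)\<^sup>2 + r\<^sup>2 = 1" "r > 0"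
    using direction_decomposition[OF L(1)] unfolding L(3) by (simp_all add: W_def r_def v_def t_def)
  have sine: "sine z = W / v" unfolding sine_def L(4) by (simp add: W_def v_def t_def)
  have "l * snd z = W / v" using L(4) by (simp add: W_def v_def l_def t_def)
  then have q: "snd z = W / (v * l)" using l v(1) by (simp add: field_simps)
  have "1 - (W / v)\<^sup>2 = r\<^sup>2" using dec(1) by simp
  then have cosine: "cosine z = r" unfolding cosine_def sine using dec(2) by simp
  have slope: "slope z = W / v / r" by (simp add: slope_def sine cosine)
  have dv: "(speed has_real_derivative v1) (at t)" "(stretch has_real_derivative l1) (at t)"
    using smooth_on_real_has_derivative[OF smooth_speed t] smooth_on_real_has_derivative[OF smooth_stretch t]
    by (simp_all add: has_real_derivative_iff_has_vector_derivative v1_def l1_def)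
  have "((\<lambda>s. 1 / (speed s * stretch s)) has_real_derivative
      (0 * (speed t * stretch t) - 1 * (speed t * l1 + v1 * stretch t)) /
      ((speed t * stretch t) * (speed t * stretch t))) (at t)"
    by (rule DERIV_divide[OF DERIV_const DERIV_mult'[OF dv]]) (use v l in \<open>simp add: v_def l_def\<close>)
  then have \<mu>': "((\<lambda>s. 1 / (speed s * stretch s)) has_real_derivative
      - ((v1 * l + v * l1) / ((v * l) * (v * l)))) (at t)"
    by (simp add: v_def l_def minus_divide_left add.commute)
  define X1 where "X1 = - (2 * F * W / (r * (v * v)))"
  define X2 where "X2 = - ((v1 * l + v * l1) / ((v * l) * (v * l))) * X1 * W + 1 / (v * l) *
      (- (2 * r * F1) + X1 * (W / (v * v)) * (v * v1))"
  have "((\<lambda>\<epsilon>. xw_chart I c e (deformation_map I c N f \<epsilon> L)) has_vector_derivative (X1, X2)) (at 0)"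
    using deformation_curve_derivative[OF L(1) f, unfolded L(3), folded t_def, OF \<mu>']
    unfolding W_def[symmetric] r_def[symmetric] v(2,3) F_def[symmetric] F1_def[symmetric]
      v_def[symmetric] l_def[symmetric] X1_def[symmetric] X2_def[symmetric] .
  then have lhs: "deformation_field I c N e P f z = (X1, X2)"
    unfolding deformation_field_def L(2) by (rule vector_derivative_at)
  have dF: "((\<lambda>s. - 2 * f (c s)) has_real_derivative - 2 * F1) (at t)"
    using DERIV_cmult[of "f \<circ> c" F1 t UNIV "- 2"] smooth_on_real_has_derivative[OF f t]
    by (simp add: has_real_derivative_iff_has_vector_derivative F1_def o_def del: partials.simps)
  have H: "(\<lambda>z. - 2 * (f (c (fst z)) * cosine z)) = (\<lambda>z. (- 2 * f (c (fst z))) * sqrt (1 - (sine z)\<^sup>2))"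
    by (simp add: cosine_def mult.assoc)
  note ps = partials_separated[OF z dF[unfolded t_def] cosine_profile_derivative[OF z]]
  have "1 / (v * l) * (- 2 * F * - (W / v / r) * l) = - X1"
    using v(1) l dec(2) unfolding X1_def by (simp add: field_simps)
  moreover have "1 / (v * l) * (- 2 * F1 * r + - 2 * F * - (W / v / r) * (l1 * (W / (v * l)))) = X2"
    using v(1) l dec(2) unfolding X2_def X1_def by (simp add: field_simps)
  ultimately show ?thesis
    unfolding lhs hamiltonian_field_def H ps area_def slope q cosine[unfolded cosine_def]
      t_def[symmetric] v_def[symmetric] l_def[symmetric] F_def[symmetric] l1_def[symmetric]
    by simp
qed

end

theorem theorem1p10:
  fixes a b :: real and I :: "real set" and c :: "real \<Rightarrow> plane" and e :: plane
    and N :: "plane \<Rightarrow> plane" and P :: "oriented_line set" and D :: "(real \<times> real) set"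
  assumes "a < b" and I: "I = {a<..<b}"
    and smooth: "smooth_on I c"
    and axis: "e \<in> Basis" "\<And>t. t \<in> I \<Longrightarrow> velocity c t \<bullet> e \<noteq> 0"
    and domain: "P \<noteq> {}" "openin (top_of_set oriented_lines) P" "connected P"
    and one_crossing: "\<And>L. L \<in> P \<Longrightarrow> \<exists>!t. t \<in> I \<and> c t \<in> points L"
    and transversal: "\<And>L t. L \<in> P \<Longrightarrow> t \<in> I \<Longrightarrow> c t \<in> points L \<Longrightarrow> L \<in> lines_crossing c t"
    and normal_field: "smooth_on I (N \<circ> c)"
      "\<And>t. t \<in> I \<Longrightarrow> norm (N (c t)) = 1 \<and> N (c t) \<bullet> velocity c t = 0"
    and normal_side: "\<And>L t. L \<in> P \<Longrightarrow> t \<in> I \<Longrightarrow> c t \<in> points L \<Longrightarrow> direction L \<bullet> N (c t) > 0"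
    and chart: "diffeomorphism P D (xw_chart I c e)" "open D" "contractible D"
  shows "C_infinity_dense D
           (generated_lie_algebra {deformation_field I c N e P f | f. smooth_on I (f \<circ> c)})
           (symplectic_fields D (exterior_derivative (liouville_form c e)))"
proof -
  interpret billiard_curve a b I c e N P D
    by unfold_locales (fact I smooth axis(2) domain(2) one_crossing normal_field normal_side chart)+
  show ?thesis
  proof (rule generated_lie_algebra_dense)
    fix F :: "real \<Rightarrow> real" assume F: "smooth_on {a<..<b} F"
    define f where "f = (\<lambda>x. F (inv_into I c x))"
    have fc: "f (c t) = F t" if "t \<in> I" for t
      using that curve_injective by (simp add: f_def)
    have sm: "smooth_on I (f \<circ> c)"
      by (rule smooth_on_cong[OF open_I _ F[folded I]]) (simp add: fc)
    have "deformation_field I c N e P f z = Ham (\<lambda>z. - 2 * (F (fst z) * cosine z)) z" if "z \<in> D" for z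
      unfolding deformation_field_eq_hamiltonian_field[OF sm that]
      by (rule hamiltonian_field_cong[OF chart(2) _ that]) (use base fc in \<open>simp add: I\<close>)
    with sm show "\<exists>X\<in>{deformation_field I c N e P f | f. smooth_on I (f \<circ> c)}.
        \<forall>z\<in>D. X z = Ham (\<lambda>z. - 2 * (F (fst z) * cosine z)) z" by blast
  next
    fix X assume "X \<in> {deformation_field I c N e P f | f. smooth_on I (f \<circ> c)}"
    then obtain f where f: "X = deformation_field I c N e P f" "smooth_on I (f \<circ> c)" by blast
    have "smooth_on D (\<lambda>z. - 2 * (f (c (fst z)) * cosine z))"
      using smooth_on_base[OF f(2)[unfolded I]]
      by (intro smooth_on_mult smooth_on_const smooth_on_cosine chart(2)) (simp add: o_def)
    with deformation_field_eq_hamiltonian_field[OF f(2)] f(1)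
    show "\<exists>H. smooth_on D H \<and> (\<forall>z\<in>D. X z = Ham H z)" by blast
  qed (rule area_form)
qed

end
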